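(* Let $K$ be a compact Hausdorff space, $\varphi$ a homeomorphism of $K$ into itself (continuous and injective) with $\varphi(K)\subsetneqq K$, and let $w\in C(K)$. Let $(Tf)(k)=w(k)f(\varphi(k))$ on $C(K)$, and put $L=\bigcap_{n=0}^\infty\varphi^n(K)$, $M=K\setminus\mathrm{Int}_K L$. Let $\lambda\in\sigma(T)\setminus\{0\}$. The operator $\lambda I-T$ is upper semi-Fredholm on $C(K)$ if and only if the following conditions are satisfied: (a) the operator $\lambda I-T$ is upper semi-Fredholm on $C(L)$; (b) the set $M$ is the union of two $\varphi$-invariant disjoint closed subsets $M_1$ and $M_2$ such that (c) if $M_1\neq\emptyset$ then $\rho(T,C(M_1))<|\lambda|$; (d) if $M_2\neq\emptyset$ (which is the case, in particular, if $\lambda\notin\sigma(T,C(L))$) then $T$ is invertible on $C(N_2)$, where $N_2=\bigcap_{n=0}^\infty\varphi^n(M_2)$, $|\lambda|<1/\rho(T^{-1},C(N_2))$, and the set $M_2\setminus\varphi(M_2)$ is finite. Moreover, in this case $$\dim\ker(\lambda I-T)=\dim\ker(\lambda I-T,C(L))+\mathrm{card}(M_2\setminus\varphi(M_2)).$$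
   Context: $C(K)$ is the Banach space of complex-valued continuous functions on $K$ with the sup norm. $\mathrm{Int}_K L$ is the interior of $L$ in $K$. A set $F$ is $\varphi$-invariant if $\varphi(F)\subseteq F$. For a closed $\varphi$-invariant set $F\subseteq K$ (such as $L$, $M$), the same formula $(Tf)(k)=w(k)f(\varphi(k))$, $k\in F$, defines an operator on $C(F)$, again denoted $T$; $\sigma(T,C(F))$, $\rho(T,C(F))$ denote its spectrum and spectral radius, $\rho(T^{-1},C(F))$ the spectral radius of its inverse on $C(F)$ when it is invertible there, and $\ker(\lambda I-T,C(F))$ the kernel of $\lambda I-T$ on $C(F)$. $\sigma(T)=\sigma(T,C(K))$. A bounded operator $A$ on a Banach space is upper semi-Fredholm if its range is closed and $\dim\ker A<\infty$. *)

theory Defs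
  imports "HOL-Analysis.Analysis" "HOL-Library.Function_Algebras"
begin

section \<open>Spaces of continuous functions on closed subsets\<close>

text \<open>
  The spaces \<open>C(F)\<close> for the various closed subsets \<open>F\<close> of one compact Hausdorff space \<open>X\<close> are
  all realised inside the complex vector space \<open>'a \<Rightarrow> complex\<close>: a function on \<open>F\<close> is
  represented by its extension by \<open>0\<close>, which is continuous on \<open>F\<close> but in general not on \<open>X\<close>.
  Addition and subtraction of functions are the pointwise ones of Function_Algebras.
\<close>

definition fscale :: "complex \<Rightarrow> ('a \<Rightarrow> complex) \<Rightarrow> 'a \<Rightarrow> complex" where
  "fscale c f = (\<lambda>x. c * f x)"

global_interpretation fun_vs: vector_space fscale
  by unfold_locales (auto simp: fscale_def fun_eq_iff algebra_simps)

definition C_space :: "'a topology \<Rightarrow> 'a set \<Rightarrow> ('a \<Rightarrow> complex) set" where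
  "C_space X F =
     {f. continuous_map (subtopology X F) euclidean f \<and> (\<forall>x. x \<notin> F \<longrightarrow> f x = 0)}"

text \<open>Elements of \<open>C_space X F\<close> vanish off \<open>F\<close>, so this is their sup norm on \<open>F\<close>; taking the
  supremum over the whole type also gives the right value \<open>0\<close> when \<open>F\<close> is empty. On a
  compact \<open>F\<close> all continuous functions are bounded; the value \<open>0\<close> for unbounded functions only serves to
  make \<open>sup_dist\<close> nonnegative everywhere, as \<open>Metric_space\<close> demands.\<close>

definition sup_norm :: "('a \<Rightarrow> complex) \<Rightarrow> real" where
  "sup_norm f =
     (if bdd_above (range (\<lambda>x. cmod (f x))) then SUP x. cmod (f x) else 0)"

abbreviation sup_dist :: "('a \<Rightarrow> complex) \<Rightarrow> ('a \<Rightarrow> complex) \<Rightarrow> real" where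
  "sup_dist f g \<equiv> sup_norm (f - g)"

lemma subspace_C_space: "fun_vs.subspace (C_space X F)"
proof -
  have "continuous_map (subtopology X F) euclidean (f + g)"
    if "continuous_map (subtopology X F) euclidean f" "continuous_map (subtopology X F) euclidean g"
    for f g :: "'a \<Rightarrow> complex"
    unfolding plus_fun_def using that by (rule continuous_map_add)
  moreover have "continuous_map (subtopology X F) euclidean (fscale c f)"
    if "continuous_map (subtopology X F) euclidean f" for c and f :: "'a \<Rightarrow> complex"
  proof -
    have "continuous_map (subtopology X F) euclidean ((\<lambda>z. c * z) \<circ> f)"
      by (rule continuous_map_compose[OF that]) (simp add: continuous_on_mult_left)
    then show ?thesis
      by (simp add: fscale_def o_def)
  qed
  moreover have "continuous_map (subtopology X F) euclidean (0 :: 'a \<Rightarrow> complex)"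
    by (simp add: zero_fun_def)
  ultimately show ?thesis
    unfolding fun_vs.subspace_def C_space_def by (simp add: fscale_def)
qed

lemma bdd_above_C_space:
  assumes "compactin X F" "f \<in> C_space X F"
  shows "bdd_above (range (\<lambda>x. cmod (f x)))"
proof -
  have F: "F \<subseteq> topspace X"
    using assms(1) compactin_subset_topspace by blast
  have "compact_space (subtopology X F)"
    using assms(1) by (simp add: compact_space_subtopology)
  then have "compactin (subtopology X F) F"
    using F by (simp add: compact_space_def inf.absorb2)
  moreover have "continuous_map (subtopology X F) euclidean f"
    using assms(2) by (simp add: C_space_def)
  ultimately have "compact (f ` F)"
    using image_compactin[of "subtopology X F" F euclidean f] by simp
  then obtain B where B: "\<And>x. x \<in> F \<Longrightarrow> cmod (f x) \<le> B"
    using compact_imp_bounded[of "f ` F"] by (auto simp: bounded_iff)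
  have "cmod (f x) \<le> max B 0" for x
    using B[of x] assms(2) by (cases "x \<in> F") (auto simp: C_space_def)
  then show ?thesis
    by (auto intro!: bdd_aboveI[where M = "max B 0"])
qed

lemma Metric_space_C_space:
  assumes "compactin X F"
  shows "Metric_space (C_space X F) sup_dist"
proof
  have bdd: "bdd_above (range (\<lambda>x. cmod ((f - g) x)))"
    if "f \<in> C_space X F" "g \<in> C_space X F" for f g
    using bdd_above_C_space[OF assms fun_vs.subspace_diff[OF subspace_C_space that]] .
  have le: "cmod (f x - g x) \<le> sup_dist f g"
    if "f \<in> C_space X F" "g \<in> C_space X F" for f g x
    using bdd[OF that] by (auto simp: sup_norm_def intro: cSUP_upper2)
  fix f g :: "'a \<Rightarrow> complex"
  show "0 \<le> sup_dist f g"
    by (auto simp: sup_norm_def intro: cSUP_upper2)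
  show "sup_dist f g = sup_dist g f"
    by (simp add: sup_norm_def norm_minus_commute)
  assume f: "f \<in> C_space X F" and g: "g \<in> C_space X F"
  show "sup_dist f g = 0 \<longleftrightarrow> f = g"
  proof
    assume "sup_dist f g = 0"
    with le[OF f g] show "f = g"
      by (auto simp: fun_eq_iff)
  qed (simp add: sup_norm_def)
  fix h assume h: "h \<in> C_space X F"
  have "cmod ((f - h) x) \<le> sup_dist f g + sup_dist g h" for x
  proof -
    have "cmod (f x - h x) \<le> cmod (f x - g x) + cmod (g x - h x)"
      using norm_triangle_ineq[of "f x - g x" "g x - h x"] by simp
    with le[OF f g, of x] le[OF g h, of x] show ?thesis
      by simp
  qed
  with bdd[OF f h] show "sup_dist f h \<le> sup_dist f g + sup_dist g h"
    by (auto simp: sup_norm_def[of "f - h"] intro: cSUP_least)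
qed

section \<open>Operator theory\<close>

text \<open>Here \<open>E\<close> is a linear subspace of \<open>'a \<Rightarrow> complex\<close> consisting of bounded functions and
  normed by \<open>sup_norm\<close>. Operators on \<open>E\<close> are maps on the whole function type of which
  only the restriction to \<open>E\<close> matters.\<close>

definition bounded_op :: "('a \<Rightarrow> complex) set \<Rightarrow> (('a \<Rightarrow> complex) \<Rightarrow> 'a \<Rightarrow> complex) \<Rightarrow> bool" where
  "bounded_op E A \<longleftrightarrow>
     A \<in> E \<rightarrow> E \<and>
     (\<forall>f\<in>E. \<forall>g\<in>E. A (f + g) = A f + A g) \<and>
     (\<forall>c. \<forall>f\<in>E. A (fscale c f) = fscale c (A f)) \<and>
     (\<exists>B. \<forall>f\<in>E. sup_norm (A f) \<le> B * sup_norm f)"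

definition op_invertible :: "('a \<Rightarrow> complex) set \<Rightarrow> (('a \<Rightarrow> complex) \<Rightarrow> 'a \<Rightarrow> complex) \<Rightarrow> bool" where
  "op_invertible E A \<longleftrightarrow>
     bounded_op E A \<and> (\<exists>S. bounded_op E S \<and> (\<forall>f\<in>E. S (A f) = f \<and> A (S f) = f))"

definition op_inverse ::
    "('a \<Rightarrow> complex) set \<Rightarrow> (('a \<Rightarrow> complex) \<Rightarrow> 'a \<Rightarrow> complex) \<Rightarrow> ('a \<Rightarrow> complex) \<Rightarrow> 'a \<Rightarrow> complex" where
  "op_inverse E A = inv_into E A"

text \<open>The operator \<open>z I - A\<close>.\<close>

definition shifted_op ::
    "complex \<Rightarrow> (('a \<Rightarrow> complex) \<Rightarrow> 'a \<Rightarrow> complex) \<Rightarrow> ('a \<Rightarrow> complex) \<Rightarrow> 'a \<Rightarrow> complex" where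
  "shifted_op z A = (\<lambda>f. fscale z f - A f)"

definition op_spectrum ::
    "('a \<Rightarrow> complex) set \<Rightarrow> (('a \<Rightarrow> complex) \<Rightarrow> 'a \<Rightarrow> complex) \<Rightarrow> complex set" where
  "op_spectrum E A = {z. \<not> op_invertible E (shifted_op z A)}"

definition op_spectral_radius ::
    "('a \<Rightarrow> complex) set \<Rightarrow> (('a \<Rightarrow> complex) \<Rightarrow> 'a \<Rightarrow> complex) \<Rightarrow> real" where
  "op_spectral_radius E A = (SUP z\<in>op_spectrum E A. cmod z)"

definition op_kernel ::
    "('a \<Rightarrow> complex) set \<Rightarrow> (('a \<Rightarrow> complex) \<Rightarrow> 'a \<Rightarrow> complex) \<Rightarrow> ('a \<Rightarrow> complex) set" where
  "op_kernel E A = {f \<in> E. A f = 0}"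

text \<open>The range is required to be closed in the norm topology of \<open>E\<close>.\<close>

definition upper_semi_Fredholm ::
    "('a \<Rightarrow> complex) set \<Rightarrow> (('a \<Rightarrow> complex) \<Rightarrow> 'a \<Rightarrow> complex) \<Rightarrow> bool" where
  "upper_semi_Fredholm E A \<longleftrightarrow>
     bounded_op E A \<and>
     closedin (Metric_space.mtopology E sup_dist) (A ` E) \<and>
     (\<exists>B. finite B \<and> op_kernel E A \<subseteq> fun_vs.span B)"

section \<open>Weighted composition operators\<close>

text \<open>The operator \<open>T\<close> on \<open>C(F)\<close>, for a \<open>\<phi>\<close>-invariant set \<open>F\<close>.\<close>

definition wcomp ::
    "('a \<Rightarrow> complex) \<Rightarrow> ('a \<Rightarrow> 'a) \<Rightarrow> 'a set \<Rightarrow> ('a \<Rightarrow> complex) \<Rightarrow> 'a \<Rightarrow> complex" where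
  "wcomp w \<phi> F f = (\<lambda>k. if k \<in> F then w k * f (\<phi> k) else 0)"

definition iterated_image_Inter :: "('a \<Rightarrow> 'a) \<Rightarrow> 'a set \<Rightarrow> 'a set" where
  "iterated_image_Inter \<phi> F = (\<Inter>n. (\<phi> ^^ n) ` F)"

text \<open>A splitting of \<open>M\<close> into a part \<open>M1\<close> on which the spectral radius of \<open>T\<close> is below \<open>|\<mu>|\<close> and a
  part \<open>M2\<close> on whose core \<open>N2\<close> the spectrum of \<open>T\<close> lies outside the disc of radius \<open>|\<mu>|\<close>.\<close>

definition Fredholm_splitting ::
    "'a topology \<Rightarrow> ('a \<Rightarrow> 'a) \<Rightarrow> ('a \<Rightarrow> complex) \<Rightarrow> complex \<Rightarrow> 'a set \<Rightarrow> 'a set \<Rightarrow> 'a set \<Rightarrow> bool" where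
  "Fredholm_splitting X \<phi> w \<mu> M M1 M2 \<longleftrightarrow>
     M = M1 \<union> M2 \<and> M1 \<inter> M2 = {} \<and>
     closedin X M1 \<and> closedin X M2 \<and> \<phi> ` M1 \<subseteq> M1 \<and> \<phi> ` M2 \<subseteq> M2 \<and>
     (M1 \<noteq> {} \<longrightarrow> op_spectral_radius (C_space X M1) (wcomp w \<phi> M1) < cmod \<mu>) \<and>
     (M2 \<noteq> {} \<longrightarrow>
        (let N2 = iterated_image_Inter \<phi> M2 in
           op_invertible (C_space X N2) (wcomp w \<phi> N2) \<and>
           cmod \<mu> < 1 / op_spectral_radius (C_space X N2) (op_inverse (C_space X N2) (wcomp w \<phi> N2)) \<and>
           finite (M2 - \<phi> ` M2)))"

end

theory Submission
  imports Defs "HOL-Complex_Analysis.Complex_Analysis"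
begin

text \<open>
  After division by \<open>\<mu>\<close> one studies \<open>D = 1 - T\<close> with weight \<open>v = w / \<mu>\<close>. Let \<open>J\<close> be the space of functions
  vanishing on \<open>L\<close>, so that \<open>C(K) / J = C(L)\<close>. Functions vanishing on some \<open>\<phi>\<^sup>m(K)\<close> are dense in \<open>J\<close> and
  \<open>T\<close> is nilpotent on them, hence \<open>D\<close> always has dense range in \<open>J\<close>. Therefore \<open>D\<close> is upper semi-Fredholm
  on \<open>C(K)\<close> iff it is so on \<open>C(L)\<close> and on \<open>J\<close> satisfies an estimate
  \<open>\<parallel>f\<parallel> \<le> C (\<parallel>D f\<parallel> + \<Sum>p\<in>P. \<bar>f p\<bar>)\<close> with a finite set \<open>P\<close> of points. If \<open>P\<close> is minimal, the kernel in \<open>J\<close> has a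
  basis dual to the evaluations at \<open>P\<close>, and kernel dimensions add up.

  The complement of \<open>L\<close> is the disjoint union of the orbits of the points of \<open>K - \<phi>(K)\<close>. Testing the estimate
  with functions supported on finite orbit segments shows that the products \<open>v(k) v(\<phi> k) \<dots> v(\<phi>\<^sup>n k)\<close> are
  uniformly summable along every orbit missing \<open>P\<close>, while along the orbits through \<open>P\<close>, which carry kernel
  functions decaying towards \<open>L\<close>, they grow geometrically; the closures of the two families of orbits are
  \<open>M\<^sub>1\<close> and \<open>M\<^sub>2\<close>. Conversely, contraction on \<open>M\<^sub>1\<close> and expansion near the core of \<open>M\<^sub>2\<close> give the estimate with
  one point on each of the finitely many orbits of \<open>M\<^sub>2\<close>.

  Spectral radii enter through the pointwise criterion that \<open>\<rho>(T) < s\<close> iff each \<open>k\<close> admits some \<open>n \<ge> 1\<close> with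
  \<open>\<bar>w(k) w(\<phi> k) \<dots> w(\<phi>\<^sup>n\<^sup>-\<^sup>1 k)\<bar> < s\<^sup>n\<close>.
\<close>

section \<open>Banach spaces of functions and a priori estimates\<close>

text \<open>Closed range is not visibly inherited by the invariant subspace \<open>J\<close>,
  whereas an estimate is; this is why the Fredholm property is first turned into one. Point values
  can carry the finite-dimensional defect because a finite-dimensional space of functions is
  determined by its values at finitely many points. Minimality of \<open>P\<close> matters twice: it
  supplies the dual kernel functions, and these forbid two points of \<open>P\<close> on one orbit.

  The two estimates for products have the form "the sum of the first n moduli is at most c" and "at
  most c times the n-th modulus", with one c for all orbits. Besides surviving limits, this form
  excludes the neutral case of products that neither decay nor grow: a common point of both closures
  would give n / c <= c for every n. The same comparison of n with c yields the strict contraction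
  and expansion which strict inequalities between spectral radii require.

  Spectral radii are suprema over the spectrum, so boundedness and nonemptiness of the spectrum have
  to be secured; scalar holomorphy of point values of the resolvent is enough for this.\<close>

lemma sup_norm_nonneg [simp]: "0 \<le> sup_norm f"
  by (auto simp: sup_norm_def intro: cSUP_upper2)

lemma sup_norm_le:
  assumes "\<And>x. cmod (f x) \<le> B"
  shows "sup_norm f \<le> B"
proof -
  have "bdd_above (range (\<lambda>x. cmod (f x)))"
    using assms by (intro bdd_aboveI[of _ B]) auto
  then show ?thesis
    using assms by (auto simp: sup_norm_def intro: cSUP_least)
qed

lemma sup_norm_zero [simp]: "sup_norm 0 = 0"
  by (simp add: sup_norm_def)

lemma sup_norm_zero' [simp]: "sup_norm (\<lambda>x. 0) = 0"
  by (simp add: sup_norm_def)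

lemma sup_norm_uminus [simp]: "sup_norm (- f) = sup_norm f"
  by (simp add: sup_norm_def)

lemma sum_fun_apply: "sum h I x = (\<Sum>i\<in>I. h i x)"
  for h :: "'i \<Rightarrow> 'a \<Rightarrow> complex"
  by (induction I rule: infinite_finite_induct) auto

lemma sup_norm_minus_commute: "sup_norm (f - g) = sup_norm (g - f)"
  by (simp add: sup_norm_def norm_minus_commute)

definition dual_family :: "'a set \<Rightarrow> ('a \<Rightarrow> 'a \<Rightarrow> complex) \<Rightarrow> bool" where
  "dual_family P e \<longleftrightarrow> (\<forall>p\<in>P. e p p = 1 \<and> (\<forall>q\<in>P - {p}. e p q = 0))"

lemma dual_family_sum:
  assumes "finite P" "dual_family P e" "q \<in> P"
  shows "(\<Sum>p\<in>P. fscale (c p) (e p)) q = c q"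
proof -
  have "(\<Sum>p\<in>P. fscale (c p) (e p)) q = (\<Sum>p\<in>P. c p * e p q)"
    by (simp add: fscale_def sum_fun_apply)
  also have "\<dots> = (\<Sum>p\<in>P. if p = q then c q else 0)"
    using assms(2,3) by (intro sum.cong) (auto simp: dual_family_def)
  finally show ?thesis using assms(1,3) by simp
qed

lemma dual_family_independent:
  assumes "finite P" "dual_family P e"
  shows "inj_on e P" "fun_vs.independent (e ` P)"
proof -
  show inj: "inj_on e P"
    using assms(2) unfolding dual_family_def by (intro inj_onI) (metis DiffI singletonD zero_neq_one)
  show "fun_vs.independent (e ` P)"
  proof (rule fun_vs.independent_if_scalars_zero)
    fix f x assume "(\<Sum>x\<in>e ` P. fscale (f x) x) = 0" and "x \<in> e ` P"
    then obtain p where p: "p \<in> P" "x = e p" and "(\<Sum>q\<in>P. fscale (f (e q)) (e q)) = 0"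
      by (auto simp: sum.reindex[OF inj])
    then show "f x = 0" using dual_family_sum[OF assms p(1), of "\<lambda>q. f (e q)"] by simp
  qed (use assms in simp)
qed

text \<open>\<open>sup_norm\<close> takes the default value 0 on unbounded functions, so boundedness
  must be assumed for it to be a norm. With completeness phrased by Cauchy sequences,
  \<open>C(F)\<close> and the subspace \<open>J\<close> of functions vanishing on \<open>L\<close>
  are instances alike.\<close>

locale fun_banach =
  fixes E :: "('a \<Rightarrow> complex) set"
  assumes sub: "fun_vs.subspace E"
    and bdd: "f \<in> E \<Longrightarrow> bdd_above (range (\<lambda>x. cmod (f x)))"
    and complete: "\<lbrakk>\<And>n::nat. s n \<in> E; \<And>e. e > 0 \<Longrightarrow> \<exists>N. \<forall>m\<ge>N. \<forall>n\<ge>N. sup_norm (s m - s n) \<le> e\<rbrakk>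
      \<Longrightarrow> \<exists>g\<in>E. (\<lambda>n. sup_norm (s n - g)) \<longlonglongrightarrow> 0"
begin

lemma mem_zero [simp]: "0 \<in> E" and mem_add: "f \<in> E \<Longrightarrow> g \<in> E \<Longrightarrow> f + g \<in> E"
  and mem_diff: "f \<in> E \<Longrightarrow> g \<in> E \<Longrightarrow> f - g \<in> E" and mem_scale: "f \<in> E \<Longrightarrow> fscale c f \<in> E"
  and mem_sum: "(\<And>i. i \<in> I \<Longrightarrow> h i \<in> E) \<Longrightarrow> sum h I \<in> E"
  using sub by (auto simp: fun_vs.subspace_0 fun_vs.subspace_add fun_vs.subspace_diff
      fun_vs.subspace_scale intro: fun_vs.subspace_sum)

lemma cmod_le: "f \<in> E \<Longrightarrow> cmod (f x) \<le> sup_norm f"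
  using bdd[of f] by (auto simp: sup_norm_def intro: cSUP_upper2)

lemma norm_add: "f \<in> E \<Longrightarrow> g \<in> E \<Longrightarrow> sup_norm (f + g) \<le> sup_norm f + sup_norm g"
  by (rule sup_norm_le) (auto intro: norm_triangle_le add_mono cmod_le)

lemma norm_diff: "f \<in> E \<Longrightarrow> g \<in> E \<Longrightarrow> sup_norm (f - g) \<le> sup_norm f + sup_norm g"
  by (rule sup_norm_le) (auto intro: norm_triangle_le_diff add_mono cmod_le)

lemma norm_scale: "f \<in> E \<Longrightarrow> sup_norm (fscale c f) \<le> cmod c * sup_norm f"
  by (rule sup_norm_le) (auto simp: fscale_def norm_mult intro: mult_left_mono cmod_le)

lemma norm_sum: "(\<And>i. i \<in> I \<Longrightarrow> h i \<in> E) \<Longrightarrow> sup_norm (sum h I) \<le> (\<Sum>i\<in>I. sup_norm (h i))"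
proof (induction I rule: infinite_finite_induct)
  case (insert i I)
  then have "h i \<in> E" "sum h I \<in> E" "sup_norm (sum h I) \<le> (\<Sum>i\<in>I. sup_norm (h i))"
    by (auto intro: mem_sum)
  then show ?case using norm_add[of "h i" "sum h I"] unfolding sum.insert[OF insert.hyps] by linarith
qed auto

lemma norm_eq_0: "f \<in> E \<Longrightarrow> sup_norm f \<le> 0 \<Longrightarrow> f = 0"
  using cmod_le[of f] by (metis norm_le_zero_iff order_trans zero_fun_apply ext)

text \<open>Vectors picked with error \<open>1 / Suc n\<close> lead, through an a priori estimate,
  to exactly this form of Cauchy bound.\<close>

lemma complete_rate:
  fixes s :: "nat \<Rightarrow> 'a \<Rightarrow> complex"
  assumes "\<And>n. s n \<in> E"
    and "\<And>m n. sup_norm (s m - s n) \<le> c * (1 / real (Suc m) + 1 / real (Suc n))"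
  shows "\<exists>g\<in>E. (\<lambda>n. sup_norm (s n - g)) \<longlonglongrightarrow> 0"
proof (rule complete[OF assms(1)])
  fix e :: real assume "e > 0"
  \<comment> \<open>\<open>c\<close> may be 0 or negative, while \<open>d\<close> can be divided
    by.\<close>
  define d where "d = max c 1"
  have d: "d \<ge> 1" "c \<le> d" by (auto simp: d_def)
  obtain N where N: "1 / real (Suc N) < e / (2 * d)"
    using reals_Archimedean[of "e / (2 * d)"] \<open>e > 0\<close> d by (auto simp: inverse_eq_divide)
  have "sup_norm (s m - s n) \<le> e" if "m \<ge> N" "n \<ge> N" for m n
  proof -
    have "1 / real (Suc m) \<le> 1 / real (Suc N)" "1 / real (Suc n) \<le> 1 / real (Suc N)"
      using that by (auto intro!: divide_left_mono)
    then have "1 / real (Suc m) + 1 / real (Suc n) \<le> 2 * (e / (2 * d))" using N by linarith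
    then have "d * (1 / real (Suc m) + 1 / real (Suc n)) \<le> d * (2 * (e / (2 * d)))"
      using d by (intro mult_left_mono) auto
    also have "\<dots> = e" using d by simp
    finally have "d * (1 / real (Suc m) + 1 / real (Suc n)) \<le> e" .
    moreover have "c * (1 / real (Suc m) + 1 / real (Suc n)) \<le> d * (1 / real (Suc m) + 1 / real (Suc n))"
      using d by (intro mult_right_mono) auto
    ultimately show ?thesis using assms(2)[of m n] by linarith
  qed
  then show "\<exists>N. \<forall>m\<ge>N. \<forall>n\<ge>N. sup_norm (s m - s n) \<le> e" by blast
qed

lemma Metric_space: "Metric_space E sup_dist"
proof
  fix f g :: "'a \<Rightarrow> complex"
  show "0 \<le> sup_dist f g" by simp
  show "sup_dist f g = sup_dist g f" by (rule sup_norm_minus_commute)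
  assume f: "f \<in> E" and g: "g \<in> E"
  then show "sup_dist f g = 0 \<longleftrightarrow> f = g"
    using norm_eq_0[of "f - g"] mem_diff by auto
  fix h assume h: "h \<in> E"
  show "sup_dist f h \<le> sup_dist f g + sup_dist g h"
    using norm_add[of "f - g" "g - h"] f g h mem_diff by simp
qed

text \<open>With the range of an operator as \<open>S\<close>, closedness becomes: whatever has
  approximate preimages has a preimage.\<close>

lemma closedin_iff:
  "closedin (Metric_space.mtopology E sup_dist) S \<longleftrightarrow>
    S \<subseteq> E \<and> (\<forall>g\<in>E. (\<forall>e>0. \<exists>f\<in>S. sup_norm (f - g) \<le> e) \<longrightarrow> g \<in> S)"
proof -
  interpret Metric_space E sup_dist by (rule Metric_space)
  have "closedin mtopology S \<longleftrightarrow> S \<subseteq> E \<and> mtopology closure_of S \<subseteq> S"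
    using closure_of_subset_eq[where X = mtopology] by simp
  also have "\<dots> \<longleftrightarrow> S \<subseteq> E \<and> (\<forall>g\<in>E. (\<forall>e>0. \<exists>f\<in>S. sup_norm (f - g) \<le> e) \<longrightarrow> g \<in> S)"
  proof (intro conj_cong refl)
    assume S: "S \<subseteq> E"
    have "g \<in> mtopology closure_of S \<longleftrightarrow> g \<in> E \<and> (\<forall>e>0. \<exists>f\<in>S. sup_norm (f - g) \<le> e)" for g
      unfolding metric_closure_of_alt using S by (fastforce simp: sup_norm_minus_commute[of _ g])
    then show "mtopology closure_of S \<subseteq> S \<longleftrightarrow> (\<forall>g\<in>E. (\<forall>e>0. \<exists>f\<in>S. sup_norm (f - g) \<le> e) \<longrightarrow> g \<in> S)"
      by blast
  qed
  finally show ?thesis .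
qed

lemma fun_banach_vanishing: "fun_banach {f \<in> E. \<forall>x\<in>Z. f x = 0}"
proof
  show "fun_vs.subspace {f \<in> E. \<forall>x\<in>Z. f x = 0}"
    using mem_scale by (auto simp: fun_vs.subspace_def mem_add) (auto simp: fscale_def)
  show "bdd_above (range (\<lambda>x. cmod (f x)))" if "f \<in> {f \<in> E. \<forall>x\<in>Z. f x = 0}" for f
    using that bdd by auto
  fix f :: "nat \<Rightarrow> 'a \<Rightarrow> complex"
  assume f: "\<And>n. f n \<in> {f \<in> E. \<forall>x\<in>Z. f x = 0}"
    and C: "\<And>e. e > 0 \<Longrightarrow> \<exists>N. \<forall>m\<ge>N. \<forall>n\<ge>N. sup_norm (f m - f n) \<le> e"
  obtain g where g: "g \<in> E" "(\<lambda>n. sup_norm (f n - g)) \<longlonglongrightarrow> 0"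
    using complete[of f] f C by auto
  have "g x = 0" if "x \<in> Z" for x
  proof -
    have "cmod (g x) \<le> sup_norm (f n - g)" for n
      using cmod_le[of "f n - g" x] f[of n] g(1) that mem_diff by auto
    then have "cmod (g x) \<le> 0"
      using g(2) by (intro LIMSEQ_le_const) auto
    then show ?thesis by simp
  qed
  then show "\<exists>g\<in>{f \<in> E. \<forall>x\<in>Z. f x = 0}. (\<lambda>n. sup_norm (f n - g)) \<longlonglongrightarrow> 0"
    using g by auto
qed

end

lemma fun_banach_C_space:
  assumes "compactin X F"
  shows "fun_banach (C_space X F)"
proof
  show "fun_vs.subspace (C_space X F)" by (rule subspace_C_space)
  show bdd: "bdd_above (range (\<lambda>x. cmod (f x)))" if "f \<in> C_space X F" for f
    using bdd_above_C_space[OF assms that] .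
  fix f :: "nat \<Rightarrow> 'a \<Rightarrow> complex"
  assume f: "\<And>n. f n \<in> C_space X F"
    and C: "\<And>e. e > 0 \<Longrightarrow> \<exists>N. \<forall>m\<ge>N. \<forall>n\<ge>N. sup_norm (f m - f n) \<le> e"
  have le: "cmod (f m x - f n x) \<le> sup_norm (f m - f n)" for m n x
    using bdd[OF fun_vs.subspace_diff[OF subspace_C_space f f], of m n]
    by (auto simp: sup_norm_def intro: cSUP_upper2)
  have "Cauchy (\<lambda>n. f n x)" for x
    unfolding Cauchy_altdef2 dist_norm
  proof (intro allI impI)
    fix e :: real assume "e > 0"
    then obtain N where N: "\<And>m n. m \<ge> N \<Longrightarrow> n \<ge> N \<Longrightarrow> sup_norm (f m - f n) \<le> e / 2"
      using C[of "e / 2"] by auto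
    have "cmod (f n x - f N x) < e" if "n \<ge> N" for n
      using le[of n x N] N[of n N] that \<open>e > 0\<close> by auto
    then show "\<exists>N. \<forall>n\<ge>N. cmod (f n x - f N x) < e" by blast
  qed
  then have "\<exists>l. (\<lambda>n. f n x) \<longlonglongrightarrow> l" for x
    using Cauchy_convergent_iff convergent_def by blast
  then obtain g where g: "\<And>x. (\<lambda>n. f n x) \<longlonglongrightarrow> g x" by metis
  have unif: "\<exists>N. \<forall>n\<ge>N. \<forall>x. cmod (f n x - g x) \<le> e" if e: "e > 0" for e
  proof -
    obtain N where N: "\<And>m n. m \<ge> N \<Longrightarrow> n \<ge> N \<Longrightarrow> sup_norm (f m - f n) \<le> e"
      using C[OF e] by metis
    have "cmod (f n x - g x) \<le> e" if "n \<ge> N" for n x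
    proof (rule LIMSEQ_le_const2)
      show "(\<lambda>m. cmod (f n x - f m x)) \<longlonglongrightarrow> cmod (f n x - g x)"
        by (intro tendsto_intros g)
      show "\<exists>N. \<forall>m\<ge>N. cmod (f n x - f m x) \<le> e"
        using le[of n x] N[OF that] order_trans by blast
    qed
    then show ?thesis by blast
  qed
  have "continuous_map (subtopology X F) Met_TC.mtopology g"
  proof (rule Met_TC.continuous_map_uniform_limit[where F = sequentially and f = f])
    show "\<forall>\<^sub>F \<xi> in sequentially. continuous_map (subtopology X F) Met_TC.mtopology (f \<xi>)"
      using f by (simp add: C_space_def mtopology_is_euclidean)
    fix e :: real assume "e > 0"
    then obtain N where "\<forall>n\<ge>N. \<forall>x. cmod (f n x - g x) \<le> e / 2"
      using unif[of "e / 2"] by auto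
    then have "\<forall>n\<ge>N. \<forall>x. cmod (f n x - g x) < e"
      using \<open>e > 0\<close> by (auto intro: order_le_less_trans[of _ "e / 2"])
    then show "\<forall>\<^sub>F n in sequentially. \<forall>x\<in>topspace (subtopology X F). g x \<in> UNIV \<and> dist (f n x) (g x) < e"
      unfolding eventually_sequentially dist_norm by blast
  qed auto
  moreover have "g x = 0" if "x \<notin> F" for x
    using g[of x] that f by (auto simp: C_space_def LIMSEQ_const_iff)
  ultimately have "g \<in> C_space X F"
    by (simp add: C_space_def mtopology_is_euclidean)
  moreover have "(\<lambda>n. sup_norm (f n - g)) \<longlonglongrightarrow> 0"
    unfolding LIMSEQ_def
  proof (intro allI impI)
    fix e :: real assume "e > 0"
    then obtain N where N: "\<forall>n\<ge>N. \<forall>x. cmod (f n x - g x) \<le> e / 2"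
      using unif[of "e / 2"] by auto
    have "sup_norm (f n - g) < e" if "n \<ge> N" for n
    proof -
      have "sup_norm (f n - g) \<le> e / 2"
        using N that by (intro sup_norm_le) auto
      then show ?thesis using \<open>e > 0\<close> by linarith
    qed
    then show "\<exists>N. \<forall>n\<ge>N. dist (sup_norm (f n - g)) 0 < e"
      by (intro exI[of _ N]) auto
  qed
  ultimately show "\<exists>g\<in>C_space X F. (\<lambda>n. sup_norm (f n - g)) \<longlonglongrightarrow> 0" by blast
qed

text \<open>A quantitative substitute for closed range with finite-dimensional kernel: the values at
  \<open>P\<close> absorb the kernel. For \<open>P = {}\<close> it says that \<open>A\<close> is
  bounded below.\<close>

definition apriori ::
    "('a \<Rightarrow> complex) set \<Rightarrow> (('a \<Rightarrow> complex) \<Rightarrow> 'a \<Rightarrow> complex) \<Rightarrow> 'a set \<Rightarrow> real \<Rightarrow> bool" where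
  "apriori E A P C \<longleftrightarrow> (\<forall>f\<in>E. sup_norm f \<le> C * (sup_norm (A f) + (\<Sum>p\<in>P. cmod (f p))))"

lemma apriori_mono:
  assumes "apriori E A P C" "C \<le> C'"
  shows "apriori E A P C'"
proof -
  have "C * (sup_norm (A f) + (\<Sum>p\<in>P. cmod (f p))) \<le> C' * (sup_norm (A f) + (\<Sum>p\<in>P. cmod (f p)))" for f
    using assms(2) by (intro mult_right_mono) (auto intro!: add_nonneg_nonneg sum_nonneg)
  with assms(1) show ?thesis
    unfolding apriori_def by (meson order_trans)
qed

text \<open>Dropping a point may cost a larger constant, but the set gets smaller each time, so the
  process stops.\<close>

lemma ex_minimal_apriori:
  assumes "finite P" "apriori E A P C"
  obtains P' C' where "P' \<subseteq> P" "apriori E A P' C'" "\<And>p c. p \<in> P' \<Longrightarrow> \<not> apriori E A (P' - {p}) c"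
proof -
  have "\<exists>P'\<subseteq>P. (\<exists>C. apriori E A P' C) \<and> (\<forall>p\<in>P'. \<forall>c. \<not> apriori E A (P' - {p}) c)"
    using assms
  proof (induction P arbitrary: C rule: finite_psubset_induct)
    case (psubset P)
    show ?case
    proof (cases "\<exists>p\<in>P. \<exists>c. apriori E A (P - {p}) c")
      case True
      then obtain p c where p: "p \<in> P" "apriori E A (P - {p}) c" by blast
      then have "P - {p} \<subset> P" by blast
      from psubset.IH[OF this p(2)] show ?thesis by blast
    next
      case False
      with psubset.prems show ?thesis by blast
    qed
  qed
  then show ?thesis using that by blast
qed

section \<open>Bounded operators satisfying an a priori estimate\<close>

locale fun_op = fun_banach E for E :: "('a \<Rightarrow> complex) set" +
  fixes A :: "('a \<Rightarrow> complex) \<Rightarrow> 'a \<Rightarrow> complex"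
  assumes bop: "bounded_op E A"
begin

lemma A_mem: "f \<in> E \<Longrightarrow> A f \<in> E" and A_add: "f \<in> E \<Longrightarrow> g \<in> E \<Longrightarrow> A (f + g) = A f + A g"
  and A_scale: "f \<in> E \<Longrightarrow> A (fscale c f) = fscale c (A f)"
  using bop by (auto simp: bounded_op_def)

lemma A_zero [simp]: "A 0 = 0"
  using A_add[of 0 0] by simp

lemma A_diff: "f \<in> E \<Longrightarrow> g \<in> E \<Longrightarrow> A (f - g) = A f - A g"
  using A_add[of "f - g" g] mem_diff[of f g] by simp

lemma A_sum: "(\<And>i. i \<in> I \<Longrightarrow> h i \<in> E) \<Longrightarrow> A (sum h I) = (\<Sum>i\<in>I. A (h i))"
proof (induction I rule: infinite_finite_induct)
  case (insert i I)
  then have "h i \<in> E" "sum h I \<in> E" "A (sum h I) = (\<Sum>i\<in>I. A (h i))"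
    by (auto intro: mem_sum)
  then show ?case using A_add[of "h i" "sum h I"] unfolding sum.insert[OF insert.hyps] by metis
qed auto

lemma A_bound: obtains B where "B > 0" "\<And>f. f \<in> E \<Longrightarrow> sup_norm (A f) \<le> B * sup_norm f"
proof -
  obtain B where B: "\<And>f. f \<in> E \<Longrightarrow> sup_norm (A f) \<le> B * sup_norm f"
    using bop unfolding bounded_op_def by blast
  have "sup_norm (A f) \<le> max B 1 * sup_norm f" if "f \<in> E" for f
    using B[OF that] mult_right_mono[of B "max B 1" "sup_norm f"] by auto
  then show ?thesis by (intro that[of "max B 1"]) auto
qed

lemma A_tendsto:
  assumes "\<And>n. f n \<in> E" "g \<in> E" "(\<lambda>n. sup_norm (f n - g)) \<longlonglongrightarrow> 0"
  shows "(\<lambda>n. sup_norm (A (f n) - A g)) \<longlonglongrightarrow> 0"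
proof -
  obtain B where B: "B > 0" "\<And>f. f \<in> E \<Longrightarrow> sup_norm (A f) \<le> B * sup_norm f" using A_bound by blast
  show ?thesis
  proof (rule tendsto_sandwich)
    show "(\<lambda>n. 0) \<longlonglongrightarrow> (0::real)" "(\<lambda>n. B * sup_norm (f n - g)) \<longlonglongrightarrow> 0"
      using tendsto_mult_right_zero[OF assms(3)] by auto
    show "\<forall>\<^sub>F n in sequentially. sup_norm (A (f n) - A g) \<le> B * sup_norm (f n - g)"
      using B(2)[OF mem_diff[OF assms(1,2)]] A_diff[OF assms(1,2)] by (intro always_eventually) auto
  qed (auto intro: always_eventually)
qed

lemma A_limit_eq:
  assumes "\<And>n. f n \<in> E" "g \<in> E" "(\<lambda>n. sup_norm (f n - g)) \<longlonglongrightarrow> 0"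
    and "h \<in> E" "(\<lambda>n. sup_norm (A (f n) - h)) \<longlonglongrightarrow> 0"
  shows "A g = h"
proof -
  have "sup_norm (A g - h) \<le> sup_norm (A (f n) - A g) + sup_norm (A (f n) - h)" for n
    using norm_diff[of "A (f n) - h" "A (f n) - A g"] assms A_mem mem_diff by auto
  moreover have "(\<lambda>n. sup_norm (A (f n) - A g) + sup_norm (A (f n) - h)) \<longlonglongrightarrow> 0"
    using tendsto_add[OF A_tendsto[OF assms(1-3)] assms(5)] by simp
  ultimately have "sup_norm (A g - h) \<le> 0"
    by (intro LIMSEQ_le_const) auto
  then show ?thesis
    using norm_eq_0[of "A g - h"] assms A_mem mem_diff by auto
qed

text \<open>A point that cannot be dropped from the estimate gives almost-kernel vectors normalised at
  that point; by the estimate itself they form a Cauchy sequence.\<close>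

lemma ex_dual_kernel_vector:
  assumes fin: "finite P" and ap: "apriori E A P C" and p: "p \<in> P"
    and min: "\<And>c. \<not> apriori E A (P - {p}) c"
  shows "\<exists>e\<in>E. A e = 0 \<and> e p = 1 \<and> (\<forall>q\<in>P - {p}. e q = 0)"
proof -
  define C' where "C' = max C 1"
  have C': "C' \<ge> 1" and ap': "apriori E A P C'"
    using apriori_mono[OF ap, of C'] by (auto simp: C'_def)
  let ?S = "\<lambda>f. sup_norm (A f) + (\<Sum>q\<in>P - {p}. cmod (f q))"
  have S0: "?S f \<ge> 0" for f by (intro add_nonneg_nonneg sum_nonneg) auto
  have bnd: "sup_norm f \<le> C' * (?S f + cmod (f p))" if "f \<in> E" for f
    using ap' that p fin unfolding apriori_def by (auto simp: sum.remove algebra_simps)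
  have "\<exists>h\<in>E. h p = 1 \<and> ?S h \<le> 1 / real (Suc n)" for n
  proof -
    \<comment> \<open>Failure of the estimate with this constant makes \<open>C' * ?S f\<close> at
      most half of the norm of \<open>f\<close>, so the other half is controlled by
      \<open>f p\<close>. The factor \<open>Suc n\<close> survives the normalisation at
      \<open>p\<close> and becomes the error.\<close>
    let ?c = "2 * C' * real (Suc n)"
    obtain f where f: "f \<in> E" "sup_norm f > ?c * ?S f"
      using min[of ?c] unfolding apriori_def by (auto simp: not_le)
    have c1: "?c \<ge> 2 * C'" using C' by (simp add: algebra_simps)
    have "2 * C' * ?S f \<le> ?c * ?S f" using c1 S0 by (rule mult_right_mono)
    then have "2 * C' * ?S f \<le> sup_norm f" using f(2) by linarith
    moreover have "sup_norm f \<le> C' * ?S f + C' * cmod (f p)"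
      using bnd[OF f(1)] by (simp only: distrib_left)
    ultimately have *: "sup_norm f \<le> 2 * C' * cmod (f p)" by linarith
    have pos: "sup_norm f > 0" 
    proof -
      have "?c * ?S f \<ge> 0" using S0[of f] C' by (intro mult_nonneg_nonneg) auto
      then show ?thesis using f(2) by linarith
    qed
    then have fp: "f p \<noteq> 0" using * by auto
    define h where "h = fscale (1 / f p) f"
    have "sup_norm (A h) \<le> cmod (1 / f p) * sup_norm (A f)"
      unfolding h_def A_scale[OF f(1)] by (rule norm_scale[OF A_mem[OF f(1)]])
    moreover have "(\<Sum>q\<in>P - {p}. cmod (h q)) = cmod (1 / f p) * (\<Sum>q\<in>P - {p}. cmod (f q))"
      by (simp add: h_def fscale_def norm_mult norm_divide sum_divide_distrib)
    ultimately have "?S h \<le> cmod (1 / f p) * ?S f" by (simp only: distrib_left)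
    also have "\<dots> = ?S f / cmod (f p)" by (simp only: norm_divide norm_one) (simp only: times_divide_eq_left mult_1)
    also have "\<dots> \<le> 1 / real (Suc n)"
    proof -
      have "?c * ?S f \<le> 2 * C' * cmod (f p)" using f(2) * by linarith
      then have "(2 * C') * (real (Suc n) * ?S f) \<le> (2 * C') * cmod (f p)" by (simp only: mult.assoc)
      then have "real (Suc n) * ?S f \<le> cmod (f p)" using C' by (subst (asm) mult_le_cancel_left_pos) auto
      then show ?thesis using fp by (simp add: divide_simps mult.commute)
    qed
    finally have "?S h \<le> 1 / real (Suc n)" .
    moreover have "h \<in> E" "h p = 1"
      unfolding h_def using f(1) fp by (auto simp: mem_scale) (simp add: fscale_def)
    ultimately show ?thesis by blast
  qed
  then obtain h where h: "\<And>n. h n \<in> E" "\<And>n. h n p = 1" "\<And>n. ?S (h n) \<le> 1 / real (Suc n)"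
    by metis
  have hA: "sup_norm (A (h n)) \<le> 1 / real (Suc n)" for n
    using h(3)[of n] sum_nonneg[of "P - {p}" "\<lambda>q. cmod (h n q)"] by auto
  have hq: "cmod (h n q) \<le> 1 / real (Suc n)" if "q \<in> P - {p}" for n q
  proof -
    have "cmod (h n q) \<le> (\<Sum>q\<in>P - {p}. cmod (h n q))"
      using that fin by (intro member_le_sum) auto
    then show ?thesis using h(3)[of n] sup_norm_nonneg[of "A (h n)"] by linarith
  qed
  have diff: "sup_norm (h m - h n) \<le> C' * (1 / real (Suc m) + 1 / real (Suc n))" for m n
  proof -
    have "?S (h m - h n) \<le> ?S (h m) + ?S (h n)"
    proof -
      have "sup_norm (A (h m - h n)) \<le> sup_norm (A (h m)) + sup_norm (A (h n))"
        using norm_diff A_diff A_mem h(1) by metis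
      moreover have "(\<Sum>q\<in>P - {p}. cmod ((h m - h n) q)) \<le> (\<Sum>q\<in>P - {p}. cmod (h m q)) + (\<Sum>q\<in>P - {p}. cmod (h n q))"
        unfolding sum.distrib[symmetric] by (intro sum_mono) (simp add: norm_triangle_ineq4)
      ultimately show ?thesis by linarith
    qed
    then have "?S (h m - h n) \<le> 1 / real (Suc m) + 1 / real (Suc n)"
      using h(3)[of m] h(3)[of n] by linarith
    then have "C' * (?S (h m - h n) + cmod ((h m - h n) p)) \<le> C' * (1 / real (Suc m) + 1 / real (Suc n))"
      using C' h(2) by (intro mult_left_mono) auto
    then show ?thesis using bnd[OF mem_diff[OF h(1) h(1)], of m n] by linarith
  qed
  from complete_rate[of h, OF h(1) diff]
  obtain e where e: "e \<in> E" "(\<lambda>n. sup_norm (h n - e)) \<longlonglongrightarrow> 0" by blast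
  have inv0: "(\<lambda>n. 1 / real (Suc n)) \<longlonglongrightarrow> 0"
    using LIMSEQ_inverse_real_of_nat by (simp add: inverse_eq_divide)
  have pt: "(\<lambda>n. h n x) \<longlonglongrightarrow> e x" for x
  proof -
    have "cmod (h n x - e x) \<le> sup_norm (h n - e)" for n
      using cmod_le[OF mem_diff[OF h(1) e(1)], of n x] by simp
    then have "(\<lambda>n. h n x - e x) \<longlonglongrightarrow> 0"
      using e(2) by (intro Lim_null_comparison[OF _ e(2)]) (auto intro: always_eventually)
    then show ?thesis using LIM_zero_iff by blast
  qed
  have "A e = 0"
  proof (rule A_limit_eq[OF h(1) e])
    show "(\<lambda>n. sup_norm (A (h n) - 0)) \<longlonglongrightarrow> 0"
      using hA by (intro Lim_null_comparison[OF _ inv0]) (auto intro: always_eventually)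
  qed auto
  moreover have "e p = 1" using pt[of p] h(2) by (simp add: LIMSEQ_const_iff)
  moreover have "e q = 0" if "q \<in> P - {p}" for q
  proof -
    have "(\<lambda>n. h n q) \<longlonglongrightarrow> 0"
      using hq[OF that] by (intro Lim_null_comparison[OF _ inv0]) (auto intro: always_eventually)
    then show ?thesis using pt[of q] LIMSEQ_unique by blast
  qed
  ultimately show ?thesis using e(1) by blast
qed

definition dual_system :: "'a set \<Rightarrow> ('a \<Rightarrow> 'a \<Rightarrow> complex) \<Rightarrow> bool" where
  "dual_system P e \<longleftrightarrow>
     dual_family P e \<and> (\<forall>p\<in>P. e p \<in> E \<and> A (e p) = 0)"

lemma ex_dual_system:
  assumes "finite P" "apriori E A P C"
  obtains P' C' e where "P' \<subseteq> P" "apriori E A P' C'" "dual_system P' e"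
proof -
  obtain P' C' where P': "P' \<subseteq> P" "apriori E A P' C'" "\<And>p c. p \<in> P' \<Longrightarrow> \<not> apriori E A (P' - {p}) c"
    using ex_minimal_apriori[OF assms] by blast
  then have "finite P'" using assms(1) finite_subset by blast
  then have "\<exists>e. \<forall>p\<in>P'. e p \<in> E \<and> A (e p) = 0 \<and> e p p = 1 \<and> (\<forall>q\<in>P' - {p}. e p q = 0)"
    using ex_dual_kernel_vector[OF _ P'(2) _ P'(3)] by (intro bchoice) blast
  then have "\<exists>e. dual_system P' e" unfolding dual_system_def dual_family_def by blast
  then show ?thesis using that P' by blast
qed

text \<open>Subtracting kernel vectors does not change the image, and duality cancels the values at
  \<open>P\<close>. For the corrected function the point terms of the estimate disappear.\<close>

lemma A_correction:
  assumes "finite P" "f \<in> E" and dual: "dual_system P e"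
  defines "f' \<equiv> f - (\<Sum>p\<in>P. fscale (f p) (e p))"
  shows "f' \<in> E" "A f' = A f" "\<And>q. q \<in> P \<Longrightarrow> f' q = 0"
proof -
  have e: "\<And>p. p \<in> P \<Longrightarrow> e p \<in> E \<and> A (e p) = 0" and fam: "dual_family P e"
    using dual by (auto simp: dual_system_def)
  have mem: "(\<Sum>p\<in>P. fscale (f p) (e p)) \<in> E" using e(1) by (intro mem_sum mem_scale) auto
  then show "f' \<in> E" unfolding f'_def using assms(2) by (intro mem_diff)
  have "A (\<Sum>p\<in>P. fscale (f p) (e p)) = (\<Sum>p\<in>P. A (fscale (f p) (e p)))"
    using e(1) by (intro A_sum mem_scale) auto
  also have "\<dots> = 0" using e(1) A_scale by (intro sum.neutral) (auto simp: fscale_def fun_eq_iff)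
  finally show "A f' = A f" unfolding f'_def using A_diff[OF assms(2) mem] by simp
  show "f' q = 0" if "q \<in> P" for q
    unfolding f'_def minus_apply dual_family_sum[OF assms(1) fam that, of f] by simp
qed

text \<open>After correction by the dual kernel vectors, approximate preimages vanish on the minimal
  set of points, so the estimate bounds their differences by those of their images and they
  converge.\<close>

lemma apriori_closed_range:
  assumes "finite P" "apriori E A P C"
    and g: "g \<in> E" "\<And>e. e > 0 \<Longrightarrow> \<exists>f\<in>E. sup_norm (A f - g) \<le> e"
  shows "g \<in> A ` E"
proof -
  obtain P' C' e where P': "P' \<subseteq> P" "apriori E A P' C'"
    and e: "dual_system P' e"
    using ex_dual_system[OF assms(1,2)] by blast
  define c where "c = max C' 1"
  have c: "c \<ge> 1" "apriori E A P' c" using apriori_mono[OF P'(2)] by (auto simp: c_def)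
  have finP': "finite P'" using P' assms(1) finite_subset by blast
  have "\<exists>f\<in>E. sup_norm (A f - g) \<le> 1 / real (Suc n) \<and> (\<forall>q\<in>P'. f q = 0)" for n
  proof -
    obtain f where f: "f \<in> E" "sup_norm (A f - g) \<le> 1 / real (Suc n)"
      using g(2)[of "1 / real (Suc n)"] by auto
    note corr = A_correction[OF finP' f(1) e]
    show ?thesis
    proof (intro bexI conjI ballI)
      show "sup_norm (A (f - (\<Sum>p\<in>P'. fscale (f p) (e p))) - g) \<le> 1 / real (Suc n)"
        unfolding corr(2) by (rule f(2))
    qed (use corr in \<open>auto simp only:\<close>)
  qed
  then obtain f where f: "\<And>n. f n \<in> E" "\<And>n. sup_norm (A (f n) - g) \<le> 1 / real (Suc n)"
    "\<And>n q. q \<in> P' \<Longrightarrow> f n q = 0" by metis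
  have diff: "sup_norm (f m - f n) \<le> c * (1 / real (Suc m) + 1 / real (Suc n))" for m n
  proof -
    have "sup_norm (A (f m - f n)) = sup_norm ((A (f m) - g) - (A (f n) - g))"
      using A_diff f(1) by simp
    also have "\<dots> \<le> sup_norm (A (f m) - g) + sup_norm (A (f n) - g)"
      using f(1) g(1) A_mem mem_diff by (intro norm_diff) auto
    finally have "sup_norm (A (f m - f n)) \<le> 1 / real (Suc m) + 1 / real (Suc n)"
      using f(2)[of m] f(2)[of n] by linarith
    then have "c * sup_norm (A (f m - f n)) \<le> c * (1 / real (Suc m) + 1 / real (Suc n))"
      using c by (intro mult_left_mono) auto
    moreover have "sup_norm (f m - f n) \<le> c * (sup_norm (A (f m - f n)) + (\<Sum>p\<in>P'. cmod ((f m - f n) p)))"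
      using c(2) mem_diff f(1) unfolding apriori_def by blast
    ultimately show ?thesis using f(3) by simp
  qed
  from complete_rate[of f, OF f(1) diff]
  obtain F where F: "F \<in> E" "(\<lambda>n. sup_norm (f n - F)) \<longlonglongrightarrow> 0" by blast
  have inv0: "(\<lambda>n. 1 / real (Suc n)) \<longlonglongrightarrow> 0"
    using LIMSEQ_inverse_real_of_nat by (simp add: inverse_eq_divide)
  have "A F = g"
    using f(2) by (intro A_limit_eq[OF f(1) F g(1)] Lim_null_comparison[OF _ inv0])
      (auto intro: always_eventually)
  then show ?thesis using F(1) by blast
qed

end

text \<open>Banach's open mapping theorem for \<open>A\<close> onto its closed range: Baire's
  theorem gives approximate solvability with norm control, and a geometric series of corrections
  makes it exact.\<close>

lemma (in fun_op) open_mapping: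
  assumes closed: "closedin (Metric_space.mtopology E sup_dist) (A ` E)"
  shows "\<exists>C\<ge>0. \<forall>f\<in>E. \<exists>f'\<in>E. A f' = A f \<and> sup_norm f' \<le> C * sup_norm (A f)"
proof -
  let ?R = "A ` E"
  have RE: "?R \<subseteq> E" using A_mem by auto
  have R_add: "y + z \<in> ?R" if "y \<in> ?R" "z \<in> ?R" for y z
    using that A_add mem_add by (smt (verit) image_iff)
  have R_diff: "y - z \<in> ?R" if "y \<in> ?R" "z \<in> ?R" for y z
    using that A_diff mem_diff by (smt (verit) image_iff)
  have R_scale: "fscale c y \<in> ?R" if "y \<in> ?R" for c y
    using that A_scale mem_scale by (smt (verit) image_iff)
  interpret E: Metric_space E sup_dist by (rule Metric_space)
  interpret R: Submetric E sup_dist ?R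
    by unfold_locales (rule RE)
  have "E.mcomplete"
    unfolding E.mcomplete_def
  proof (intro allI impI)
    fix \<sigma> assume \<sigma>: "E.MCauchy \<sigma>"
    have mem: "\<sigma> n \<in> E" for n using \<sigma> unfolding E.MCauchy_def by auto
    have "\<exists>g\<in>E. (\<lambda>n. sup_norm (\<sigma> n - g)) \<longlonglongrightarrow> 0"
    proof (rule complete[OF mem])
      fix e :: real assume "e > 0"
      then show "\<exists>N. \<forall>m\<ge>N. \<forall>n\<ge>N. sup_norm (\<sigma> m - \<sigma> n) \<le> e"
        using \<sigma> unfolding E.MCauchy_def by (meson less_imp_le)
    qed
    then obtain g where g: "g \<in> E" "(\<lambda>n. sup_norm (\<sigma> n - g)) \<longlonglongrightarrow> 0" by blast
    have "limitin E.mtopology \<sigma> g sequentially"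
      unfolding E.limitin_metric using g mem order_tendstoD(2)[OF g(2)] by (auto intro: always_eventually)
    then show "\<exists>x. limitin E.mtopology \<sigma> x sequentially" by blast
  qed
  then have Rc: "R.sub.mcomplete" using closed R.closedin_eq_mcomplete by blast
  \<comment> \<open>The range is complete, being closed, and is covered by the sets
    \<open>G n\<close>; so one of them has an interior point.\<close>
  define G where "G n = R.sub.mtopology closure_of {A f |f. f \<in> E \<and> sup_norm f \<le> real n}" for n
  have top: "topspace R.sub.mtopology = ?R" by simp
  have GR: "G n \<subseteq> ?R" for n unfolding G_def using closure_of_subset_topspace[of R.sub.mtopology] by auto
  have G_approx: "\<exists>f\<in>E. sup_norm f \<le> real n \<and> sup_norm (A f - y) < e" if "y \<in> G n" "e > 0" for n y e
  proof -
    have "\<exists>z\<in>{A f |f. f \<in> E \<and> sup_norm f \<le> real n}. z \<in> R.sub.mball y e"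
      using that unfolding G_def R.sub.metric_closure_of by blast
    then show ?thesis by (auto simp: sup_norm_minus_commute[of y])
  qed
  have "\<exists>n. R.sub.mtopology interior_of G n \<noteq> {}"
  proof (rule ccontr)
    assume "\<not> ?thesis"
    then have "R.sub.mtopology closure_of (?R - G n) = ?R" for n
      using closure_of_complement[of R.sub.mtopology "G n"] by simp
    moreover have "openin R.sub.mtopology (?R - G n)" for n
    proof -
      have "openin R.sub.mtopology (topspace R.sub.mtopology - G n)"
        unfolding G_def by (rule openin_diff[OF openin_topspace closedin_closure_of])
      then show ?thesis by (simp only: top)
    qed
    ultimately have "R.sub.mtopology closure_of (\<Inter>n. ?R - G n) = ?R"
      by (intro R.sub.metric_Baire_category[OF Rc]) auto
    moreover have "(\<Inter>n. ?R - G n) = {}"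
    proof -
      have "\<exists>n. y \<in> G n" if y: "y \<in> ?R" for y
      proof -
        obtain f where f: "f \<in> E" "y = A f" using y by blast
        obtain n where "sup_norm f \<le> real n" using real_arch_simple by blast
        then have "y \<in> {A f |f. f \<in> E \<and> sup_norm f \<le> real n}" using f by blast
        moreover have "{A f |f. f \<in> E \<and> sup_norm f \<le> real n} \<subseteq> topspace R.sub.mtopology" by auto
        ultimately show ?thesis unfolding G_def using closure_of_subset by blast
      qed
      then show ?thesis by auto
    qed
    ultimately have "?R = {}" by (simp only: closure_of_empty)
    then show False using mem_zero by blast
  qed
  then obtain n y0 where "y0 \<in> R.sub.mtopology interior_of G n" by blast
  then obtain r where y0: "y0 \<in> ?R" and r: "r > 0" "R.sub.mball y0 r \<subseteq> G n"
    unfolding R.sub.metric_interior_of by blast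
  \<comment> \<open>Subtracting approximate preimages of \<open>y0\<close> from those of
    \<open>y0 + y\<close> moves the ball from \<open>y0\<close> to the origin, at the price of
    doubling \<open>n\<close>.\<close>
  have small: "\<exists>f\<in>E. sup_norm f \<le> 2 * real n \<and> sup_norm (A f - y) \<le> e"
    if y: "y \<in> ?R" "sup_norm y < r" and e: "e > 0" for y e
  proof -
    have "sup_dist y0 (y0 + y) = sup_norm y"
      using sup_norm_minus_commute[of y0 "y0 + y"] by simp
    then have "y0 \<in> R.sub.mball y0 r" "y0 + y \<in> R.sub.mball y0 r"
      unfolding R.sub.in_mball using y0 r(1) y R_add[OF y0 y(1)] by (auto simp only:) simp
    then have "y0 \<in> G n" "y0 + y \<in> G n" using r(2) by blast+
    from G_approx[OF this(1), of "e/2"] G_approx[OF this(2), of "e/2"] e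
    obtain f g where f: "f \<in> E" "sup_norm f \<le> real n" "sup_norm (A f - y0) < e / 2"
      and g: "g \<in> E" "sup_norm g \<le> real n" "sup_norm (A g - (y0 + y)) < e / 2" by auto
    have "sup_norm (A (g - f) - y) = sup_norm ((A g - (y0 + y)) - (A f - y0))"
      unfolding A_diff[OF g(1) f(1)] by (rule arg_cong[where f = sup_norm]) (simp add: fun_eq_iff)
    also have "\<dots> \<le> sup_norm (A g - (y0 + y)) + sup_norm (A f - y0)"
      using f g y y0 RE by (intro norm_diff mem_diff mem_add A_mem) auto
    finally have "sup_norm (A (g - f) - y) \<le> e" using f g by linarith
    moreover have "sup_norm (g - f) \<le> 2 * real n" using norm_diff[OF g(1) f(1)] f g by linarith
    ultimately show ?thesis using mem_diff[OF g(1) f(1)] by blast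
  qed
  \<comment> \<open>\<open>2 * n\<close> from recentring the ball, and another factor
    \<open>2 / r\<close> from rescaling \<open>y\<close> to norm \<open>r / 2\<close>, strictly
    inside the ball.\<close>
  define c where "c = 4 * real n / r"
  have c0: "c \<ge> 0" using r by (simp add: c_def)
  have half: "\<exists>f\<in>E. sup_norm f \<le> c * sup_norm y \<and> sup_norm (y - A f) \<le> sup_norm y / 2"
    if y: "y \<in> ?R" for y
  proof (cases "sup_norm y = 0")
    case True
    then have "y = 0" using y RE norm_eq_0[of y] by auto
    then show ?thesis by (intro bexI[of _ 0]) auto
  next
    case False
    then have pos: "sup_norm y > 0" using sup_norm_nonneg[of y] by linarith
    define t where "t = r / (2 * sup_norm y)"
    have t: "t > 0" using pos r by (simp add: t_def)
    have yE: "y \<in> E" using y RE by auto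
    have "sup_norm (fscale (of_real t) y) \<le> t * sup_norm y" using norm_scale[OF yE, of "of_real t"] t by simp
    also have "\<dots> < r" using pos r by (simp add: t_def)
    finally obtain f where f: "f \<in> E" "sup_norm f \<le> 2 * real n"
      "sup_norm (A f - fscale (of_real t) y) \<le> t * sup_norm y / 2"
      using small[OF R_scale[OF y], of "of_real t" "t * sup_norm y / 2"] t pos by auto
    define h where "h = fscale (of_real (1 / t)) f"
    have "sup_norm h \<le> (1 / t) * sup_norm f" using norm_scale[OF f(1), of "of_real (1/t)"] t by (simp add: h_def norm_divide)
    also have "\<dots> \<le> (1 / t) * (2 * real n)" using f(2) t by (intro mult_left_mono) auto
    also have "\<dots> = c * sup_norm y" using r pos by (simp add: t_def c_def)
    finally have h1: "sup_norm h \<le> c * sup_norm y" .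
    have "A h - y = fscale (of_real (1/t)) (A f - fscale (of_real t) y)"
      unfolding h_def A_scale[OF f(1)] using t by (auto simp: fun_eq_iff fscale_def algebra_simps)
    then have "sup_norm (A h - y) \<le> (1/t) * sup_norm (A f - fscale (of_real t) y)"
      using norm_scale[of "A f - fscale (of_real t) y" "of_real (1/t)"] f yE t A_mem mem_diff mem_scale
      by (simp add: norm_divide)
    also have "\<dots> \<le> (1/t) * (t * sup_norm y / 2)" using f(3) t by (intro mult_left_mono) auto
    also have "\<dots> = sup_norm y / 2" using t by simp
    finally have h2: "sup_norm (A h - y) \<le> sup_norm y / 2" .
    moreover have "h \<in> E" unfolding h_def by (rule mem_scale[OF f(1)])
    ultimately show ?thesis using h1 by (intro bexI[of _ h]) (auto simp: sup_norm_minus_commute[of y])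
  qed
  have "\<exists>f'\<in>E. A f' = y \<and> sup_norm f' \<le> 2 * c * sup_norm y" if y: "y \<in> ?R" for y
  proof -
    obtain S where S: "\<And>y. y \<in> ?R \<Longrightarrow> S y \<in> E \<and> sup_norm (S y) \<le> c * sup_norm y \<and> sup_norm (y - A (S y)) \<le> sup_norm y / 2"
      using half by metis
    \<comment> \<open>The part of \<open>y\<close> still unsolved after \<open>n\<close>
      corrections; each correction halves it, and \<open>F n\<close> below collects them.\<close>
    define ys where "ys n = ((\<lambda>y. y - A (S y)) ^^ n) y" for n
    have ys_Suc: "ys (Suc n) = ys n - A (S (ys n))" for n by (simp add: ys_def)
    have ysR: "ys n \<in> ?R" for n
    proof (induction n)
      case 0 then show ?case using y by (simp add: ys_def)
    next
      case (Suc n) then show ?case unfolding ys_Suc using S by (intro R_diff) auto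
    qed
    have ysn: "sup_norm (ys n) \<le> sup_norm y / 2 ^ n" for n
    proof (induction n)
      case 0 then show ?case by (simp add: ys_def)
    next
      case (Suc n)
      have "sup_norm (ys (Suc n)) \<le> sup_norm (ys n) / 2" unfolding ys_Suc using S[OF ysR[of n]] by blast
      also have "\<dots> \<le> (sup_norm y / 2 ^ n) / 2" using Suc by (intro divide_right_mono) auto
      also have "\<dots> = sup_norm y / 2 ^ Suc n" by simp
      finally show ?case .
    qed
    define F where "F n = (\<Sum>i<n. S (ys i))" for n
    have FE: "F n \<in> E" for n unfolding F_def using S ysR by (intro mem_sum) auto
    have AF: "A (F n) = y - ys n" for n
    proof (induction n)
      case 0
      have "F 0 = 0" "ys 0 = y" unfolding F_def ys_def by (simp_all only: lessThan_0 sum.empty funpow_0)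
      then show ?case by (simp only: A_zero diff_self)
    next
      case (Suc n)
      have "F (Suc n) = F n + S (ys n)" by (simp add: F_def)
      then have "A (F (Suc n)) = A (F n) + A (S (ys n))" using A_add FE S ysR by simp
      then show ?case unfolding Suc ys_Suc[of n] by (rule trans) (simp add: fun_eq_iff)
    qed
    have Fd: "sup_norm (F m - F n) \<le> 2 * c * sup_norm y * (1 / 2 ^ n - 1 / 2 ^ m)" if "n \<le> m" for m n
      using that
    proof (induction m rule: dec_induct)
      case base
      then show ?case by simp
    next
      case (step m)
      have "F (Suc m) - F n = (F m - F n) + S (ys m)" by (simp add: F_def fun_eq_iff)
      moreover have "S (ys m) \<in> E" using S ysR by blast
      ultimately have "sup_norm (F (Suc m) - F n) \<le> sup_norm (F m - F n) + sup_norm (S (ys m))"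
        using norm_add[OF mem_diff[OF FE FE], of "S (ys m)" m n] by (simp only:)
      moreover have "sup_norm (S (ys m)) \<le> c * (sup_norm y / 2 ^ m)"
        using S[OF ysR[of m]] mult_left_mono[OF ysn[of m] c0] by linarith
      moreover have "2 * c * sup_norm y * (1 / 2 ^ n - 1 / 2 ^ m) + c * (sup_norm y / 2 ^ m)
          = 2 * c * sup_norm y * (1 / 2 ^ n - 1 / 2 ^ Suc m)" by (simp add: field_simps)
      ultimately show ?case using step.IH by linarith
    qed
    have Fd': "sup_norm (F m - F n) \<le> 2 * c * sup_norm y / 2 ^ n" if "n \<le> m" for m n
    proof -
      have "2 * c * sup_norm y * (1 / 2 ^ n - 1 / 2 ^ m) \<le> 2 * c * sup_norm y * (1 / 2 ^ n)"
        using c0 by (intro mult_left_mono) auto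
      then show ?thesis using Fd[OF that] by simp
    qed
    have pow: "1 / 2 ^ n \<le> 1 / real (Suc n)" for n
      using less_exp[of n] by (auto intro!: divide_left_mono simp: Suc_le_eq) (metis of_nat_Suc of_nat_le_iff of_nat_numeral of_nat_power Suc_leI less_exp)
    have "sup_norm (F m - F n) \<le> 2 * c * sup_norm y * (1 / real (Suc m) + 1 / real (Suc n))" for m n
    proof -
      have *: "2 * c * sup_norm y / 2 ^ k \<le> 2 * c * sup_norm y * (1 / real (Suc m) + 1 / real (Suc n))" if "k = m \<or> k = n" for k
      proof -
        have "1 / 2 ^ k \<le> 1 / real (Suc m) + 1 / real (Suc n)"
          using that pow[of k] by (auto intro: order_trans add_increasing add_increasing2)
        then have "2 * c * sup_norm y * (1 / 2 ^ k) \<le> 2 * c * sup_norm y * (1 / real (Suc m) + 1 / real (Suc n))"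
          using c0 by (intro mult_left_mono) auto
        then show ?thesis by simp
      qed
      show ?thesis
      proof (cases "n \<le> m")
        case True then show ?thesis using Fd'[OF True] *[of n] by linarith
      next
        case False
        then have "m \<le> n" by simp
        then show ?thesis using Fd'[OF \<open>m \<le> n\<close>] *[of m] sup_norm_minus_commute[of "F m" "F n"] by linarith
      qed
    qed
    from complete_rate[OF FE this] obtain f' where f': "f' \<in> E" "(\<lambda>n. sup_norm (F n - f')) \<longlonglongrightarrow> 0" by blast
    have yE: "y \<in> E" using y RE by auto
    have "A f' = y"
    proof (rule A_limit_eq[OF FE f' yE])
      have "sup_norm (A (F n) - y) \<le> sup_norm y * (1 / real (Suc n))" for n
      proof -
        have "y - A (F n) = ys n" unfolding AF by simp
        then have "sup_norm (A (F n) - y) = sup_norm (ys n)"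
          using sup_norm_minus_commute[of "A (F n)" y] by (simp only:)
        also have "\<dots> \<le> sup_norm y * (1 / 2 ^ n)" using ysn[of n] by simp
        also have "\<dots> \<le> sup_norm y * (1 / real (Suc n))" using pow by (intro mult_left_mono) auto
        finally show ?thesis .
      qed
      then have ev: "\<forall>\<^sub>F n in sequentially. norm (sup_norm (A (F n) - y)) \<le> sup_norm y * (1 / real (Suc n))"
        by (intro always_eventually allI) (simp only: real_norm_def abs_of_nonneg sup_norm_nonneg)
      have "(\<lambda>n. sup_norm y * (1 / real (Suc n))) \<longlonglongrightarrow> 0"
        using tendsto_mult_right_zero[OF LIMSEQ_inverse_real_of_nat] by (simp add: inverse_eq_divide)
      then show "(\<lambda>n. sup_norm (A (F n) - y)) \<longlonglongrightarrow> 0"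
        by (rule Lim_null_comparison[OF ev])
    qed
    moreover have "sup_norm f' \<le> 2 * c * sup_norm y"
    proof (rule LIMSEQ_le_const)
      show "(\<lambda>n. 2 * c * sup_norm y + sup_norm (F n - f')) \<longlonglongrightarrow> 2 * c * sup_norm y"
        using tendsto_add[OF tendsto_const f'(2)] by simp
      have "sup_norm f' \<le> 2 * c * sup_norm y + sup_norm (F n - f')" for n
      proof -
        have "sup_norm f' \<le> sup_norm (F n) + sup_norm (F n - f')"
        proof -
          have "F n - (F n - f') = f'" by (simp add: fun_eq_iff)
          then show ?thesis using norm_diff[OF FE[of n] mem_diff[OF FE f'(1)], of n] by (simp only:)
        qed
        moreover have "sup_norm (F n) \<le> 2 * c * sup_norm y" using Fd'[of 0 n] by (simp add: F_def)
        ultimately show ?thesis by linarith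
      qed
      then show "\<exists>N. \<forall>n\<ge>N. sup_norm f' \<le> 2 * c * sup_norm y + sup_norm (F n - f')" by blast
    qed
    ultimately show ?thesis using f'(1) by blast
  qed
  moreover have "0 \<le> 2 * c" using c0 by simp
  ultimately show ?thesis by blast
qed

text \<open>A dual family in \<open>N\<close> of greatest size reproduces every \<open>f\<close> in
  \<open>N\<close>. Otherwise the remainder vanishes on \<open>P\<close> but not at some
  \<open>x\<close>, and \<open>x\<close> can be added to the family; the size cannot exceed
  \<open>card B\<close> because dual families are independent.\<close>

lemma ex_interpolation_points:
  assumes sub: "fun_vs.subspace N" and "finite B" "N \<subseteq> fun_vs.span B"
  obtains P e where "finite P"
    "\<And>p. p \<in> P \<Longrightarrow> e p \<in> N"
    "\<And>f. f \<in> N \<Longrightarrow> f = (\<Sum>p\<in>P. fscale (f p) (e p))"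
proof -
  define Q where "Q k \<longleftrightarrow> (\<exists>P e. finite P \<and> card P = k \<and> dual_family P e \<and> e ` P \<subseteq> N)" for k
  have bound: "k \<le> card B" if Qk: "Q k" for k
  proof -
    obtain P e where P: "finite P" "card P = k" "dual_family P e" "e ` P \<subseteq> N"
      using Qk unfolding Q_def by blast
    have "card (e ` P) \<le> card B"
      using fun_vs.independent_span_bound[OF assms(2) dual_family_independent(2)[OF P(1,3)]] P(4) assms(3)
      by blast
    then show ?thesis using card_image[OF dual_family_independent(1)[OF P(1,3)]] P(2) by simp
  qed
  have "Q 0" unfolding Q_def by (intro exI[of _ "{}"]) (auto simp: dual_family_def)
  then have Qk: "Q (Greatest Q)" "\<And>k. Q k \<Longrightarrow> k \<le> Greatest Q"
    using bound GreatestI_nat[of Q 0 "card B"] Greatest_le_nat[of Q _ "card B"] by blast+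
  then obtain P e where P: "finite P" "card P = Greatest Q" "dual_family P e" "e ` P \<subseteq> N"
    unfolding Q_def by blast
  then have e: "\<forall>p\<in>P. e p \<in> N \<and> e p p = 1 \<and> (\<forall>q\<in>P - {p}. e p q = 0)"
    unfolding dual_family_def by blast
  have "f = (\<Sum>p\<in>P. fscale (f p) (e p))" if f: "f \<in> N" for f
  proof (rule ccontr)
    assume ne: "f \<noteq> (\<Sum>p\<in>P. fscale (f p) (e p))"
    define g where "g = f - (\<Sum>p\<in>P. fscale (f p) (e p))"
    have gN: "g \<in> N" unfolding g_def using f e sub
      by (intro fun_vs.subspace_diff fun_vs.subspace_sum fun_vs.subspace_scale) auto
    have gP: "g q = 0" if q: "q \<in> P" for q
      unfolding g_def minus_apply dual_family_sum[OF P(1,3) q, of f] by simp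
    have "g \<noteq> 0" using ne by (auto simp: g_def)
    then obtain x where x: "g x \<noteq> 0" by (auto simp: fun_eq_iff)
    then have xP: "x \<notin> P" using gP by blast
    define h where "h = fscale (1 / g x) g"
    have hN: "h \<in> N" unfolding h_def using gN sub by (intro fun_vs.subspace_scale)
    have h: "h x = 1" "\<And>q. q \<in> P \<Longrightarrow> h q = 0" using x gP by (auto simp: h_def fscale_def)
    \<comment> \<open>The old functions are made to vanish at the new point; their values on
      \<open>P\<close> stay, since \<open>h\<close> vanishes there.\<close>
    define e' where "e' p = (if p = x then h else e p - fscale (e p x) h)" for p
    have "e' p \<in> N \<and> e' p p = 1 \<and> (\<forall>q\<in>insert x P - {p}. e' p q = 0)" if p: "p \<in> insert x P" for p
    proof (cases "p = x")
      case True then show ?thesis using hN h by (auto simp: e'_def)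
    next
      case False
      then have "p \<in> P" using p by blast
      moreover have "e p - fscale (e p x) h \<in> N"
        using hN e \<open>p \<in> P\<close> sub by (intro fun_vs.subspace_diff fun_vs.subspace_scale) auto
      moreover have "e' p q = 0" if "q \<in> insert x P - {p}" for q
      proof (cases "q = x")
        case True then show ?thesis using False h by (simp add: e'_def fscale_def)
      next
        case False
        then have "e p q = 0" "h q = 0" using e \<open>p \<in> P\<close> that h by auto
        then show ?thesis using \<open>p \<noteq> x\<close> by (simp add: e'_def fscale_def)
      qed
      moreover have "e p p = 1" using e \<open>p \<in> P\<close> by blast
      moreover have e'p: "e' p = e p - fscale (e p x) h" unfolding e'_def by (rule if_not_P[OF False])
      moreover have "e' p p = e p p" unfolding e'p using h(2)[OF \<open>p \<in> P\<close>] by (simp add: fscale_def)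
      ultimately show ?thesis by metis
    qed
    then have "dual_family (insert x P) e'" "e' ` insert x P \<subseteq> N" unfolding dual_family_def by blast+
    then have "Q (card (insert x P))" unfolding Q_def using P(1) by blast
    then show False using Qk(2)[of "card (insert x P)"] P xP by simp
  qed
  then show ?thesis using that P e by metis
qed

context fun_op
begin

lemma subspace_kernel: "fun_vs.subspace (op_kernel E A)"
  using mem_add mem_scale A_add A_scale
  by (auto simp: fun_vs.subspace_def op_kernel_def fscale_def fun_eq_iff)

text \<open>\<open>open_mapping\<close> provides \<open>f'\<close> with the same image as
  \<open>f\<close> and controlled norm. The difference lies in the kernel and is therefore
  reproduced from its values at the interpolation points.\<close>

lemma upper_semi_Fredholm_imp_apriori:
  assumes "upper_semi_Fredholm E A"
  shows "\<exists>P C. finite P \<and> apriori E A P C"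
proof -
  obtain C where C: "C \<ge> 0" "\<And>f. f \<in> E \<Longrightarrow> \<exists>f'\<in>E. A f' = A f \<and> sup_norm f' \<le> C * sup_norm (A f)"
    using open_mapping assms unfolding upper_semi_Fredholm_def by blast
  obtain B where B: "finite B" "op_kernel E A \<subseteq> fun_vs.span B"
    using assms unfolding upper_semi_Fredholm_def by blast
  obtain P e where P: "finite P" and eN: "\<And>p. p \<in> P \<Longrightarrow> e p \<in> op_kernel E A"
    and rep: "\<And>f. f \<in> op_kernel E A \<Longrightarrow> f = (\<Sum>p\<in>P. fscale (f p) (e p))"
    using ex_interpolation_points[OF subspace_kernel B] by blast
  have e: "e p \<in> E" if "p \<in> P" for p using eN[OF that] by (simp add: op_kernel_def)
  define M where "M = (\<Sum>p\<in>P. sup_norm (e p))"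
  have M: "M \<ge> 0" "\<And>p. p \<in> P \<Longrightarrow> sup_norm (e p) \<le> M"
    unfolding M_def using P by (auto intro: sum_nonneg member_le_sum)
  \<comment> \<open>\<open>C\<close> bounds \<open>f'\<close>, \<open>M\<close> the contribution of
    the values of \<open>f\<close> on \<open>P\<close>, and the middle term that of the values of
    \<open>f'\<close> on \<open>P\<close>.\<close>
  define K where "K = C + M * real (card P) * C + M"
  have "sup_norm f \<le> K * (sup_norm (A f) + (\<Sum>p\<in>P. cmod (f p)))" if f: "f \<in> E" for f
  proof -
    obtain f' where f': "f' \<in> E" "A f' = A f" "sup_norm f' \<le> C * sup_norm (A f)" using C(2)[OF f] by blast
    define g where "g = f - f'"
    have "g \<in> op_kernel E A" using f f' A_diff mem_diff by (simp add: g_def op_kernel_def)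
    then have "sup_norm g = sup_norm (\<Sum>p\<in>P. fscale (g p) (e p))" using rep by metis
    also have "\<dots> \<le> (\<Sum>p\<in>P. sup_norm (fscale (g p) (e p)))" using e by (intro norm_sum mem_scale)
    also have "\<dots> \<le> (\<Sum>p\<in>P. M * (cmod (f p) + C * sup_norm (A f)))"
    proof (rule sum_mono)
      fix p assume p: "p \<in> P"
      have "sup_norm (fscale (g p) (e p)) \<le> cmod (g p) * sup_norm (e p)" by (rule norm_scale[OF e[OF p]])
      also have "\<dots> \<le> cmod (g p) * M" using M(2)[OF p] by (intro mult_left_mono) auto
      also have "\<dots> = M * cmod (g p)" by (rule mult.commute)
      finally have "sup_norm (fscale (g p) (e p)) \<le> M * cmod (g p)" .
      moreover have "cmod (g p) \<le> cmod (f p) + C * sup_norm (A f)"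
        using norm_triangle_ineq4[of "f p" "f' p"] cmod_le[OF f'(1), of p] f'(3) by (simp add: g_def)
      ultimately show "sup_norm (fscale (g p) (e p)) \<le> M * (cmod (f p) + C * sup_norm (A f))"
        using M(1) by (meson mult_left_mono order_trans)
    qed
    also have "\<dots> = M * (\<Sum>p\<in>P. cmod (f p)) + M * real (card P) * C * sup_norm (A f)"
      by (simp add: sum_distrib_left[symmetric] sum.distrib algebra_simps)
    finally have "sup_norm g \<le> \<dots>" .
    moreover have "sup_norm f \<le> sup_norm f' + sup_norm g"
      using norm_add[OF f'(1) mem_diff[OF f f'(1)]] by (simp add: g_def)
    ultimately have "sup_norm f \<le> C * sup_norm (A f) + (M * (\<Sum>p\<in>P. cmod (f p)) + M * real (card P) * C * sup_norm (A f))"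
      using f'(3) by linarith
    moreover have "0 \<le> (C + M * real (card P) * C) * (\<Sum>p\<in>P. cmod (f p)) + M * sup_norm (A f)"
      using C(1) M(1) by (intro add_nonneg_nonneg mult_nonneg_nonneg sum_nonneg) auto
    ultimately show ?thesis by (simp add: K_def algebra_simps)
  qed
  then have "apriori E A P K" unfolding apriori_def by blast
  then show ?thesis using P by blast
qed

text \<open>The bounded inverse theorem: \<open>op_invertible\<close> asks for a bounded inverse,
  and the bound comes from \<open>open_mapping\<close>.\<close>

lemma bij_imp_op_invertible:
  assumes inj: "\<And>f. f \<in> E \<Longrightarrow> A f = 0 \<Longrightarrow> f = 0" and surj: "E \<subseteq> A ` E"
  shows "op_invertible E A"
proof -
  have AE: "A ` E = E" using surj A_mem by auto
  have inj_on: "inj_on A E"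
  proof (rule inj_onI)
    fix f g assume fg: "f \<in> E" "g \<in> E" "A f = A g"
    have "f - g = 0" by (rule inj[OF mem_diff[OF fg(1,2)]]) (simp add: A_diff[OF fg(1,2)] fg(3))
    then show "f = g" by simp
  qed
  have "closedin (Metric_space.mtopology E sup_dist) (A ` E)"
    unfolding AE closedin_iff by simp
  then obtain C where C: "\<And>f. f \<in> E \<Longrightarrow> \<exists>f'\<in>E. A f' = A f \<and> sup_norm f' \<le> C * sup_norm (A f)"
    using open_mapping by blast
  have bnd: "sup_norm f \<le> C * sup_norm (A f)" if "f \<in> E" for f
    using C[OF that] inj_on that by (metis inj_onD)
  define S where "S = inv_into E A"
  have S: "S g \<in> E" "A (S g) = g" if "g \<in> E" for g
    using that AE unfolding S_def by (metis inv_into_into, metis f_inv_into_f)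
  have SA: "S (A f) = f" if "f \<in> E" for f using that inj_on unfolding S_def by simp
  have "bounded_op E S"
    unfolding bounded_op_def
  proof (intro conjI ballI allI)
    show "S \<in> E \<rightarrow> E" using S by auto
    show "S (f + g) = S f + S g" if "f \<in> E" "g \<in> E" for f g
      using SA[OF mem_add[OF S(1) S(1)]] A_add S that by metis
    show "S (fscale c f) = fscale c (S f)" if "f \<in> E" for c f
      using SA[OF mem_scale[OF S(1)]] A_scale S that by metis
    show "\<exists>B. \<forall>f\<in>E. sup_norm (S f) \<le> B * sup_norm f"
    proof (intro exI ballI)
      fix f assume "f \<in> E"
      then show "sup_norm (S f) \<le> C * sup_norm f" using bnd[OF S(1)] S(2) by simp
    qed
  qed
  then show ?thesis using bop S SA unfolding op_invertible_def by blast
qed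

end

lemma fun_op_scaled_diff:
  assumes "fun_op E A"
  shows "fun_op E (\<lambda>f. fscale a f - fscale b (A f))"
proof -
  interpret fun_op E A by (rule assms)
  obtain B where B: "B > 0" "\<And>f. f \<in> E \<Longrightarrow> sup_norm (A f) \<le> B * sup_norm f" using A_bound by blast
  show ?thesis
  proof
    show "bounded_op E (\<lambda>f. fscale a f - fscale b (A f))"
      unfolding bounded_op_def
    proof (intro conjI ballI allI)
      show "(\<lambda>f. fscale a f - fscale b (A f)) \<in> E \<rightarrow> E" using A_mem mem_diff mem_scale by auto
      show "\<exists>B. \<forall>f\<in>E. sup_norm (fscale a f - fscale b (A f)) \<le> B * sup_norm f"
      proof (intro exI ballI)
        fix f assume f: "f \<in> E"
        have "cmod b * sup_norm (A f) \<le> cmod b * (B * sup_norm f)" using B(2)[OF f] by (intro mult_left_mono) auto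
        then show "sup_norm (fscale a f - fscale b (A f)) \<le> (cmod a + cmod b * B) * sup_norm f"
          using norm_diff[OF mem_scale[OF f] mem_scale[OF A_mem[OF f]], of a b]
            norm_scale[OF f, of a] norm_scale[OF A_mem[OF f], of b]
          by (simp add: algebra_simps)
      qed
      show "fscale a (fscale c f) - fscale b (A (fscale c f)) = fscale c (fscale a f - fscale b (A f))"
        if "f \<in> E" for c f
        unfolding A_scale[OF that] by (simp add: fun_eq_iff fscale_def algebra_simps)
      show "fscale a (f + g) - fscale b (A (f + g)) = fscale a f - fscale b (A f) + (fscale a g - fscale b (A g))"
        if "f \<in> E" "g \<in> E" for f g
        unfolding A_add[OF that] by (simp add: fun_eq_iff fscale_def algebra_simps)
    qed
  qed
qed

lemma fun_op_id_minus: "fun_op E A \<Longrightarrow> fun_op E (\<lambda>f. f - A f)"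
  using fun_op_scaled_diff[of E A 1 1] by (simp add: fscale_def)

lemma fun_op_shifted: "fun_op E A \<Longrightarrow> fun_op E (shifted_op z A)"
  using fun_op_scaled_diff[of E A z 1] by (simp add: fscale_def shifted_op_def[abs_def])

lemma fun_op_scale: "fun_op E A \<Longrightarrow> fun_op E (\<lambda>f. fscale c (A f))"
  using fun_op_scaled_diff[of E A 0 "- c"] by (simp add: fscale_def fun_diff_def)

section \<open>Powers and Neumann series\<close>

lemma (in fun_op) pow_mem: "f \<in> E \<Longrightarrow> (A ^^ n) f \<in> E"
  by (induction n) (auto intro: A_mem)

lemma (in fun_op) pow_norm_le:
  assumes "B > 0" "\<And>f. f \<in> E \<Longrightarrow> sup_norm (A f) \<le> B * sup_norm f" "f \<in> E"
  shows "sup_norm ((A ^^ n) f) \<le> B ^ n * sup_norm f"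
proof (induction n)
  case (Suc n)
  have "sup_norm (A ((A ^^ n) f)) \<le> B * sup_norm ((A ^^ n) f)" by (rule assms(2)[OF pow_mem[OF assms(3)]])
  also have "\<dots> \<le> B * (B ^ n * sup_norm f)" using assms(1) Suc by (intro mult_left_mono) auto
  finally show ?case by (simp add: mult.assoc)
qed auto

lemma (in fun_op) telescope:
  assumes "f \<in> E"
  shows "(\<Sum>i<n. (A ^^ i) f) - A (\<Sum>i<n. (A ^^ i) f) = f - (A ^^ n) f"
proof (induction n)
  case 0
  show ?case unfolding lessThan_0 sum.empty A_zero by simp
next
  case (Suc n)
  have m: "(\<Sum>i<n. (A ^^ i) f) \<in> E" using assms pow_mem by (intro mem_sum) auto
  have "A (\<Sum>i<Suc n. (A ^^ i) f) = A (\<Sum>i<n. (A ^^ i) f) + A ((A ^^ n) f)"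
    unfolding sum.lessThan_Suc by (rule A_add[OF m pow_mem[OF assms]])
  then have "(\<Sum>i<Suc n. (A ^^ i) f) - A (\<Sum>i<Suc n. (A ^^ i) f) =
      ((\<Sum>i<n. (A ^^ i) f) + (A ^^ n) f) - (A (\<Sum>i<n. (A ^^ i) f) + A ((A ^^ n) f))"
    by (simp only: sum.lessThan_Suc)
  also have "\<dots> = ((\<Sum>i<n. (A ^^ i) f) - A (\<Sum>i<n. (A ^^ i) f)) + (A ^^ n) f - A ((A ^^ n) f)"
    by (simp add: fun_eq_iff)
  finally have "(\<Sum>i<Suc n. (A ^^ i) f) - A (\<Sum>i<Suc n. (A ^^ i) f) =
      ((\<Sum>i<n. (A ^^ i) f) - A (\<Sum>i<n. (A ^^ i) f)) + (A ^^ n) f - A ((A ^^ n) f)" .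
  then show ?case unfolding Suc by (simp only: diff_add_cancel funpow.simps o_def)
qed

text \<open>The companion of \<open>telescope\<close> with the powers applied after
  \<open>I - A\<close>: this one yields estimates, the other one preimages.\<close>

lemma (in fun_op) pow_commute_minus:
  assumes "f \<in> E"
  shows "(\<Sum>i<n. (A ^^ i) (f - A f)) = f - (A ^^ n) f"
proof (induction n)
  case (Suc n)
  have "(A ^^ n) (f - A f) = (A ^^ n) f - (A ^^ Suc n) f" for n
  proof (induction n)
    case (Suc n)
    have "(A ^^ Suc n) (f - A f) = A ((A ^^ n) f - (A ^^ Suc n) f)"
      unfolding Suc[symmetric] by simp
    then show ?case
      unfolding A_diff[OF pow_mem[OF assms] pow_mem[OF assms]] by (simp only: funpow.simps o_def)
  qed auto
  then show ?case unfolding sum.lessThan_Suc Suc by simp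
qed auto

text \<open>The contraction makes \<open>I - A\<close> bounded below. Neumann sums of length
  \<open>N * k\<close> are approximate preimages of \<open>g\<close>, and
  \<open>apriori_closed_range\<close> with no points turns them into a preimage.\<close>

lemma (in fun_op) power_contraction:
  assumes q: "q < 1" "\<And>f. f \<in> E \<Longrightarrow> sup_norm ((A ^^ N) f) \<le> q * sup_norm f"
  shows "\<And>f. f \<in> E \<Longrightarrow> f - A f = 0 \<Longrightarrow> f = 0" "\<And>g. g \<in> E \<Longrightarrow> \<exists>f\<in>E. f - A f = g"
proof -
  obtain B where B: "B > 0" "\<And>f. f \<in> E \<Longrightarrow> sup_norm (A f) \<le> B * sup_norm f" using A_bound by blast
  have Bn: "sup_norm ((A ^^ i) f) \<le> B ^ i * sup_norm f" if "f \<in> E" for i f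
    using B that by (rule pow_norm_le)
  define K where "K = (\<Sum>i<N. B ^ i) / (1 - q)"
  have est: "sup_norm f \<le> K * sup_norm (f - A f)" if f: "f \<in> E" for f
  proof -
    have d: "f - A f \<in> E" using f A_mem mem_diff by auto
    have "f = (\<Sum>i<N. (A ^^ i) (f - A f)) + (A ^^ N) f" using pow_commute_minus[OF f, of N] by simp
    then have "sup_norm f \<le> sup_norm (\<Sum>i<N. (A ^^ i) (f - A f)) + sup_norm ((A ^^ N) f)"
      using norm_add[of "\<Sum>i<N. (A ^^ i) (f - A f)" "(A ^^ N) f"] d f pow_mem mem_sum by (metis (no_types, lifting))
    also have "sup_norm (\<Sum>i<N. (A ^^ i) (f - A f)) \<le> (\<Sum>i<N. B ^ i * sup_norm (f - A f))"
      using norm_sum[of "{..<N}" "\<lambda>i. (A ^^ i) (f - A f)"] Bn[OF d] d pow_mem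
      by (meson order_trans sum_mono)
    finally have "sup_norm f \<le> (\<Sum>i<N. B ^ i) * sup_norm (f - A f) + q * sup_norm f"
      using q(2)[OF f] by (simp add: sum_distrib_right)
    then show ?thesis using q(1) by (simp add: K_def field_simps)
  qed
  show "f = 0" if "f \<in> E" "f - A f = 0" for f
    using est[OF that(1)] that norm_eq_0[OF that(1)] by simp
  interpret D: fun_op E "\<lambda>f. f - A f" by (rule fun_op_id_minus) unfold_locales
  have ap: "apriori E (\<lambda>f. f - A f) {} K" unfolding apriori_def using est by simp
  fix g assume g: "g \<in> E"
  have small: "sup_norm ((A ^^ (N * k)) g) \<le> (max q 0) ^ k * sup_norm g" for k
  proof (induction k)
    case (Suc k)
    have "sup_norm ((A ^^ (N * Suc k)) g) = sup_norm ((A ^^ N) ((A ^^ (N * k)) g))"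
      by (simp add: funpow_add)
    also have "\<dots> \<le> q * sup_norm ((A ^^ (N * k)) g)" by (rule q(2)[OF pow_mem[OF g]])
    also have "\<dots> \<le> max q 0 * sup_norm ((A ^^ (N * k)) g)" by (intro mult_right_mono) auto
    also have "\<dots> \<le> max q 0 * ((max q 0) ^ k * sup_norm g)" using Suc by (intro mult_left_mono) auto
    finally show ?case by (simp add: mult.assoc)
  qed auto
  have "g \<in> (\<lambda>f. f - A f) ` E"
  proof (rule D.apriori_closed_range[OF _ ap g])
    fix e :: real assume e: "e > 0"
    have "(\<lambda>k. (max q 0) ^ k * sup_norm g) \<longlonglongrightarrow> 0"
      using q(1) by (intro tendsto_mult_left_zero LIMSEQ_power_zero) auto
    then have "\<forall>\<^sub>F k in sequentially. (max q 0) ^ k * sup_norm g < e"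
      using e by (intro order_tendstoD)
    then obtain k where k: "(max q 0) ^ k * sup_norm g < e"
      using eventually_happens by force
    let ?f = "\<Sum>i<N * k. (A ^^ i) g"
    have "?f \<in> E" using g pow_mem by (intro mem_sum) auto
    moreover have "sup_norm ((?f - A ?f) - g) \<le> e"
    proof -
      have "sup_norm ((?f - A ?f) - g) = sup_norm ((A ^^ (N * k)) g)"
        unfolding telescope[OF g] using sup_norm_minus_commute[of "g - (A ^^ (N * k)) g" g] by simp
      then show ?thesis using small[of k] k by linarith
    qed
    ultimately show "\<exists>f\<in>E. sup_norm ((f - A f) - g) \<le> e" by blast
  qed auto
  then show "\<exists>f\<in>E. f - A f = g" by blast
qed

section \<open>Spectral radius of weighted composition operators\<close>

text \<open>The difference series represents 0, whose zeros are not isolated, so no coefficient of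
  positive index can differ. The constant term is compared directly at 0.\<close>

lemma powser_unique:
  fixes a b :: "nat \<Rightarrow> complex"
  assumes r: "r > 0"
    and a: "\<And>z. cmod z < r \<Longrightarrow> (\<lambda>n. a n * z ^ n) sums f z"
    and b: "\<And>z. cmod z < r \<Longrightarrow> (\<lambda>n. b n * z ^ n) sums f z"
  shows "a = b"
proof -
  have c: "(\<lambda>n. (a n - b n) * (z - 0) ^ n) sums 0" if "norm (z - 0) < r" for z
    using sums_diff[OF a[of z] b[of z]] that by (simp add: left_diff_distrib)
  have "a m = b m" for m
  proof (cases "m = 0")
    case True
    have "(\<lambda>n. (a n - b n) * 0 ^ n) sums 0" using c[of 0] r by simp
    then show ?thesis using True powser_sums_zero[of "\<lambda>n. a n - b n"] sums_unique2 by fastforce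
  next
    case False
    show ?thesis
    proof (rule ccontr)
      assume "a m \<noteq> b m"
      show False
      proof (rule powser_0_nonzero[where f = "\<lambda>_. 0" and a = "\<lambda>n. a n - b n" and \<xi> = 0 and r = r and m = m])
        fix s :: real
        assume s: "0 < s" "\<And>z::complex. z \<in> cball 0 s - {0} \<Longrightarrow> (0::complex) \<noteq> 0"
        have "of_real s \<in> cball (0::complex) s - {0}" using s(1) by simp
        then show False using s(2) by blast
      qed (use r c False \<open>a m \<noteq> b m\<close> in auto)
    qed
  qed
  then show ?thesis by blast
qed

lemma has_field_derivative_quadratic_bound:
  fixes f :: "complex \<Rightarrow> complex"
  assumes "d > 0" "\<And>z. cmod (z - x) < d \<Longrightarrow> cmod (f z - f x - (z - x) * D) \<le> M * (cmod (z - x))\<^sup>2"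
  shows "(f has_field_derivative D) (at x)"
proof -
  have "((\<lambda>z. (f z - f x) / (z - x) - D) \<longlongrightarrow> 0) (at x)"
  proof (rule Lim_null_comparison)
    show "\<forall>\<^sub>F z in at x. norm ((f z - f x) / (z - x) - D) \<le> M * cmod (z - x)"
      unfolding eventually_at
    proof (intro exI[of _ d] conjI ballI impI assms(1))
      fix z assume z: "z \<noteq> x \<and> dist z x < d"
      then have "(f z - f x) / (z - x) - D = (f z - f x - (z - x) * D) / (z - x)"
        by (simp add: field_simps)
      then have "norm ((f z - f x) / (z - x) - D) = cmod (f z - f x - (z - x) * D) / cmod (z - x)"
        by (simp add: norm_divide)
      also have "\<dots> \<le> M * (cmod (z - x))\<^sup>2 / cmod (z - x)"
        using assms(2)[of z] z by (intro divide_right_mono) (auto simp: dist_norm)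
      also have "\<dots> = M * cmod (z - x)" using z by (simp add: power2_eq_square)
      finally show "norm ((f z - f x) / (z - x) - D) \<le> M * cmod (z - x)" .
    qed
    show "((\<lambda>z. M * cmod (z - x)) \<longlongrightarrow> 0) (at x)"
      by (auto intro!: tendsto_eq_intros)
  qed
  then show ?thesis
    unfolding has_field_derivative_iff using LIM_zero_iff by blast
qed

section \<open>Decay of powers from the existence of resolvents\<close>

context fun_op
begin

lemma pow_add: "f \<in> E \<Longrightarrow> g \<in> E \<Longrightarrow> (A ^^ n) (f + g) = (A ^^ n) f + (A ^^ n) g"
  by (induction n) (auto simp: A_add pow_mem simp del: plus_fun_apply)

lemma pow_scale: "f \<in> E \<Longrightarrow> (A ^^ n) (fscale c f) = fscale c ((A ^^ n) f)"
  by (induction n) (auto simp: A_scale pow_mem)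

text \<open>In the variable \<open>\<zeta> = 1 / z\<close> the resolvent equation
  \<open>h - \<zeta> A h = g\<close> remains meaningful at \<open>\<zeta> = 0\<close>, the point at
  infinity of the \<open>z\<close>-plane. Solvability and a norm bound are all that is used of the
  inverse.\<close>

lemma op_invertible_shifted_imp:
  assumes "op_invertible E (shifted_op z A)" "z \<noteq> 0"
  shows "\<exists>K>0. (\<forall>h\<in>E. sup_norm h \<le> K * sup_norm (h - fscale (1 / z) (A h))) \<and>
    (\<forall>g\<in>E. \<exists>h\<in>E. h - fscale (1 / z) (A h) = g)"
proof -
  obtain S where S: "bounded_op E S" "\<forall>f\<in>E. S (shifted_op z A f) = f \<and> shifted_op z A (S f) = f"
    using assms(1) unfolding op_invertible_def by blast
  obtain K0 where K0: "\<forall>f\<in>E. sup_norm (S f) \<le> K0 * sup_norm f"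
    using S(1) unfolding bounded_op_def by blast
  define K1 where "K1 = max K0 1"
  have K1: "K1 > 0" "\<And>f. f \<in> E \<Longrightarrow> sup_norm (S f) \<le> K1 * sup_norm f"
  proof -
    show "K1 > 0" by (simp add: K1_def)
    show "sup_norm (S f) \<le> K1 * sup_norm f" if "f \<in> E" for f
      using K0 that mult_right_mono[of K0 K1 "sup_norm f"] unfolding K1_def by fastforce
  qed
  have eq: "shifted_op z A h = fscale z (h - fscale (1 / z) (A h))" for h
    using assms(2) by (simp add: shifted_op_def fscale_def fun_eq_iff algebra_simps)
  show ?thesis
  proof (intro exI[of _ "K1 * cmod z"] conjI ballI)
    show "0 < K1 * cmod z" using K1 assms(2) by simp
    fix h assume h: "h \<in> E"
    then have d: "h - fscale (1 / z) (A h) \<in> E" by (intro mem_diff mem_scale A_mem)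
    have "sup_norm h = sup_norm (S (shifted_op z A h))" using S(2) h by simp
    also have "\<dots> \<le> K1 * sup_norm (shifted_op z A h)"
      unfolding eq by (rule K1(2)[OF mem_scale[OF d]])
    also have "\<dots> \<le> K1 * (cmod z * sup_norm (h - fscale (1 / z) (A h)))"
      unfolding eq using K1(1) norm_scale[OF d] by (intro mult_left_mono) auto
    finally show "sup_norm h \<le> K1 * cmod z * sup_norm (h - fscale (1 / z) (A h))"
      by (simp only: mult.assoc)
  next
    fix g assume g: "g \<in> E"
    then have zg: "fscale z g \<in> E" by (rule mem_scale)
    then have 1: "S (fscale z g) \<in> E" using S(1) by (auto simp: bounded_op_def)
    have "fscale z (S (fscale z g) - fscale (1 / z) (A (S (fscale z g)))) = fscale z g"
      using S(2) zg by (simp only: eq[symmetric])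
    then have "S (fscale z g) - fscale (1 / z) (A (S (fscale z g))) = g"
      using assms(2) by (auto simp: fscale_def fun_eq_iff)
    then show "\<exists>h\<in>E. h - fscale (1 / z) (A h) = g" using 1 by blast
  qed
qed

text \<open>The resolvent applied to \<open>f\<close> and evaluated at \<open>x\<close> is a scalar holomorphic function of
  \<open>\<zeta> = 1 / z\<close> whose power series coefficients at \<open>0\<close> are the numbers \<open>(A ^^ n) f x\<close>; the radius
  of convergence then bounds their growth.\<close>

lemma resolvent_power_tendsto:
  assumes rs: "r < s" "0 < s" and inv: "\<And>z. cmod z > r \<Longrightarrow> op_invertible E (shifted_op z A)"
    and f: "f \<in> E"
  shows "(\<lambda>n. (A ^^ n) f x / of_real s ^ n) \<longlonglongrightarrow> 0"
proof -
  \<comment> \<open>\<open>r\<close> may be 0 or negative; \<open>r'\<close> is a positive radius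
    still strictly below \<open>s\<close>, so its reciprocal exceeds \<open>1 / s\<close>.\<close>
  define r' where "r' = max r (s / 2)"
  have r': "0 < r'" "r' < s" "r \<le> r'" using rs by (auto simp: r'_def)
  define \<rho> where "\<rho> = 1 / r'"
  have \<rho>: "\<rho> > 0" using r' by (simp add: \<rho>_def)
  obtain B where B: "B > 0" "\<And>f. f \<in> E \<Longrightarrow> sup_norm (A f) \<le> B * sup_norm f" using A_bound by blast
  have res: "\<exists>K>0. (\<forall>h\<in>E. sup_norm h \<le> K * sup_norm (h - fscale \<zeta> (A h))) \<and>
    (\<forall>g\<in>E. \<exists>h\<in>E. h - fscale \<zeta> (A h) = g)" if z: "cmod \<zeta> < \<rho>" for \<zeta>
  proof (cases "\<zeta> = 0")
    case True
    have "h - fscale 0 (A h) = h" for h by (simp add: fscale_def fun_eq_iff)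
    then show ?thesis unfolding True by (intro exI[of _ 1]) auto
  next
    case False
    have "cmod (1 / \<zeta>) > r'" using z False r' by (simp add: norm_divide \<rho>_def field_simps)
    then have "op_invertible E (shifted_op (1 / \<zeta>) A)" using r' by (intro inv) auto
    then show ?thesis using op_invertible_shifted_imp[of "1 / \<zeta>"] False by simp
  qed
  define h where "h \<zeta> = (SOME h. h \<in> E \<and> h - fscale \<zeta> (A h) = f)" for \<zeta>
  have h: "h \<zeta> \<in> E" "h \<zeta> - fscale \<zeta> (A (h \<zeta>)) = f" if "cmod \<zeta> < \<rho>" for \<zeta>
    using someI_ex[of "\<lambda>h. h \<in> E \<and> h - fscale \<zeta> (A h) = f"] res[OF that] f unfolding h_def by blast+
  have hx: "h \<zeta> y = f y + \<zeta> * A (h \<zeta>) y" if "cmod \<zeta> < \<rho>" for \<zeta> y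
    using fun_cong[OF h(2)[OF that], of y] by (simp add: fscale_def algebra_simps)
  define H where "H \<zeta> = h \<zeta> x" for \<zeta>
  have deriv: "\<exists>D. (H has_field_derivative D) (at \<eta>)" if eta: "cmod \<eta> < \<rho>" for \<eta>
  proof -
    obtain K where K: "K > 0" "\<And>h. h \<in> E \<Longrightarrow> sup_norm h \<le> K * sup_norm (h - fscale \<eta> (A h))"
      "\<And>g. g \<in> E \<Longrightarrow> \<exists>h\<in>E. h - fscale \<eta> (A h) = g" using res[OF eta] by blast
    \<comment> \<open>\<open>u\<close> is the derivative of \<open>h\<close> at
      \<open>\<eta>\<close>: formally, differentiating \<open>h - \<zeta> A h = f\<close> gives this
      equation.\<close>
    obtain u where u: "u \<in> E" "u - fscale \<eta> (A u) = A (h \<eta>)" using K(3) A_mem h(1)[OF eta] by blast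
    have ux: "u y = A (h \<eta>) y + \<eta> * A u y" for y
      using fun_cong[OF u(2), of y] by (simp add: fscale_def algebra_simps)
    \<comment> \<open>The first bound keeps \<open>\<zeta>\<close> in the disc; the second makes
      \<open>\<zeta> A\<close> a perturbation of \<open>\<eta> A\<close> small enough that
      \<open>h \<zeta>\<close> stays bounded by \<open>2 * K * sup_norm f\<close>.\<close>
    define d where "d = min (\<rho> - cmod \<eta>) (1 / (2 * K * B))"
    have d: "d > 0" using eta K(1) B(1) by (auto simp: d_def)
    define M where "M = K * B * (K * B * (2 * K * sup_norm f))"
    have "cmod (H \<zeta> - H \<eta> - (\<zeta> - \<eta>) * u x) \<le> M * (cmod (\<zeta> - \<eta>))\<^sup>2" if z: "cmod (\<zeta> - \<eta>) < d" for \<zeta>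
    proof -
      have z1: "cmod \<zeta> < \<rho>" using z norm_triangle_sub[of \<zeta> \<eta>] by (auto simp: d_def)
      have z2: "cmod (\<zeta> - \<eta>) * (K * B) \<le> 1 / 2"
      proof -
        have "cmod (\<zeta> - \<eta>) \<le> 1 / (2 * K * B)" using z by (auto simp: d_def)
        then show ?thesis using K(1) B(1) by (simp add: field_simps)
      qed
      note hz = h(1)[OF z1] and he = h(1)[OF eta]
      have step: "sup_norm g \<le> K * (cmod (\<zeta> - \<eta>) * (B * sup_norm g'))"
        if "g \<in> E" "g' \<in> E" "g - fscale \<eta> (A g) = fscale (\<zeta> - \<eta>) (A g')" for g g'
      proof -
        have "sup_norm g \<le> K * sup_norm (fscale (\<zeta> - \<eta>) (A g'))" using K(2)[OF that(1)] that(3) by simp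
        also have "\<dots> \<le> K * (cmod (\<zeta> - \<eta>) * sup_norm (A g'))"
          using K(1) norm_scale[OF A_mem[OF that(2)]] by (intro mult_left_mono) auto
        also have "\<dots> \<le> K * (cmod (\<zeta> - \<eta>) * (B * sup_norm g'))"
          using K(1) B(2)[OF that(2)] by (intro mult_left_mono) auto
        finally show ?thesis .
      qed
      \<comment> \<open>\<open>v\<close> is the increment and \<open>w\<close> below its remainder
        after the linear term; \<open>step\<close> gains one factor
        \<open>cmod (\<zeta> - \<eta>)\<close> for each, hence the quadratic bound.\<close>
      define v where "v = h \<zeta> - h \<eta>"
      have vE: "v \<in> E" unfolding v_def by (intro mem_diff hz he)
      have Av: "A v y = A (h \<zeta>) y - A (h \<eta>) y" for y unfolding v_def A_diff[OF hz he] by simp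
      have vy: "v y = h \<zeta> y - h \<eta> y" for y by (simp add: v_def)
      have v: "sup_norm v \<le> K * (cmod (\<zeta> - \<eta>) * (B * sup_norm (h \<zeta>)))"
      proof (rule step[OF vE hz], rule ext)
        fix y show "(v - fscale \<eta> (A v)) y = fscale (\<zeta> - \<eta>) (A (h \<zeta>)) y"
          using hx[OF z1, of y] hx[OF eta, of y] by (simp add: fscale_def Av vy algebra_simps)
      qed
      define w where "w = v - fscale (\<zeta> - \<eta>) u"
      have wE: "w \<in> E" unfolding w_def by (intro mem_diff mem_scale vE u)
      have Aw: "A w y = A v y - (\<zeta> - \<eta>) * A u y" for y
        unfolding w_def A_diff[OF vE mem_scale[OF u(1)]] A_scale[OF u(1)] by (simp add: fscale_def)
      have wy: "w y = v y - (\<zeta> - \<eta>) * u y" for y by (simp add: w_def fscale_def)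
      have w: "sup_norm w \<le> K * (cmod (\<zeta> - \<eta>) * (B * sup_norm v))"
      proof (rule step[OF wE vE], rule ext)
        fix y
        have "v y - \<eta> * A v y = (\<zeta> - \<eta>) * A (h \<zeta>) y"
          using hx[OF z1, of y] hx[OF eta, of y] by (simp add: vy Av algebra_simps)
        then show "(w - fscale \<eta> (A w)) y = fscale (\<zeta> - \<eta>) (A v) y"
          using ux[of y] wy[of y] by (simp add: fscale_def Aw Av algebra_simps)
      qed
      have hz2: "sup_norm (h \<zeta>) \<le> 2 * K * sup_norm f"
      proof -
        have eq: "h \<zeta> - fscale \<eta> (A (h \<zeta>)) = f + fscale (\<zeta> - \<eta>) (A (h \<zeta>))"
        proof (rule ext)
          fix y show "(h \<zeta> - fscale \<eta> (A (h \<zeta>))) y = (f + fscale (\<zeta> - \<eta>) (A (h \<zeta>))) y"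
            using hx[OF z1, of y] by (simp add: fscale_def algebra_simps)
        qed
        have "sup_norm (f + fscale (\<zeta> - \<eta>) (A (h \<zeta>))) \<le> sup_norm f + cmod (\<zeta> - \<eta>) * (B * sup_norm (h \<zeta>))"
        proof -
          have "sup_norm (fscale (\<zeta> - \<eta>) (A (h \<zeta>))) \<le> cmod (\<zeta> - \<eta>) * sup_norm (A (h \<zeta>))"
            by (rule norm_scale[OF A_mem[OF hz]])
          also have "\<dots> \<le> cmod (\<zeta> - \<eta>) * (B * sup_norm (h \<zeta>))" using B(2)[OF hz] by (intro mult_left_mono) auto
          finally show ?thesis using norm_add[OF f mem_scale[OF A_mem[OF hz]], of "\<zeta> - \<eta>"] by linarith
        qed
        then have "sup_norm (h \<zeta>) \<le> K * (sup_norm f + cmod (\<zeta> - \<eta>) * (B * sup_norm (h \<zeta>)))"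
          using K(1) K(2)[OF hz] unfolding eq by (meson mult_left_mono order_trans less_imp_le)
        also have "\<dots> = K * sup_norm f + (cmod (\<zeta> - \<eta>) * (K * B)) * sup_norm (h \<zeta>)" by (simp only: distrib_left mult_ac)
        also have "\<dots> \<le> K * sup_norm f + 1 / 2 * sup_norm (h \<zeta>)"
          using z2 by (intro add_left_mono mult_right_mono) auto
        finally show ?thesis by linarith
      qed
      have "sup_norm w \<le> K * (cmod (\<zeta> - \<eta>) * (B * (K * (cmod (\<zeta> - \<eta>) * (B * (2 * K * sup_norm f))))))"
      proof -
        have mono: "K * (cmod (\<zeta> - \<eta>) * (B * a)) \<le> K * (cmod (\<zeta> - \<eta>) * (B * b))" if "a \<le> b" for a b
          using K(1) B(1) that by (intro mult_left_mono) auto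
        have "sup_norm v \<le> K * (cmod (\<zeta> - \<eta>) * (B * (2 * K * sup_norm f)))"
          using v mono[OF hz2] by (rule order_trans)
        from order_trans[OF w mono[OF this]] show ?thesis .
      qed
      also have "\<dots> = M * (cmod (\<zeta> - \<eta>))\<^sup>2" by (simp add: M_def power2_eq_square)
      finally have "sup_norm w \<le> M * (cmod (\<zeta> - \<eta>))\<^sup>2" .
      moreover have "cmod (w x) \<le> sup_norm w" by (rule cmod_le[OF wE])
      moreover have "w x = H \<zeta> - H \<eta> - (\<zeta> - \<eta>) * u x" by (simp add: w_def v_def H_def fscale_def)
      ultimately show ?thesis by simp
    qed
    then show ?thesis using has_field_derivative_quadratic_bound[OF d] by blast
  qed
  have "H holomorphic_on ball 0 \<rho>"
    unfolding holomorphic_on_open[OF open_ball] using deriv by simp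
  then have series: "(\<lambda>n. (deriv ^^ n) H 0 / fact n * \<zeta> ^ n) sums H \<zeta>" if "cmod \<zeta> < \<rho>" for \<zeta>
    using holomorphic_power_series[of H 0 \<rho> \<zeta>] that by simp
  \<comment> \<open>On this smaller disc the Neumann series converges by the norm bound alone and
    represents \<open>H\<close>. Uniqueness identifies its coefficients with the Taylor
    coefficients, whose series converges on the whole disc of radius \<open>\<rho>\<close>.\<close>
  define \<rho>' where "\<rho>' = min \<rho> (1 / B)"
  have \<rho>': "\<rho>' > 0" "\<rho>' \<le> \<rho>" using \<rho> B by (auto simp: \<rho>'_def)
  have series': "(\<lambda>n. (A ^^ n) f x * \<zeta> ^ n) sums H \<zeta>" if z: "cmod \<zeta> < \<rho>'" for \<zeta>
  proof -
    have z1: "cmod \<zeta> < \<rho>" and z2: "cmod \<zeta> * B < 1" using z B by (auto simp: \<rho>'_def field_simps)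
    note hz = h(1)[OF z1]
    have fz: "h \<zeta> = f + fscale \<zeta> (A (h \<zeta>))"
      using hx[OF z1] by (simp add: fscale_def fun_eq_iff)
    have rec: "H \<zeta> = (\<Sum>i<n. (A ^^ i) f x * \<zeta> ^ i) + \<zeta> ^ n * (A ^^ n) (h \<zeta>) x" for n
    proof (induction n)
      case 0 then show ?case by (simp add: H_def)
    next
      case (Suc n)
      have "(A ^^ n) (h \<zeta>) = (A ^^ n) (f + fscale \<zeta> (A (h \<zeta>)))" using fz by simp
      also have "\<dots> = (A ^^ n) f + fscale \<zeta> ((A ^^ n) (A (h \<zeta>)))"
        unfolding pow_add[OF f mem_scale[OF A_mem[OF hz]]] pow_scale[OF A_mem[OF hz]] ..
      also have "(A ^^ n) (A (h \<zeta>)) = (A ^^ Suc n) (h \<zeta>)" by (simp add: funpow_swap1)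
      finally have "(A ^^ n) (h \<zeta>) = (A ^^ n) f + fscale \<zeta> ((A ^^ Suc n) (h \<zeta>))" .
      from fun_cong[OF this, of x]
      have "(A ^^ n) (h \<zeta>) x = (A ^^ n) f x + \<zeta> * (A ^^ Suc n) (h \<zeta>) x"
        by (simp only: fscale_def plus_fun_apply)
      then show ?case using Suc by (simp add: algebra_simps)
    qed
    have Bn: "sup_norm ((A ^^ n) (h \<zeta>)) \<le> B ^ n * sup_norm (h \<zeta>)" for n
      using B hz by (rule pow_norm_le)
    have "(\<lambda>n. \<zeta> ^ n * (A ^^ n) (h \<zeta>) x) \<longlonglongrightarrow> 0"
    proof (rule Lim_null_comparison)
      have "norm (\<zeta> ^ n * (A ^^ n) (h \<zeta>) x) \<le> (cmod \<zeta> * B) ^ n * sup_norm (h \<zeta>)" for n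
      proof -
        have "cmod ((A ^^ n) (h \<zeta>) x) \<le> B ^ n * sup_norm (h \<zeta>)"
          using cmod_le[OF pow_mem[OF hz], of n x] Bn[of n] by linarith
        then have "cmod \<zeta> ^ n * cmod ((A ^^ n) (h \<zeta>) x) \<le> cmod \<zeta> ^ n * (B ^ n * sup_norm (h \<zeta>))"
          by (intro mult_left_mono) auto
        then show ?thesis by (simp add: norm_mult norm_power power_mult_distrib)
      qed
      then show "\<forall>\<^sub>F n in sequentially. norm (\<zeta> ^ n * (A ^^ n) (h \<zeta>) x) \<le> (cmod \<zeta> * B) ^ n * sup_norm (h \<zeta>)"
        by (intro always_eventually allI)
      show "(\<lambda>n. (cmod \<zeta> * B) ^ n * sup_norm (h \<zeta>)) \<longlonglongrightarrow> 0"
        using z2 B(1) by (intro tendsto_mult_left_zero LIMSEQ_power_zero) (simp add: norm_mult)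
    qed
    then have "(\<lambda>n. H \<zeta> - \<zeta> ^ n * (A ^^ n) (h \<zeta>) x) \<longlonglongrightarrow> H \<zeta> - 0" by (intro tendsto_diff tendsto_const)
    moreover have "(\<lambda>n. H \<zeta> - \<zeta> ^ n * (A ^^ n) (h \<zeta>) x) = (\<lambda>n. \<Sum>i<n. (A ^^ i) f x * \<zeta> ^ i)"
    proof
      fix n show "H \<zeta> - \<zeta> ^ n * (A ^^ n) (h \<zeta>) x = (\<Sum>i<n. (A ^^ i) f x * \<zeta> ^ i)"
        using rec[of n] by (simp only: add_diff_cancel_right')
    qed
    ultimately show ?thesis unfolding sums_def by simp
  qed
  have "(\<lambda>n. (A ^^ n) f x) = (\<lambda>n. (deriv ^^ n) H 0 / fact n)"
    using powser_unique[OF \<rho>'(1) series', of "\<lambda>n. (deriv ^^ n) H 0 / fact n"] series \<rho>'(2) by auto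
  then have eq: "(A ^^ n) f x = (deriv ^^ n) H 0 / fact n" for n by (rule fun_cong)
  have "cmod (of_real (1 / s)) < \<rho>" using r' rs by (simp add: \<rho>_def norm_divide field_simps)
  from sums_summable[OF series[OF this]]
  have "(\<lambda>n. (A ^^ n) f x * of_real (1 / s) ^ n) \<longlonglongrightarrow> 0"
    unfolding eq by (rule summable_LIMSEQ_zero)
  then show ?thesis by (simp add: divide_inverse power_inverse)
qed

end

section \<open>Products of weights along orbits\<close>

definition cocycle :: "('a \<Rightarrow> complex) \<Rightarrow> ('a \<Rightarrow> 'a) \<Rightarrow> nat \<Rightarrow> 'a \<Rightarrow> complex" where
  "cocycle v \<psi> n k = (\<Prod>i<n. v ((\<psi> ^^ i) k))"

lemma cocycle_0 [simp]: "cocycle v \<psi> 0 k = 1"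
  by (simp add: cocycle_def)

lemma cocycle_Suc: "cocycle v \<psi> (Suc n) k = v k * cocycle v \<psi> n (\<psi> k)"
  unfolding cocycle_def prod.lessThan_Suc_shift by (simp add: funpow_swap1)

lemma cocycle_add: "cocycle v \<psi> (m + n) k = cocycle v \<psi> m k * cocycle v \<psi> n ((\<psi> ^^ m) k)"
  by (induction m arbitrary: k) (auto simp: cocycle_Suc funpow_swap1)

lemma cocycle_1 [simp]: "cocycle v \<psi> (Suc 0) k = v k"
  by (simp add: cocycle_Suc)

lemma cocycle_divide: "cocycle (\<lambda>k. v k / c) \<psi> n k = cocycle v \<psi> n k / c ^ n"
  by (simp add: cocycle_def prod_dividef)

text \<open>Continuity is demanded only on \<open>F\<close>, so that the inverse of
  \<open>\<phi>\<close> on the core of an invariant set, where alone it is defined, is an instance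
  along with \<open>\<phi>\<close> itself.\<close>

locale weighted_map =
  fixes X :: "'a topology" and F :: "'a set" and v :: "'a \<Rightarrow> complex" and \<psi> :: "'a \<Rightarrow> 'a"
  assumes F: "compactin X F"
    and cont_\<psi>: "continuous_map (subtopology X F) (subtopology X F) \<psi>"
    and cont_v: "continuous_map (subtopology X F) euclidean v"
begin

lemma F_sub: "F \<subseteq> topspace X"
  using F compactin_subset_topspace by blast

lemma topspace_F [simp]: "topspace (subtopology X F) = F"
  using F_sub by auto

lemma compact_space_F: "compact_space (subtopology X F)"
  using F by (simp add: compact_space_subtopology)

lemma \<psi>_mem: "k \<in> F \<Longrightarrow> \<psi> k \<in> F"
  using continuous_map_funspace[OF cont_\<psi>] unfolding topspace_F by auto

lemma \<psi>_pow_mem: "k \<in> F \<Longrightarrow> (\<psi> ^^ n) k \<in> F"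
  by (induction n) (auto intro: \<psi>_mem)

lemma cont_\<psi>_pow: "continuous_map (subtopology X F) (subtopology X F) (\<psi> ^^ n)"
proof (induction n)
  case (Suc n)
  then show ?case using continuous_map_compose[OF Suc cont_\<psi>] by (simp only: funpow.simps)
qed (simp add: id_def[symmetric])

lemma cont_cocycle: "continuous_map (subtopology X F) euclidean (cocycle v \<psi> n)"
proof -
  have "continuous_map (subtopology X F) euclidean (\<lambda>k. v ((\<psi> ^^ i) k))" for i
    using continuous_map_compose[OF cont_\<psi>_pow cont_v] by (simp add: o_def)
  then have "continuous_map (subtopology X F) euclidean (\<lambda>k. \<Prod>i<n. v ((\<psi> ^^ i) k))"
    unfolding continuous_map_atin limitin_canonical_iff by (auto intro!: tendsto_prod)
  then show ?thesis by (simp add: cocycle_def[abs_def])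
qed

lemma bounded_on_F:
  assumes "continuous_map (subtopology X F) euclidean (f :: 'a \<Rightarrow> complex)"
  obtains B where "B > 0" "\<And>k. k \<in> F \<Longrightarrow> cmod (f k) \<le> B"
proof -
  have "compactin (subtopology X F) F" using compact_space_F unfolding compact_space_def topspace_F .
  then have "compact (f ` F)"
    using image_compactin[OF _ assms] by simp
  then have "bounded (f ` F)" by (rule compact_imp_bounded)
  then obtain B where "\<And>k. k \<in> F \<Longrightarrow> cmod (f k) \<le> B"
    by (auto simp: bounded_iff)
  then have "\<And>k. k \<in> F \<Longrightarrow> cmod (f k) \<le> max B 1" by force
  then show ?thesis by (intro that[of "max B 1"]) auto
qed

abbreviation "E \<equiv> C_space X F"
abbreviation "T \<equiv> wcomp v \<psi> F"

lemma fun_op: "fun_op E T"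
proof -
  interpret fun_banach E by (rule fun_banach_C_space[OF F])
  obtain B where B: "B > 0" "\<And>k. k \<in> F \<Longrightarrow> cmod (v k) \<le> B" using bounded_on_F[OF cont_v] by blast
  show ?thesis
  proof
    show "bounded_op E T"
      unfolding bounded_op_def
    proof (intro conjI ballI allI)
      show "T \<in> E \<rightarrow> E"
      proof
        fix f assume f: "f \<in> E"
        have 1: "continuous_map (subtopology X F) euclidean (\<lambda>k. f (\<psi> k))"
          using continuous_map_compose[OF cont_\<psi>, of euclidean f] f by (simp add: C_space_def o_def)
        have "continuous_map (subtopology X F) euclidean (\<lambda>k. v k * f (\<psi> k))"
          using 1 cont_v unfolding continuous_map_atin limitin_canonical_iff by (auto intro!: tendsto_mult)
        then have "continuous_map (subtopology X F) euclidean (T f)"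
          by (rule continuous_map_eq) (simp add: wcomp_def F_sub inf_absorb2)
        then show "T f \<in> E" by (simp add: C_space_def wcomp_def)
      qed
      show "T (f + g) = T f + T g" for f g by (simp add: wcomp_def fun_eq_iff algebra_simps)
      show "T (fscale c f) = fscale c (T f)" for c f by (simp add: wcomp_def fscale_def fun_eq_iff)
      show "\<exists>B. \<forall>f\<in>E. sup_norm (T f) \<le> B * sup_norm f"
      proof (intro exI[of _ B] ballI sup_norm_le)
        fix f x assume f: "f \<in> E"
        show "cmod (T f x) \<le> B * sup_norm f"
        proof (cases "x \<in> F")
          case True
          have "cmod (v x) * cmod (f (\<psi> x)) \<le> B * sup_norm f"
            using B True cmod_le[OF f] by (intro mult_mono) auto
          then show ?thesis using True by (simp add: wcomp_def norm_mult)
        qed (use B in \<open>simp add: wcomp_def\<close>)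
      qed
    qed
  qed
qed

sublocale fun_op "C_space X F" "wcomp v \<psi> F"
  by (rule fun_op)

lemma T_pow: "k \<in> F \<Longrightarrow> (T ^^ n) f k = cocycle v \<psi> n k * f ((\<psi> ^^ n) k)"
proof (induction n arbitrary: k)
  case (Suc n)
  then show ?case using \<psi>_mem by (simp add: wcomp_def cocycle_Suc funpow_swap1)
qed simp

definition unit_fun :: "'a \<Rightarrow> complex" where "unit_fun k = (if k \<in> F then 1 else 0)"

lemma unit_fun_mem: "unit_fun \<in> E"
proof -
  have "continuous_map (subtopology X F) euclidean unit_fun"
    by (rule continuous_map_eq[of _ _ "\<lambda>_. 1"]) (auto simp: unit_fun_def)
  then show ?thesis by (simp add: C_space_def unit_fun_def)
qed

text \<open>Compactness makes the pointwise hypothesis uniform: some contraction occurs within the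
  first \<open>R\<close> steps, with a common factor \<open>q < 1\<close>.\<close>

lemma cocycle_unif_tendsto_0:
  assumes pt: "\<And>k. k \<in> F \<Longrightarrow> \<exists>n\<ge>1. cmod (cocycle v \<psi> n k) < 1" and "e > 0"
  shows "\<exists>N. \<forall>n\<ge>N. \<forall>k\<in>F. cmod (cocycle v \<psi> n k) \<le> e"
proof -
  \<comment> \<open>The points that see no factor below \<open>1 - 1 / Suc R\<close> within
    \<open>Suc R\<close> steps. A single index for the factor and the number of steps gives a
    decreasing sequence of closed sets, and no point lies in all of them.\<close>
  define G where "G R = {k\<in>F. \<forall>n\<in>{1..Suc R}. cmod (cocycle v \<psi> n k) \<ge> 1 - 1 / real (Suc R)}" for R
  have "\<exists>R. G R = {}"
  proof (rule ccontr)
    assume ne: "\<nexists>R. G R = {}"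
    have "(\<Inter>R. G R) \<noteq> {}"
    proof (rule compact_space_imp_nest[OF compact_space_F])
      fix R
      have "closedin (subtopology X F) {k\<in>F. cmod (cocycle v \<psi> n k) \<ge> c}" for n c
      proof -
        have "continuous_map (subtopology X F) euclidean (\<lambda>k. cmod (cocycle v \<psi> n k))"
          using cont_cocycle unfolding continuous_map_atin limitin_canonical_iff by (auto intro!: tendsto_norm)
        from closedin_continuous_map_preimage[OF this, of "{c..}"] show ?thesis
          unfolding topspace_F atLeast_iff by simp
      qed
      then have "closedin (subtopology X F) (\<Inter>n\<in>{1..Suc R}. {k\<in>F. cmod (cocycle v \<psi> n k) \<ge> 1 - 1 / real (Suc R)})"
        by (intro closedin_INT) auto
      moreover have "(\<Inter>n\<in>{1..Suc R}. {k\<in>F. cmod (cocycle v \<psi> n k) \<ge> 1 - 1 / real (Suc R)}) = G R"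
        by (auto simp: G_def)
      ultimately show "closedin (subtopology X F) (G R)" by simp
      show "G R \<noteq> {}" using ne by blast
    next
      show "decseq G"
        unfolding decseq_Suc_iff
      proof
        fix R
        have "1 / real (Suc (Suc R)) \<le> 1 / real (Suc R)" by (intro divide_left_mono) auto
        then have "c \<ge> 1 - 1 / real (Suc R)" if "c \<ge> 1 - 1 / real (Suc (Suc R))" for c
          using that by linarith
        moreover have "n \<in> {1..Suc (Suc R)}" if "n \<in> {1..Suc R}" for n using that by simp
        ultimately show "G (Suc R) \<subseteq> G R" unfolding G_def by blast
      qed
    qed
    then obtain k where k: "\<And>R. k \<in> G R" by blast
    then have "k \<in> F" by (auto simp: G_def)
    then obtain n where n: "n \<ge> 1" "cmod (cocycle v \<psi> n k) < 1" using pt by blast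
    obtain R where R: "1 / real (Suc R) < 1 - cmod (cocycle v \<psi> n k)"
      using reals_Archimedean[of "1 - cmod (cocycle v \<psi> n k)"] n by (auto simp: inverse_eq_divide)
    have "1 / real (Suc (max R n)) \<le> 1 / real (Suc R)" by (intro divide_left_mono) auto
    moreover have "cmod (cocycle v \<psi> n k) \<ge> 1 - 1 / real (Suc (max R n))"
      using k[of "max R n"] n(1) unfolding G_def by auto
    ultimately show False using R by linarith
  qed
  then obtain R where R: "G R = {}" by blast
  define q where "q = 1 - 1 / real (Suc R)"
  have q: "0 \<le> q" "q < 1" by (auto simp: q_def)
  have pick: "\<exists>n\<in>{1..Suc R}. cmod (cocycle v \<psi> n k) \<le> q" if "k \<in> F" for k
    using R that unfolding G_def q_def[symmetric] by force
  have "\<exists>B>0. \<forall>k\<in>F. cmod (cocycle v \<psi> i k) \<le> B" for i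
    using bounded_on_F[OF cont_cocycle, of i] by metis
  then obtain b where b: "\<And>i. b i > 0" "\<And>i k. k \<in> F \<Longrightarrow> cmod (cocycle v \<psi> i k) \<le> b i" by metis
  define B where "B = (\<Sum>i\<le>R. b i)"
  have B: "B > 0" unfolding B_def using b(1) by (intro sum_pos) auto
  have Bi: "cmod (cocycle v \<psi> i k) \<le> B" if "k \<in> F" "i \<le> R" for i k
  proof -
    have "b i \<le> B" unfolding B_def using that b(1) less_imp_le by (intro member_le_sum) auto
    then show ?thesis using b(2)[OF that(1), of i] by linarith
  qed
  \<comment> \<open>Splitting off a contracting block shortens the product without enlarging it, so
    the bound for the first \<open>R\<close> steps is valid at every length.\<close>
  have Ball: "cmod (cocycle v \<psi> m k) \<le> B" if "k \<in> F" for m k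
    using that
  proof (induction m arbitrary: k rule: less_induct)
    case (less m)
    show ?case
    proof (cases "m \<le> R")
      case True then show ?thesis using Bi less.prems by blast
    next
      case False
      obtain n where n: "n \<ge> 1" "n \<le> Suc R" "cmod (cocycle v \<psi> n k) \<le> q" using pick[OF less.prems] by auto
      have m: "m = n + (m - n)" using n False by simp
      have "cmod (cocycle v \<psi> m k) = cmod (cocycle v \<psi> n k) * cmod (cocycle v \<psi> (m - n) ((\<psi> ^^ n) k))"
        by (subst m) (simp add: cocycle_add norm_mult)
      also have "\<dots> \<le> q * B"
        using n False less.IH[of "m - n"] \<psi>_pow_mem[OF less.prems] q B by (intro mult_mono) auto
      also have "\<dots> \<le> B" using q B mult_right_mono[of q 1 B] by simp
      finally show ?thesis .
    qed
  qed
  have decay: "cmod (cocycle v \<psi> m k) \<le> B * q ^ j" if "k \<in> F" "m \<ge> j * Suc R" for j m k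
    using that
  proof (induction j arbitrary: m k)
    case 0 then show ?case using Ball by simp
  next
    case (Suc j)
    obtain n where n: "n \<ge> 1" "n \<le> Suc R" "cmod (cocycle v \<psi> n k) \<le> q" using pick[OF Suc.prems(1)] by auto
    have m: "m = n + (m - n)" "m - n \<ge> j * Suc R" using n Suc.prems(2) by auto
    have "cmod (cocycle v \<psi> m k) = cmod (cocycle v \<psi> n k) * cmod (cocycle v \<psi> (m - n) ((\<psi> ^^ n) k))"
      by (subst m(1)) (simp add: cocycle_add norm_mult)
    also have "\<dots> \<le> q * (B * q ^ j)"
      using n m(2) Suc.IH[of _ "m - n"] \<psi>_pow_mem[OF Suc.prems(1)] q B by (intro mult_mono) auto
    finally show ?case by (simp add: mult_ac)
  qed
  have "(\<lambda>j. B * q ^ j) \<longlonglongrightarrow> 0"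
    using q by (intro tendsto_mult_right_zero LIMSEQ_power_zero) auto
  then have "\<forall>\<^sub>F j in sequentially. B * q ^ j < e" using \<open>e > 0\<close> by (rule order_tendstoD)
  then obtain j where j: "B * q ^ j < e" using eventually_happens by force
  show ?thesis
  proof (intro exI[of _ "j * Suc R"] allI impI ballI)
    fix n k assume "n \<ge> j * Suc R" "k \<in> F"
    then show "cmod (cocycle v \<psi> n k) \<le> e" using decay[of k j n] j by linarith
  qed
qed

text \<open>Where \<open>T g\<close> has modulus 1, the modulus of \<open>v k\<close> is the
  reciprocal of that of a value of \<open>g\<close>. The \<open>+ 1\<close> keeps the denominator
  positive.\<close>

lemma weight_lower_bound:
  assumes g: "g \<in> E" "\<And>k. k \<in> F \<Longrightarrow> cmod (T g k) = 1" and k: "k \<in> F"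
  shows "cmod (v k) \<ge> 1 / (sup_norm g + 1)"
proof -
  have pos: "sup_norm g + 1 > 0" using sup_norm_nonneg[of g] by linarith
  have "cmod (v k) * cmod (g (\<psi> k)) = 1" using g(2)[OF k] k by (simp add: wcomp_def norm_mult)
  moreover have "cmod (v k) * cmod (g (\<psi> k)) \<le> cmod (v k) * (sup_norm g + 1)"
    using cmod_le[OF g(1), of "\<psi> k"] by (intro mult_left_mono) auto
  ultimately have "1 \<le> cmod (v k) * (sup_norm g + 1)" by linarith
  then show ?thesis using pos by (simp add: field_simps)
qed

lemma invertible_imp_weight_nonzero:
  assumes "op_invertible E T" "k \<in> F"
  shows "v k \<noteq> 0"
proof -
  obtain S where S: "bounded_op E S" "\<forall>f\<in>E. S (T f) = f \<and> T (S f) = f"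
    using assms(1) unfolding op_invertible_def by blast
  have "S unit_fun \<in> E" "T (S unit_fun) = unit_fun" using S unit_fun_mem by (auto simp: bounded_op_def)
  then have "cmod (v k) \<ge> 1 / (sup_norm (S unit_fun) + 1)"
    using assms(2) by (intro weight_lower_bound) (auto simp: unit_fun_def)
  moreover have "sup_norm (S unit_fun) + 1 > 0" by (simp add: add_nonneg_pos)
  ultimately show ?thesis by (auto simp: divide_le_0_iff)
qed

lemma cocycle_lower_bound:
  assumes "c > 0" "\<And>k. k \<in> F \<Longrightarrow> cmod (v k) \<ge> c" "k \<in> F"
  shows "cmod (cocycle v \<psi> n k) \<ge> c ^ n"
  using assms(3)
proof (induction n arbitrary: k)
  case (Suc n)
  have "c * c ^ n \<le> cmod (v k) * cmod (cocycle v \<psi> n (\<psi> k))"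
    using assms(1) assms(2)[OF Suc.prems] Suc.IH[OF \<psi>_mem[OF Suc.prems]] by (intro mult_mono) auto
  then show ?case by (simp add: cocycle_Suc norm_mult)
qed simp

end

text \<open>\<open>op_inverse\<close> is an \<open>inv_into\<close>, which agrees with an explicit
  weighted composition operator only on \<open>E\<close>; this and the next congruence rules carry
  spectra and spectral radii across.\<close>

lemma bounded_op_cong:
  assumes "fun_vs.subspace E" "\<And>f. f \<in> E \<Longrightarrow> A f = B f" "bounded_op E B"
  shows "bounded_op E A"
proof -
  have "f + g \<in> E" "fscale c f \<in> E" if "f \<in> E" "g \<in> E" for f g c
    using assms(1) that by (auto simp: fun_vs.subspace_add fun_vs.subspace_scale)
  then show ?thesis
    using assms(2,3) unfolding bounded_op_def Pi_iff by (simp del: plus_fun_apply)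
qed

lemma op_invertible_cong:
  assumes "fun_vs.subspace E" "\<And>f. f \<in> E \<Longrightarrow> A f = B f" "op_invertible E B"
  shows "op_invertible E A"
proof -
  obtain S where B: "bounded_op E B" and S: "bounded_op E S" "\<forall>f\<in>E. S (B f) = f \<and> B (S f) = f"
    using assms(3) unfolding op_invertible_def by blast
  have "S f \<in> E" if "f \<in> E" for f using S(1) that by (auto simp: bounded_op_def)
  then have "\<forall>f\<in>E. S (A f) = f \<and> A (S f) = f" using S(2) assms(2) by simp
  then show ?thesis
    unfolding op_invertible_def using bounded_op_cong[OF assms(1,2) B] S(1) by blast
qed

lemma op_spectrum_cong:
  assumes "fun_vs.subspace E" "\<And>f. f \<in> E \<Longrightarrow> A f = B f"
  shows "op_spectrum E A = op_spectrum E B"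
proof -
  have "shifted_op z A f = shifted_op z B f" if "f \<in> E" for z f
    using assms(2)[OF that] by (simp add: shifted_op_def)
  then have "op_invertible E (shifted_op z A) \<longleftrightarrow> op_invertible E (shifted_op z B)" for z
    using op_invertible_cong[OF assms(1), of "shifted_op z A" "shifted_op z B"]
      op_invertible_cong[OF assms(1), of "shifted_op z B" "shifted_op z A"] by metis
  then show ?thesis unfolding op_spectrum_def by simp
qed

lemma op_spectral_radius_cong:
  assumes "fun_vs.subspace E" "\<And>f. f \<in> E \<Longrightarrow> A f = B f"
  shows "op_spectral_radius E A = op_spectral_radius E B"
  unfolding op_spectral_radius_def using op_spectrum_cong[OF assms] by simp

context weighted_map
begin

text \<open>The bound makes the \<open>N\<close>-th power of \<open>T / z\<close> a contraction.
  With \<open>N = 1\<close> this confines the spectrum to a disc; a large \<open>N\<close> gives the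
  sharp radius.\<close>

lemma invertible_if_cocycle_bound:
  assumes "z \<noteq> 0" "q < 1" "\<And>k. k \<in> F \<Longrightarrow> cmod (cocycle v \<psi> N k) \<le> q * cmod z ^ N"
  shows "op_invertible E (shifted_op z T)"
proof -
  interpret W: weighted_map X F "\<lambda>k. v k / z" \<psi>
  proof
    show "continuous_map (subtopology X F) euclidean (\<lambda>k. v k / z)"
      using cont_v assms(1) unfolding continuous_map_atin limitin_canonical_iff by (auto intro!: tendsto_divide)
  qed (rule F cont_\<psi>)+
  have eq: "shifted_op z T f = fscale z (f - W.T f)" for f
    using assms(1) by (simp add: shifted_op_def fscale_def fun_eq_iff wcomp_def algebra_simps)
  have con: "sup_norm ((W.T ^^ N) f) \<le> max q 0 * sup_norm f" if f: "f \<in> E" for f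
  proof (rule sup_norm_le)
    fix k
    show "cmod ((W.T ^^ N) f k) \<le> max q 0 * sup_norm f"
    proof (cases "k \<in> F")
      case True
      have "cmod (cocycle v \<psi> N k) / cmod z ^ N \<le> q"
        using assms(1) assms(3)[OF True] by (simp add: field_simps)
      then have "cmod (cocycle v \<psi> N k / z ^ N) \<le> max q 0" by (simp add: norm_divide norm_power)
      then have "cmod (cocycle v \<psi> N k / z ^ N) * cmod (f ((\<psi> ^^ N) k)) \<le> max q 0 * sup_norm f"
        using cmod_le[OF f] by (intro mult_mono) auto
      then show ?thesis unfolding W.T_pow[OF True] cocycle_divide norm_mult .
    next
      case False
      then have "(W.T ^^ N) f k = 0" using W.pow_mem[OF f, of N] by (simp add: C_space_def)
      then show ?thesis by simp
    qed
  qed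
  have q1: "max q 0 < 1" using assms(2) by simp
  interpret S: fun_op E "shifted_op z T" by (rule fun_op_shifted[OF fun_op])
  show ?thesis
  proof (rule S.bij_imp_op_invertible)
    fix f assume f: "f \<in> E" "shifted_op z T f = 0"
    have "f - W.T f = 0"
    proof (rule ext)
      fix x show "(f - W.T f) x = 0 x"
        using fun_cong[OF f(2), of x] assms(1) unfolding eq by (simp add: fscale_def)
    qed
    then show "f = 0" using W.power_contraction(1)[OF q1 con f(1)] by (simp only:)
  next
    show "E \<subseteq> shifted_op z T ` E"
    proof
      fix g assume "g \<in> E"
      then have "fscale (1 / z) g \<in> E" by (rule mem_scale)
      then obtain f where f: "f \<in> E" "f - W.T f = fscale (1 / z) g"
        using W.power_contraction(2)[OF q1 con] by blast
      have "g = shifted_op z T f" unfolding eq f(2) using assms(1) by (simp add: fscale_def)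
      then show "g \<in> shifted_op z T ` E" using f(1) by blast
    qed
  qed
qed

text \<open>Forward: beyond the radius all resolvents exist, so \<open>(T ^^ n) unit_fun\<close> at
  \<open>k\<close>, which is the product of weights, is eventually below \<open>s ^ n\<close>.
  Backward: by compactness the pointwise bounds become uniform, and a power of \<open>T / z\<close>
  still contracts for \<open>z\<close> slightly inside the circle of radius
  \<open>s\<close>.\<close>

lemma op_spectral_radius_less_iff:
  assumes "F \<noteq> {}" "s > 0"
  shows "op_spectral_radius E T < s \<longleftrightarrow> (\<forall>k\<in>F. \<exists>n\<ge>1. cmod (cocycle v \<psi> n k) < s ^ n)"
proof -
  obtain B where B: "B > 0" "\<And>k. k \<in> F \<Longrightarrow> cmod (v k) \<le> B" using bounded_on_F[OF cont_v] by blast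
  have large: "cmod z \<le> B" if "z \<in> op_spectrum E T" for z
  proof (rule ccontr)
    assume "\<not> ?thesis"
    then have z: "cmod z > B" by simp
    have "op_invertible E (shifted_op z T)"
    proof (rule invertible_if_cocycle_bound[where q = "B / cmod z" and N = 1])
      show "z \<noteq> 0" using z B by auto
      show "B / cmod z < 1" using z B(1) by (subst divide_less_eq_1_pos) linarith+
      show "cmod (cocycle v \<psi> 1 k) \<le> B / cmod z * cmod z ^ 1" if "k \<in> F" for k
        using B(2)[OF that] \<open>z \<noteq> 0\<close> by simp
    qed
    then show False using that by (simp add: op_spectrum_def)
  qed
  \<comment> \<open>Without an upper bound the supremum would be an unspecified value.\<close>
  have bdd: "bdd_above (cmod ` op_spectrum E T)" using large by (intro bdd_aboveI[of _ B]) auto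
  have small: "\<exists>n\<ge>1. cmod (cocycle v \<psi> n k) < t ^ n"
    if r: "r < t" "0 < t" and inv: "\<And>z. cmod z > r \<Longrightarrow> z \<notin> op_spectrum E T" and k: "k \<in> F" for r t k
  proof -
    have "(\<lambda>n. (T ^^ n) unit_fun k / of_real t ^ n) \<longlonglongrightarrow> 0"
      using inv by (intro resolvent_power_tendsto[OF r _ unit_fun_mem]) (auto simp: op_spectrum_def)
    then have "(\<lambda>n. cmod (cocycle v \<psi> n k / of_real t ^ n)) \<longlonglongrightarrow> 0"
      using T_pow[OF k] \<psi>_pow_mem[OF k] tendsto_norm_zero by (fastforce simp: unit_fun_def)
    then have "\<forall>\<^sub>F n in sequentially. cmod (cocycle v \<psi> n k / of_real t ^ n) < 1"
      by (rule order_tendstoD) simp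
    then obtain N where "\<And>n. n \<ge> N \<Longrightarrow> cmod (cocycle v \<psi> n k / of_real t ^ n) < 1"
      unfolding eventually_sequentially by blast
    from this[of "Suc N"] have "cmod (cocycle v \<psi> (Suc N) k) < t ^ Suc N"
      using r(2) by (simp add: norm_divide norm_power norm_mult field_simps del: power_Suc)
    then show ?thesis by (intro exI[of _ "Suc N"]) auto
  qed
  \<comment> \<open>The supremum over an empty set would be unspecified too. If the spectrum were
    empty, 0 would be a resolvent point, which bounds \<open>v\<close> below by some
    \<open>c\<close>; yet the products would decay at every rate, in particular faster than
    \<open>c ^ n\<close>.\<close>
  have ne: "op_spectrum E T \<noteq> {}"
  proof
    assume empty: "op_spectrum E T = {}"
    then have "op_invertible E (shifted_op 0 T)" by (auto simp: op_spectrum_def)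
    then obtain S where S: "bounded_op E (shifted_op 0 T)" "bounded_op E S"
      "\<forall>f\<in>E. S (shifted_op 0 T f) = f \<and> shifted_op 0 T (S f) = f"
      unfolding op_invertible_def by blast
    define g where "g = S unit_fun"
    have sh: "cmod (shifted_op 0 T f k) = cmod (T f k)" for f k by (simp add: shifted_op_def fscale_def)
    have g: "g \<in> E" "shifted_op 0 T g = unit_fun" using S unit_fun_mem by (auto simp: g_def bounded_op_def)
    define c where "c = 1 / (sup_norm g + 1)"
    have c: "c > 0" using sup_norm_nonneg[of g] by (simp add: c_def add_nonneg_pos)
    have "cmod (T g k) = 1" if "k \<in> F" for k
      using sh[of g k] that unfolding g(2) by (simp add: unit_fun_def)
    then have vc: "cmod (v k) \<ge> c" if "k \<in> F" for k
      unfolding c_def using g(1) that by (intro weight_lower_bound)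
    have vcn: "cmod (cocycle v \<psi> n k) \<ge> c ^ n" if "k \<in> F" for n k
      using c vc that by (rule cocycle_lower_bound)
    obtain k where k: "k \<in> F" using assms(1) by blast
    obtain n where "n \<ge> 1" "cmod (cocycle v \<psi> n k) < c ^ n"
      using small[of 0 c k] c k empty by blast
    then show False using vcn[OF k, of n] by linarith
  qed
  show ?thesis
  proof
    assume less: "op_spectral_radius E T < s"
    have "z \<notin> op_spectrum E T" if "cmod z > op_spectral_radius E T" for z
      using that cSUP_upper[OF _ bdd, of z] unfolding op_spectral_radius_def by force
    then show "\<forall>k\<in>F. \<exists>n\<ge>1. cmod (cocycle v \<psi> n k) < s ^ n"
      using small[OF less assms(2)] by blast
  next
    assume pt: "\<forall>k\<in>F. \<exists>n\<ge>1. cmod (cocycle v \<psi> n k) < s ^ n"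
    interpret W: weighted_map X F "\<lambda>k. v k / of_real s" \<psi>
    proof
      show "continuous_map (subtopology X F) euclidean (\<lambda>k. v k / of_real s)"
        using cont_v assms(2) unfolding continuous_map_atin limitin_canonical_iff by (auto intro!: tendsto_divide)
    qed (rule F cont_\<psi>)+
    have "\<exists>N. \<forall>n\<ge>N. \<forall>k\<in>F. cmod (cocycle (\<lambda>k. v k / of_real s) \<psi> n k) \<le> 1 / 4"
    proof (rule W.cocycle_unif_tendsto_0)
      fix k assume "k \<in> F"
      then obtain n where n: "n \<ge> 1" "cmod (cocycle v \<psi> n k) < s ^ n" using pt by blast
      then show "\<exists>n\<ge>1. cmod (cocycle (\<lambda>k. v k / of_real s) \<psi> n k) < 1"
        using assms(2) by (intro exI[of _ n]) (simp add: cocycle_divide norm_divide norm_power)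
    qed simp
    then obtain N where N: "\<And>n k. n \<ge> N \<Longrightarrow> k \<in> F \<Longrightarrow> cmod (cocycle (\<lambda>k. v k / of_real s) \<psi> n k) \<le> 1 / 4" by blast
    define m where "m = Suc N"
    have m: "cmod (cocycle v \<psi> m k) \<le> 1 / 4 * s ^ m" if "k \<in> F" for k
      using N[of m k] that assms(2) by (simp add: m_def cocycle_divide norm_divide norm_power norm_mult field_simps del: power_Suc)
    \<comment> \<open>A strict inequality for the supremum needs a radius \<open>t < s\<close>. The
      bound \<open>1 / 4\<close> leaves room for the factor \<open>1 / 2\<close> at such a
      \<open>t\<close>.\<close>
    have "(\<lambda>t. t ^ m) \<midarrow>s\<rightarrow> s ^ m" by (intro tendsto_intros)
    then have "((\<lambda>t. t ^ m) \<longlongrightarrow> s ^ m) (at_left s)" by (rule tendsto_within_subset) simp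
    then have "\<forall>\<^sub>F t in at_left s. t ^ m > s ^ m / 2" 
      by (rule order_tendstoD) (use assms(2) in simp)
    moreover have "\<forall>\<^sub>F t in at_left s. t \<in> {0<..<s}"
      using eventually_at_left_real[OF assms(2)] .
    ultimately have "\<forall>\<^sub>F t in at_left s. t ^ m > s ^ m / 2 \<and> t \<in> {0<..<s}" by (rule eventually_conj)
    then obtain t where t: "t ^ m > s ^ m / 2" "0 < t" "t < s"
      using eventually_happens trivial_limit_at_left_real by fastforce
    have "cmod z \<le> t" if "z \<in> op_spectrum E T" for z
    proof (rule ccontr)
      assume "\<not> ?thesis"
      then have z: "cmod z > t" by simp
      have "op_invertible E (shifted_op z T)"
      proof (rule invertible_if_cocycle_bound[where q = "1 / 2" and N = m])
        show "z \<noteq> 0" using z t by auto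
        show "cmod (cocycle v \<psi> m k) \<le> 1 / 2 * cmod z ^ m" if "k \<in> F" for k
        proof -
          have "t ^ m \<le> cmod z ^ m" using z t by (intro power_mono) auto
          then show ?thesis using m[OF that] t(1) by linarith
        qed
      qed simp
      then show False using that by (simp add: op_spectrum_def)
    qed
    then have "op_spectral_radius E T \<le> t"
      unfolding op_spectral_radius_def using ne by (intro cSUP_least) auto
    then show "op_spectral_radius E T < s" using t by simp
  qed
qed

text \<open>Products of \<open>n\<close> weights are at least \<open>c ^ n\<close>, which
  contradicts the pointwise criterion at radius \<open>c\<close>.\<close>

lemma op_spectral_radius_pos:
  assumes "F \<noteq> {}" "c > 0" "\<And>k. k \<in> F \<Longrightarrow> cmod (v k) \<ge> c"
  shows "op_spectral_radius E T > 0"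
proof (rule ccontr)
  assume "\<not> ?thesis"
  then have "op_spectral_radius E T < c" using assms(2) by simp
  then have pt: "\<forall>k\<in>F. \<exists>n\<ge>1. cmod (cocycle v \<psi> n k) < c ^ n"
    using op_spectral_radius_less_iff[OF assms(1,2)] by blast
  obtain k where "k \<in> F" using assms(1) by blast
  then obtain n where "cmod (cocycle v \<psi> n k) < c ^ n" using pt by blast
  moreover have "cmod (cocycle v \<psi> n k) \<ge> c ^ n"
    using assms(2,3) \<open>k \<in> F\<close> by (rule cocycle_lower_bound)
  ultimately show False by simp
qed

end

section \<open>Reduction to the functions vanishing on the core\<close>

text \<open>A kernel function minus its interpolant has zero image and vanishes on \<open>P\<close>,
  so the estimate makes it 0.\<close>

lemma (in fun_op) kernel_basis:
  assumes "finite P" "apriori E A P C" "dual_system P e"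
  shows "fun_vs.independent (e ` P)" "card (e ` P) = card P" "fun_vs.span (e ` P) = op_kernel E A"
proof -
  have e: "e p \<in> E" "A (e p) = 0" if "p \<in> P" for p
    using assms(3) that by (auto simp: dual_system_def)
  have fam: "dual_family P e" using assms(3) by (simp add: dual_system_def)
  show "fun_vs.independent (e ` P)" by (rule dual_family_independent(2)[OF assms(1) fam])
  show "card (e ` P) = card P" by (rule card_image[OF dual_family_independent(1)[OF assms(1) fam]])
  show "fun_vs.span (e ` P) = op_kernel E A"
  proof
    show "fun_vs.span (e ` P) \<subseteq> op_kernel E A"
      using e by (intro fun_vs.span_minimal subspace_kernel) (auto simp: op_kernel_def)
    show "op_kernel E A \<subseteq> fun_vs.span (e ` P)"
    proof
      fix f assume f: "f \<in> op_kernel E A"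
      then have fE: "f \<in> E" "A f = 0" by (auto simp: op_kernel_def)
      define g where "g = (\<Sum>p\<in>P. fscale (f p) (e p))"
      note c = A_correction[OF assms(1) fE(1) assms(3), folded g_def]
      have "sup_norm (f - g) \<le> C * (sup_norm (A (f - g)) + (\<Sum>p\<in>P. cmod ((f - g) p)))"
        using assms(2) c(1) unfolding apriori_def by blast
      also have "\<dots> = 0" unfolding c(2) fE(2) using c(3) by simp
      finally have "f - g = 0" by (rule norm_eq_0[OF c(1)])
      then have "f = g" by simp
      moreover have "g \<in> fun_vs.span (e ` P)"
        unfolding g_def by (intro fun_vs.span_sum fun_vs.span_scale fun_vs.span_base imageI)
      ultimately show "f \<in> fun_vs.span (e ` P)" by metis
    qed
  qed
qed

text \<open>Applied to the iterated images of an invariant set: an open condition valid on the core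
  is already valid on one of the images.\<close>

lemma compact_nest_subset:
  fixes C :: "nat \<Rightarrow> 'a set"
  assumes "compact_space X" "\<And>n. closedin X (C n)" "decseq C" "openin X U" "(\<Inter>n. C n) \<subseteq> U"
  shows "\<exists>n. C n \<subseteq> U"
proof (rule ccontr)
  assume n: "\<not> ?thesis"
  have "decseq (\<lambda>n. C n - U)" using assms(3) unfolding decseq_def by blast
  then have "(\<Inter>n. C n - U) \<noteq> {}"
    using assms by (intro compact_space_imp_nest[OF assms(1)]) (use n in auto)
  then show False using assms(5) by blast
qed

text \<open>Real and imaginary parts are extended separately, each with bound \<open>B\<close>; this
  is the origin of the factor 2.\<close>

lemma Tietze_complex:
  assumes X: "compact_space X" "Hausdorff_space X" and F: "closedin X F"
    and h: "h \<in> C_space X F" and B: "\<And>x. cmod (h x) \<le> B"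
  shows "\<exists>f\<in>C_space X (topspace X). (\<forall>x\<in>F. f x = h x) \<and> sup_norm f \<le> 2 * B"
proof -
  have norm: "normal_space X" using X by (simp add: compact_Hausdorff_or_regular_imp_normal_space)
  have h': "continuous_map (subtopology X F) euclidean h" using h by (simp add: C_space_def)
  have re: "continuous_map (subtopology X F) euclideanreal (\<lambda>x. Re (h x))"
    "continuous_map (subtopology X F) euclideanreal (\<lambda>x. Im (h x))"
    using h' unfolding continuous_map_atin limitin_canonical_iff by (auto intro!: tendsto_Re tendsto_Im)
  have B0: "B \<ge> 0" using B[of undefined] norm_ge_zero order_trans by blast
  have bd: "\<bar>Re (h x)\<bar> \<le> B" "\<bar>Im (h x)\<bar> \<le> B" for x
    using abs_Re_le_cmod[of "h x"] abs_Im_le_cmod[of "h x"] B[of x] by linarith+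
  have im: "(\<lambda>x. Re (h x)) ` F \<subseteq> {-B..B}" "(\<lambda>x. Im (h x)) ` F \<subseteq> {-B..B}"
    using bd by (auto simp: abs_le_iff minus_le_iff)
  obtain g1 where g1: "continuous_map X euclideanreal g1" "\<And>x. x \<in> F \<Longrightarrow> g1 x = Re (h x)" "g1 ` topspace X \<subseteq> {-B..B}"
    using Tietze_extension_closed_real_interval[OF norm F re(1), of "-B" B]
    using im B0 by (metis neg_le_0_iff_le order_trans)
  obtain g2 where g2: "continuous_map X euclideanreal g2" "\<And>x. x \<in> F \<Longrightarrow> g2 x = Im (h x)" "g2 ` topspace X \<subseteq> {-B..B}"
    using Tietze_extension_closed_real_interval[OF norm F re(2), of "-B" B]
    using im B0 by (metis neg_le_0_iff_le order_trans)
  define f where "f x = (if x \<in> topspace X then Complex (g1 x) (g2 x) else 0)" for x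
  have "continuous_map X euclidean (\<lambda>x. Complex (g1 x) (g2 x))"
    using g1(1) g2(1) unfolding continuous_map_atin limitin_canonical_iff by (auto intro!: tendsto_Complex)
  then have "continuous_map X euclidean f" by (rule continuous_map_eq) (simp add: f_def)
  then have "f \<in> C_space X (topspace X)" by (simp add: C_space_def f_def)
  moreover have "f x = h x" if "x \<in> F" for x
    using that g1(2) g2(2) closedin_subset[OF F] by (auto simp: f_def complex_eq_iff)
  moreover have "sup_norm f \<le> 2 * B"
  proof (rule sup_norm_le)
    fix x
    show "cmod (f x) \<le> 2 * B"
    proof (cases "x \<in> topspace X")
      case True
      then have "\<bar>g1 x\<bar> \<le> B" "\<bar>g2 x\<bar> \<le> B" using g1(3) g2(3) by (auto simp: image_subset_iff abs_le_iff) 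
      then show ?thesis using cmod_le[of "Complex (g1 x) (g2 x)"] True by (simp add: f_def)
    qed (use B0 in \<open>simp add: f_def\<close>)
  qed
  ultimately show ?thesis by blast
qed

locale compact_embedding =
  fixes X :: "'a topology" and \<phi> :: "'a \<Rightarrow> 'a" and v :: "'a \<Rightarrow> complex"
  assumes compact: "compact_space X" and hausdorff: "Hausdorff_space X"
    and cont_\<phi>: "continuous_map X X \<phi>" and inj_\<phi>: "inj_on \<phi> (topspace X)"
    and cont_v: "continuous_map X euclidean v"
begin

abbreviation K :: "'a set" where "K \<equiv> topspace X"

section \<open>The core and the orbits outside it\<close>

definition L :: "'a set" where "L = iterated_image_Inter \<phi> K"

definition W :: "'a set" where "W = K - \<phi> ` K"

lemma \<phi>_mem: "k \<in> K \<Longrightarrow> \<phi> k \<in> K"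
  using continuous_map_funspace[OF cont_\<phi>] by auto

lemma \<phi>_pow_mem: "k \<in> K \<Longrightarrow> (\<phi> ^^ n) k \<in> K"
  by (induction n) (auto intro: \<phi>_mem)

lemma \<phi>_eq: "x \<in> K \<Longrightarrow> y \<in> K \<Longrightarrow> \<phi> x = \<phi> y \<longleftrightarrow> x = y"
  using inj_\<phi> by (auto simp: inj_on_def)

lemma \<phi>_pow_eq: "x \<in> K \<Longrightarrow> y \<in> K \<Longrightarrow> (\<phi> ^^ n) x = (\<phi> ^^ n) y \<longleftrightarrow> x = y"
  by (induction n) (auto simp: \<phi>_eq \<phi>_pow_mem)

lemma closedin_image: "closedin X C \<Longrightarrow> closedin X (\<phi> ` C)"
  using closedin_compact_space[OF compact] image_compactin[OF _ cont_\<phi>] compactin_imp_closedin[OF hausdorff]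
  by blast

lemma closedin_pow_image: "closedin X C \<Longrightarrow> closedin X ((\<phi> ^^ n) ` C)"
proof (induction n)
  case (Suc n)
  then show ?case using closedin_image[OF Suc.IH[OF Suc.prems]] by (simp add: image_comp)
qed simp

lemma pow_image_Suc_subset: "\<phi> ` C \<subseteq> C \<Longrightarrow> (\<phi> ^^ Suc n) ` C \<subseteq> (\<phi> ^^ n) ` C"
  by (auto simp: funpow_Suc_right simp del: funpow.simps)

lemma decseq_pow_image: "\<phi> ` C \<subseteq> C \<Longrightarrow> decseq (\<lambda>n. (\<phi> ^^ n) ` C)"
  unfolding decseq_Suc_iff using pow_image_Suc_subset by blast

lemma K_inv: "\<phi> ` K \<subseteq> K"
  using \<phi>_mem by auto

lemma mem_L_iff: "x \<in> L \<longleftrightarrow> (\<forall>n. x \<in> (\<phi> ^^ n) ` K)"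
  by (simp add: L_def iterated_image_Inter_def)

lemma L_subset: "L \<subseteq> K"
proof
  fix x assume "x \<in> L"
  then have "x \<in> (\<phi> ^^ 0) ` K" unfolding mem_L_iff by blast
  then show "x \<in> K" by simp
qed

lemma closedin_L: "closedin X L"
  unfolding L_def iterated_image_Inter_def using closedin_pow_image by (intro closedin_INT) auto

lemma \<phi>_mem_L_iff: "k \<in> K \<Longrightarrow> \<phi> k \<in> L \<longleftrightarrow> k \<in> L"
proof
  assume k: "k \<in> K" and "\<phi> k \<in> L"
  show "k \<in> L"
    unfolding mem_L_iff
  proof
    fix n
    have "\<phi> k \<in> (\<phi> ^^ Suc n) ` K" using \<open>\<phi> k \<in> L\<close> unfolding mem_L_iff by blast
    then obtain y where "y \<in> K" "\<phi> k = \<phi> ((\<phi> ^^ n) y)" by auto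
    then have "k = (\<phi> ^^ n) y" using \<phi>_eq k \<phi>_pow_mem by blast
    then show "k \<in> (\<phi> ^^ n) ` K" using \<open>y \<in> K\<close> by blast
  qed
next
  assume k: "k \<in> K" "k \<in> L"
  show "\<phi> k \<in> L"
    unfolding mem_L_iff
  proof
    fix n
    have "k \<in> (\<phi> ^^ n) ` K" using k unfolding mem_L_iff by blast
    then obtain y where "y \<in> K" "\<phi> k = (\<phi> ^^ n) (\<phi> y)" by (auto simp: funpow_swap1)
    then show "\<phi> k \<in> (\<phi> ^^ n) ` K" using \<phi>_mem by blast
  qed
qed

lemma L_inv: "\<phi> ` L \<subseteq> L"
  using \<phi>_mem_L_iff L_subset by blast

lemma W_subset: "W \<subseteq> K" by (auto simp: W_def)

lemma W_orbit_notin: "u \<in> W \<Longrightarrow> (\<phi> ^^ n) u \<notin> (\<phi> ^^ Suc n) ` K"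
proof
  assume u: "u \<in> W" and "(\<phi> ^^ n) u \<in> (\<phi> ^^ Suc n) ` K"
  then obtain y where "y \<in> K" "(\<phi> ^^ n) u = (\<phi> ^^ n) (\<phi> y)" by (auto simp: funpow_swap1)
  then have "u = \<phi> y" using \<phi>_pow_eq u \<phi>_mem unfolding W_def by blast
  then show False using u \<open>y \<in> K\<close> unfolding W_def by blast
qed

lemma W_orbit_notin_L: "u \<in> W \<Longrightarrow> (\<phi> ^^ n) u \<notin> L"
  using W_orbit_notin unfolding mem_L_iff by blast

text \<open>A point off \<open>L\<close> leaves the decreasing images of \<open>K\<close> at a first
  index; its iterated preimage of one order less has no further preimage.\<close>

lemma ex_root:
  assumes "x \<in> K" "x \<notin> L"
  shows "\<exists>u\<in>W. \<exists>n. x = (\<phi> ^^ n) u"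
proof -
  have ex: "\<exists>m. x \<notin> (\<phi> ^^ m) ` K" using assms(2) unfolding mem_L_iff by blast
  define m where "m = (LEAST m. x \<notin> (\<phi> ^^ m) ` K)"
  have m: "x \<notin> (\<phi> ^^ m) ` K" unfolding m_def using ex by (rule LeastI_ex)
  then have "m \<noteq> 0" using assms(1) by (intro notI) simp
  then obtain n where n: "m = Suc n" using not0_implies_Suc by blast
  then have "x \<in> (\<phi> ^^ n) ` K" using not_less_Least[of n "\<lambda>m. x \<notin> (\<phi> ^^ m) ` K"] unfolding m_def[symmetric] by simp
  then obtain u where u: "u \<in> K" "x = (\<phi> ^^ n) u" by blast
  have "u \<notin> \<phi> ` K"
  proof
    assume "u \<in> \<phi> ` K"
    then obtain y where "y \<in> K" "u = \<phi> y" by blast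
    then have "x = (\<phi> ^^ m) y" using u n by (simp add: funpow_swap1)
    then show False using m \<open>y \<in> K\<close> by blast
  qed
  then show ?thesis using u unfolding W_def by blast
qed

text \<open>With unequal exponents, the orbit point of the smaller exponent would lie in the next
  image of \<open>K\<close>, which by injectivity puts its root into the image of
  \<open>\<phi>\<close>.\<close>

lemma root_unique:
  assumes "u \<in> W" "u' \<in> W" "(\<phi> ^^ i) u = (\<phi> ^^ j) u'"
  shows "i = j \<and> u = u'"
proof -
  have le: "j \<le> i" if "u \<in> W" "u' \<in> W" "(\<phi> ^^ i) u = (\<phi> ^^ j) u'" for u u' i j
  proof (rule ccontr)
    assume "\<not> j \<le> i"
    then have "j = Suc i + (j - Suc i)" by simp
    then have "(\<phi> ^^ j) u' = (\<phi> ^^ Suc i) ((\<phi> ^^ (j - Suc i)) u')" by (metis comp_apply funpow_add)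
    then have "(\<phi> ^^ j) u' \<in> (\<phi> ^^ Suc i) ` K" using \<phi>_pow_mem that(2) W_subset by blast
    then show False using W_orbit_notin[OF that(1), of i] that(3) by simp
  qed
  have "i = j" using le[OF assms] le[OF assms(2,1) assms(3)[symmetric]] by simp
  then show ?thesis using assms \<phi>_pow_eq W_subset by blast
qed

lemma weighted_map_invariant:
  assumes "closedin X F" "\<phi> ` F \<subseteq> F"
  shows "weighted_map X F v \<phi>"
proof
  show "compactin X F" using closedin_compact_space[OF compact] assms by blast
  show "continuous_map (subtopology X F) (subtopology X F) \<phi>"
    using continuous_map_from_subtopology[OF cont_\<phi>] assms(2)
    by (intro continuous_map_into_subtopology) auto
  show "continuous_map (subtopology X F) euclidean v"
    using continuous_map_from_subtopology[OF cont_v] .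
qed

sublocale wm: weighted_map X "topspace X" v \<phi>
  by (rule weighted_map_invariant[OF closedin_topspace K_inv])

sublocale wl: weighted_map X L v \<phi>
  by (rule weighted_map_invariant[OF closedin_L L_inv])

section \<open>The operator on \<open>C(K)\<close>, on \<open>C(L)\<close> and on the functions
  vanishing on \<open>L\<close>\<close>

abbreviation CK :: "('a \<Rightarrow> complex) set" where "CK \<equiv> C_space X K"
abbreviation CL :: "('a \<Rightarrow> complex) set" where "CL \<equiv> C_space X L"
abbreviation T :: "('a \<Rightarrow> complex) \<Rightarrow> 'a \<Rightarrow> complex" where "T \<equiv> wcomp v \<phi> K"

definition D :: "'a set \<Rightarrow> ('a \<Rightarrow> complex) \<Rightarrow> 'a \<Rightarrow> complex" where
  "D F f = f - wcomp v \<phi> F f"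

definition J :: "('a \<Rightarrow> complex) set" where "J = {f \<in> CK. \<forall>x\<in>L. f x = 0}"

lemma J_subset: "J \<subseteq> CK" by (auto simp: J_def)

lemma D_apply: "x \<in> F \<Longrightarrow> D F f x = f x - v x * f (\<phi> x)"
  by (simp add: D_def wcomp_def)

lemma D_eq: "D F = (\<lambda>f. f - wcomp v \<phi> F f)"
  by (rule ext) (rule D_def)

lemma fun_op_J: "fun_op J T"
proof -
  interpret J: fun_banach J unfolding J_def by (rule wm.fun_banach_vanishing)
  show ?thesis
  proof
    have "T f \<in> J" if "f \<in> J" for f
      using that wm.A_mem[of f] L_inv by (auto simp: J_def wcomp_def)
    then show "bounded_op J T"
      using wm.bop subsetD[OF J_subset] unfolding bounded_op_def Pi_iff by metis
  qed
qed

sublocale j: fun_op J T by (rule fun_op_J)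

sublocale dk: fun_op CK "D K" unfolding D_eq by (rule fun_op_id_minus[OF wm.fun_op])
sublocale dl: fun_op CL "D L" unfolding D_eq by (rule fun_op_id_minus[OF wl.fun_op])
sublocale dj: fun_op J "D K" unfolding D_eq by (rule fun_op_id_minus[OF fun_op_J])

text \<open>The quotient map from \<open>C(K)\<close> onto \<open>C(L)\<close>, with kernel
  \<open>J\<close>, in the encoding by zero extension.\<close>

definition res :: "('a \<Rightarrow> complex) \<Rightarrow> 'a \<Rightarrow> complex" where
  "res f = (\<lambda>x. if x \<in> L then f x else 0)"

lemma res_mem: "f \<in> CK \<Longrightarrow> res f \<in> CL"
proof -
  assume "f \<in> CK"
  then have "continuous_map (subtopology X L) euclidean f"
    using continuous_map_from_subtopology by (auto simp: C_space_def)
  then have "continuous_map (subtopology X L) euclidean (res f)"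
    by (rule continuous_map_eq) (simp add: res_def)
  then show ?thesis by (simp add: C_space_def res_def)
qed

lemma res_D: "res (D K f) = D L (res f)"
  using L_subset L_inv by (auto simp: res_def D_def wcomp_def fun_eq_iff)

lemma res_eq_0_iff: "f \<in> CK \<Longrightarrow> res f = 0 \<longleftrightarrow> f \<in> J"
  by (auto simp: res_def J_def fun_eq_iff)

lemma res_add: "res (f + g) = res f + res g" and res_diff: "res (f - g) = res f - res g"
  and res_scale: "res (fscale c f) = fscale c (res f)" and res_zero: "res 0 = 0"
  by (auto simp: res_def fscale_def fun_eq_iff)

lemma res_sum: "res (sum h I) = (\<Sum>i\<in>I. res (h i))"
  by (rule ext) (simp add: res_def sum_fun_apply)

lemma res_norm: "f \<in> CK \<Longrightarrow> sup_norm (res f) \<le> sup_norm f"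
  by (rule sup_norm_le) (simp add: res_def wm.cmod_le)

lemma ex_extension:
  assumes "h \<in> CL"
  obtains f where "f \<in> CK" "res f = h" "sup_norm f \<le> 2 * sup_norm h"
proof -
  obtain f where f: "f \<in> CK" "\<forall>x\<in>L. f x = h x" "sup_norm f \<le> 2 * sup_norm h"
    using Tietze_complex[OF compact hausdorff closedin_L assms wl.cmod_le[OF assms]] by blast
  moreover have "res f = h" using f(2) assms by (auto simp: res_def C_space_def fun_eq_iff)
  ultimately show ?thesis using that by blast
qed

text \<open>Subtracting the projection onto a small disc makes a function of \<open>J\<close> vanish on some
  \<open>\<phi>\<^sup>m(K)\<close>, and on such functions the Neumann series of \<open>1 - T\<close> is finite.\<close>

lemma D_dense_range_J:
  assumes g: "g \<in> J" and e: "e > 0"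
  shows "\<exists>f\<in>J. sup_norm (D K f - g) \<le> e"
proof -
  have gc: "continuous_map X euclidean g" using g by (simp add: J_def C_space_def)
  have "openin X {x \<in> K. g x \<in> ball 0 e}"
    by (rule openin_continuous_map_preimage[OF gc]) simp
  moreover have "(\<Inter>n. (\<phi> ^^ n) ` K) \<subseteq> {x \<in> K. g x \<in> ball 0 e}"
  proof
    fix x assume "x \<in> (\<Inter>n. (\<phi> ^^ n) ` K)"
    then have "x \<in> L" by (simp add: mem_L_iff)
    then show "x \<in> {x \<in> K. g x \<in> ball 0 e}" using L_subset g e by (auto simp: J_def)
  qed
  ultimately obtain m where m: "(\<phi> ^^ m) ` K \<subseteq> {x \<in> K. g x \<in> ball 0 e}"
    using compact_nest_subset[OF compact closedin_pow_image[OF closedin_topspace] decseq_pow_image[OF K_inv]] by blast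
  define c where "c = closest_point (cball (0::complex) e)"
  have c1: "cmod (c z) \<le> e" for z
    using closest_point_in_set[of "cball (0::complex) e" z] e by (simp add: c_def)
  have c2: "c z = z" if "cmod z \<le> e" for z
    using closest_point_self[of z "cball 0 e"] that by (simp add: c_def)
  have cc: "continuous_on UNIV c"
    unfolding c_def using e by (intro continuous_on_closest_point) auto
  define h where "h x = c (g x)" for x
  have "continuous_map X euclidean h"
    using continuous_map_compose[OF gc, of euclidean c] cc by (simp add: h_def[abs_def] o_def)
  then have hJ: "h \<in> J" using g c2[of 0] e by (auto simp: J_def C_space_def h_def)
  define g' where "g' = g - h"
  have g'J: "g' \<in> J" unfolding g'_def by (rule j.mem_diff[OF g hJ])
  have "(T ^^ m) g' = 0"
  proof
    fix k show "(T ^^ m) g' k = 0 k"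
    proof (cases "k \<in> K")
      case True
      have "(\<phi> ^^ m) k \<in> (\<phi> ^^ m) ` K" using True by blast
      then have "cmod (g ((\<phi> ^^ m) k)) \<le> e" using m by auto
      then have "g' ((\<phi> ^^ m) k) = 0" using c2 by (simp add: g'_def h_def)
      then show ?thesis using wm.T_pow[OF True] by simp
    next
      case False
      then show ?thesis using j.pow_mem[OF g'J, of m] by (simp add: J_def C_space_def)
    qed
  qed
  then have "D K (\<Sum>i<m. (T ^^ i) g') = g'"
    unfolding D_def j.telescope[OF g'J] by simp
  then have "D K (\<Sum>i<m. (T ^^ i) g') - g = - h" by (simp add: g'_def)
  then have "sup_norm (D K (\<Sum>i<m. (T ^^ i) g') - g) \<le> e"
    using c1 by (simp only: sup_norm_uminus) (rule sup_norm_le, simp add: h_def)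
  moreover have "(\<Sum>i<m. (T ^^ i) g') \<in> J" using j.pow_mem[OF g'J] by (intro j.mem_sum)
  ultimately show ?thesis by blast
qed

lemma D_onto_J:
  assumes "finite P" "apriori J (D K) P C" "g \<in> J"
  obtains f where "f \<in> J" "D K f = g"
proof -
  have "g \<in> D K ` J"
    by (rule dj.apriori_closed_range[OF assms(1,2,3)]) (rule D_dense_range_J[OF assms(3)])
  then show ?thesis using that by blast
qed

context
  fixes P C
  assumes P: "finite P" "apriori J (D K) P C"
begin

lemma D_preimage:
  assumes "r \<in> CK" "res r = 0"
  obtains j where "j \<in> CK" "res j = 0" "D K j = r"
proof -
  have "r \<in> J" using assms res_eq_0_iff by blast
  then obtain j where "j \<in> J" "D K j = r" using D_onto_J[OF P] by blast
  then show ?thesis using that[of j] res_eq_0_iff[of j] J_subset by blast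
qed

text \<open>For any extension \<open>f\<close> of \<open>h\<close>, the function \<open>D f\<close>
  lies in \<open>J\<close>, and \<open>D\<close> maps \<open>J\<close> onto \<open>J\<close>;
  subtracting a preimage turns \<open>f\<close> into a kernel function. \<open>range_lift\<close>
  corrects an approximate solution in the same way.\<close>

lemma kernel_lift:
  assumes "h \<in> op_kernel CL (D L)"
  shows "\<exists>f\<in>op_kernel CK (D K). res f = h"
proof -
  have h: "h \<in> CL" "D L h = 0" using assms by (auto simp: op_kernel_def)
  obtain f where f: "f \<in> CK" "res f = h" using ex_extension[OF h(1)] by blast
  have "res (D K f) = 0" unfolding res_D f(2) h(2) ..
  then obtain g where g: "g \<in> CK" "res g = 0" "D K g = D K f" using D_preimage[OF dk.A_mem[OF f(1)]] by blast
  have "f - g \<in> op_kernel CK (D K)"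
    using dk.A_diff[OF f(1) g(1)] g(3) wm.mem_diff[OF f(1) g(1)] by (simp add: op_kernel_def)
  moreover have "res (f - g) = h" unfolding res_diff f(2) g(2) by simp
  ultimately show ?thesis by blast
qed

lemma range_lift:
  assumes g: "g \<in> CK" and "res g \<in> D L ` CL"
  shows "g \<in> D K ` CK"
proof -
  obtain h where h: "h \<in> CL" "res g = D L h" using assms(2) by blast
  obtain f where f: "f \<in> CK" "res f = h" using ex_extension[OF h(1)] by blast
  have "g - D K f \<in> CK" by (intro wm.mem_diff g dk.A_mem f)
  moreover have "res (g - D K f) = 0" unfolding res_diff res_D f(2) h(2) by simp
  ultimately obtain j where j: "j \<in> CK" "D K j = g - D K f" using D_preimage by blast
  have "g = D K (f + j)" unfolding dk.A_add[OF f(1) j(1)] j(2) by (simp add: fun_eq_iff)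
  then show ?thesis using wm.mem_add[OF f(1) j(1)] by blast
qed

end

text \<open>The estimate holds on the subspace \<open>J\<close> as well, which makes
  \<open>D\<close> onto \<open>J\<close>. Kernel functions and approximate preimages on
  \<open>L\<close> then lift to \<open>K\<close>, where the range is known to be closed.\<close>

lemma upper_semi_Fredholm_K_imp:
  assumes "upper_semi_Fredholm CK (D K)"
  shows "\<exists>P C. finite P \<and> apriori J (D K) P C" "upper_semi_Fredholm CL (D L)"
proof -
  obtain P C where P: "finite P" "apriori CK (D K) P C"
    using dk.upper_semi_Fredholm_imp_apriori[OF assms] by blast
  then have apJ: "apriori J (D K) P C" using J_subset unfolding apriori_def by blast
  with P show "\<exists>P C. finite P \<and> apriori J (D K) P C" by blast
  obtain B where B: "finite B" "op_kernel CK (D K) \<subseteq> fun_vs.span B"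
    using assms unfolding upper_semi_Fredholm_def by blast
  have res_span: "res x \<in> fun_vs.span (res ` B)" if "x \<in> fun_vs.span B" for x
    using that
  proof (induction rule: fun_vs.span_induct_alt)
    case base
    show ?case unfolding res_zero by (rule fun_vs.span_zero)
  next
    case (step c x y)
    have "res x \<in> fun_vs.span (res ` B)" by (rule fun_vs.span_base) (use step in blast)
    with step show ?case unfolding res_add res_scale
      by (intro fun_vs.span_add fun_vs.span_scale)
  qed
  have ker: "op_kernel CL (D L) \<subseteq> fun_vs.span (res ` B)"
  proof
    fix h assume "h \<in> op_kernel CL (D L)"
    then obtain f where "f \<in> op_kernel CK (D K)" "res f = h" using kernel_lift[OF P(1) apJ] by blast
    then show "h \<in> fun_vs.span (res ` B)" using B(2) res_span by blast
  qed
  have "g \<in> D L ` CL" if g: "g \<in> CL" and ap: "\<forall>e>0. \<exists>y\<in>D L ` CL. sup_norm (y - g) \<le> e" for g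
  proof -
    obtain G where G: "G \<in> CK" "res G = g" using ex_extension[OF g] by blast
    have "\<exists>y\<in>D K ` CK. sup_norm (y - G) \<le> e" if e: "e > 0" for e
    proof -
      \<comment> \<open>Half, because the extension \<open>q\<close> of the error may have twice its
        norm.\<close>
      have "e / 2 > 0" using e by simp
      then obtain h where h: "h \<in> CL" "sup_norm (D L h - g) \<le> e / 2" using ap by blast
      obtain f where f: "f \<in> CK" "res f = h" using ex_extension[OF h(1)] by blast
      have "D L h - g \<in> CL" by (intro wl.mem_diff dl.A_mem h g)
      then obtain q where q: "q \<in> CK" "res q = D L h - g" "sup_norm q \<le> 2 * sup_norm (D L h - g)"
        using ex_extension by blast
      \<comment> \<open>\<open>r\<close> vanishes on \<open>L\<close>, so it is the image of some
        \<open>j\<close> in \<open>J\<close>; after replacing \<open>f\<close> by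
        \<open>f - j\<close> only the error \<open>q\<close> remains.\<close>
      define r where "r = D K f - G - q"
      have rK: "r \<in> CK" unfolding r_def by (intro wm.mem_diff dk.A_mem f G q)
      have "res r = 0" unfolding r_def res_diff res_D f(2) G(2) q(2) by simp
      then obtain j where jK: "j \<in> CK" and j: "D K j = r" using D_preimage[OF P(1) apJ rK] by blast
      have "D K (f - j) - G = q" unfolding dk.A_diff[OF f(1) jK] j by (simp add: r_def fun_eq_iff)
      then have "sup_norm (D K (f - j) - G) \<le> e" using q(3) h(2) by simp
      then show ?thesis using wm.mem_diff[OF f(1) jK] by blast
    qed
    then have "G \<in> D K ` CK"
      using assms G(1) unfolding upper_semi_Fredholm_def wm.closedin_iff by blast
    then obtain f where "f \<in> CK" "G = D K f" by blast
    then have "g = D L (res f)" "res f \<in> CL" using G(2) res_D res_mem by auto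
    then show ?thesis by blast
  qed
  then have "closedin (Metric_space.mtopology CL sup_dist) (D L ` CL)"
    unfolding wl.closedin_iff using dl.A_mem by blast
  then show "upper_semi_Fredholm CL (D L)"
    unfolding upper_semi_Fredholm_def using dl.bop ker B(1) by blast
qed

text \<open>Restriction to \<open>L\<close> makes the three kernels a short exact sequence: the dual
  functions in \<open>J\<close> together with lifts of a basis on \<open>L\<close> form a basis on
  \<open>K\<close>. Closed range comes from approximating on \<open>L\<close> and applying
  \<open>range_lift\<close>.\<close>

lemma upper_semi_Fredholm_K_if:
  assumes P: "finite P" "apriori J (D K) P C" "dj.dual_system P e"
    and usf: "upper_semi_Fredholm CL (D L)"
  shows "upper_semi_Fredholm CK (D K)"
    "fun_vs.dim (op_kernel CK (D K)) = fun_vs.dim (op_kernel CL (D L)) + card P"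
proof -
  have "g \<in> D K ` CK" if g: "g \<in> CK" and ap: "\<forall>e>0. \<exists>y\<in>D K ` CK. sup_norm (y - g) \<le> e" for g
  proof -
    have "\<exists>y\<in>D L ` CL. sup_norm (y - res g) \<le> e" if e: "e > 0" for e
    proof -
      obtain f where f: "f \<in> CK" "sup_norm (D K f - g) \<le> e" using ap e by blast
      have "sup_norm (D L (res f) - res g) \<le> sup_norm (D K f - g)"
        unfolding res_D[symmetric] res_diff[symmetric] by (rule res_norm[OF wm.mem_diff[OF dk.A_mem[OF f(1)] g]])
      then have "sup_norm (D L (res f) - res g) \<le> e" using f(2) by linarith
      then show ?thesis using res_mem[OF f(1)] by blast
    qed
    then have "res g \<in> D L ` CL"
      using usf res_mem[OF g] unfolding upper_semi_Fredholm_def wl.closedin_iff by blast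
    then show ?thesis by (rule range_lift[OF P(1,2) g])
  qed
  then have closed: "closedin (Metric_space.mtopology CK sup_dist) (D K ` CK)"
    unfolding wm.closedin_iff using dk.A_mem by blast
  note kb = dj.kernel_basis[OF P]
  obtain B0 where B0: "finite B0" "op_kernel CL (D L) \<subseteq> fun_vs.span B0"
    using usf unfolding upper_semi_Fredholm_def by blast
  obtain BL where BL: "BL \<subseteq> op_kernel CL (D L)" "fun_vs.independent BL" "op_kernel CL (D L) \<subseteq> fun_vs.span BL"
    "card BL = fun_vs.dim (op_kernel CL (D L))"
    using fun_vs.basis_exists by blast
  have finBL: "finite BL"
    using fun_vs.independent_span_bound[OF B0(1) BL(2)] BL(1) B0(2) by blast
  have "\<exists>s. \<forall>b\<in>BL. s b \<in> op_kernel CK (D K) \<and> res (s b) = b" using BL(1) kernel_lift[OF P(1,2)] by (intro bchoice) blast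
  then obtain s where s: "\<And>b. b \<in> BL \<Longrightarrow> s b \<in> op_kernel CK (D K)" "\<And>b. b \<in> BL \<Longrightarrow> res (s b) = b" by blast
  have inj: "inj_on s BL" using s(2) by (metis inj_onI)
  define BJ where "BJ = e ` P"
  have finBJ: "finite BJ" using P(1) by (simp add: BJ_def)
  have BJ: "fun_vs.independent BJ" "card BJ = card P" "fun_vs.span BJ = op_kernel J (D K)"
    using kb by (auto simp: BJ_def)
  have resBJ: "res b = 0" if "b \<in> BJ" for b
  proof -
    have "b \<in> op_kernel J (D K)" using BJ(3) fun_vs.span_base[OF that] by blast
    then have "b \<in> J" by (simp add: op_kernel_def)
    then show ?thesis using res_eq_0_iff J_subset by blast
  qed
  \<comment> \<open>A common element would restrict to 0 on \<open>L\<close> and to a basis vector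
    at the same time; disjointness lets the cardinalities add.\<close>
  have disj: "BJ \<inter> s ` BL = {}"
  proof (rule ccontr)
    assume "BJ \<inter> s ` BL \<noteq> {}"
    then obtain b where b: "b \<in> BL" "s b \<in> BJ" by blast
    then have "b = 0" using resBJ s(2) by metis
    then show False using fun_vs.dependent_zero[of BL] BL(2) b(1) by blast
  qed
  define B where "B = BJ \<union> s ` BL"
  have finB: "finite B" using finBJ finBL by (simp add: B_def)
  have cardB: "card B = fun_vs.dim (op_kernel CL (D L)) + card P"
    unfolding B_def card_Un_disjoint[OF finBJ finite_imageI[OF finBL] disj] card_image[OF inj] BJ(2) BL(4) by simp
  have ind: "fun_vs.independent B"
  proof (rule fun_vs.independent_if_scalars_zero[OF finB])
    fix f x assume zero: "(\<Sum>x\<in>B. fscale (f x) x) = 0" and x: "x \<in> B"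
    have split: "(\<Sum>x\<in>BJ. fscale (f x) x) + (\<Sum>b\<in>BL. fscale (f (s b)) (s b)) = 0"
      using zero unfolding B_def sum.union_disjoint[OF finBJ finite_imageI[OF finBL] disj] sum.reindex[OF inj] o_def .
    have "res (\<Sum>x\<in>BJ. fscale (f x) x) = 0"
      unfolding res_sum res_scale using resBJ by (intro sum.neutral) (auto simp: fscale_def fun_eq_iff)
    moreover have "res (\<Sum>b\<in>BL. fscale (f (s b)) (s b)) = (\<Sum>b\<in>BL. fscale (f (s b)) b)"
      unfolding res_sum res_scale using s(2) by (intro sum.cong) auto
    ultimately have "(\<Sum>b\<in>BL. fscale (f (s b)) b) = 0"
      using arg_cong[OF split, of res] unfolding res_add res_zero by simp
    then have fs: "f (s b) = 0" if "b \<in> BL" for b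
      using fun_vs.independentD[OF BL(2) finBL order_refl _ that, of "\<lambda>b. f (s b)"] by blast
    have "(\<Sum>b\<in>BL. fscale (f (s b)) (s b)) = 0"
      using fs by (intro sum.neutral) (auto simp: fscale_def fun_eq_iff)
    then have "(\<Sum>x\<in>BJ. fscale (f x) x) = 0" using split by simp
    then have "f b = 0" if "b \<in> BJ" for b
      using fun_vs.independentD[OF BJ(1) finBJ order_refl _ that, of f] by blast
    then show "f x = 0" using x fs unfolding B_def by blast
  qed
  have BN: "B \<subseteq> op_kernel CK (D K)"
  proof -
    have "BJ \<subseteq> op_kernel J (D K)" using BJ(3) fun_vs.span_superset by blast
    then show ?thesis using s(1) J_subset unfolding B_def op_kernel_def by blast
  qed
  have NB: "op_kernel CK (D K) \<subseteq> fun_vs.span B"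
  proof
    fix f assume f: "f \<in> op_kernel CK (D K)"
    then have fK: "f \<in> CK" "D K f = 0" by (auto simp: op_kernel_def)
    have "res f \<in> op_kernel CL (D L)" using fK res_mem res_D[of f] by (simp add: op_kernel_def res_zero)
    then have "res f \<in> fun_vs.span BL" using BL(3) by blast
    then obtain c where c: "res f = (\<Sum>b\<in>BL. fscale (c b) b)"
      unfolding fun_vs.span_finite[OF finBL] by blast
    define g where "g = (\<Sum>b\<in>BL. fscale (c b) (s b))"
    have gN: "g \<in> op_kernel CK (D K)"
      unfolding g_def using s(1) dk.subspace_kernel
      by (intro fun_vs.subspace_sum fun_vs.subspace_scale)
    have "res g = res f" unfolding g_def c res_sum res_scale using s(2) by (intro sum.cong) auto
    moreover have fgN: "f - g \<in> op_kernel CK (D K)" using f gN dk.subspace_kernel fun_vs.subspace_diff by blast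
    ultimately have "f - g \<in> J" using res_eq_0_iff[of "f - g"] unfolding res_diff op_kernel_def by simp
    then have "f - g \<in> fun_vs.span BJ" using fgN unfolding BJ(3) op_kernel_def by blast
    then have "f - g \<in> fun_vs.span B" using fun_vs.span_mono[of BJ B] unfolding B_def by blast
    moreover have "g \<in> fun_vs.span B"
      unfolding g_def B_def by (intro fun_vs.span_sum fun_vs.span_scale fun_vs.span_base) auto
    ultimately have "(f - g) + g \<in> fun_vs.span B" by (rule fun_vs.span_add)
    then show "f \<in> fun_vs.span B" by simp
  qed
  show "upper_semi_Fredholm CK (D K)"
    unfolding upper_semi_Fredholm_def using dk.bop closed NB finB by blast
  show "fun_vs.dim (op_kernel CK (D K)) = fun_vs.dim (op_kernel CL (D L)) + card P"
    using fun_vs.dim_unique[OF BN NB ind refl] cardB by simp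
qed

text \<open>Without points in the estimate \<open>D\<close> is bijective on \<open>J\<close>, so
  invertibility passes from the quotient \<open>C(L)\<close> to \<open>C(K)\<close>. This is the
  source of the claim that \<open>M2\<close> is nonempty when \<open>\<mu>\<close> is off the
  spectrum on \<open>C(L)\<close>.\<close>

lemma invertible_K_if:
  assumes "apriori J (D K) {} C" "op_invertible CL (D L)"
  shows "op_invertible CK (D K)"
proof (rule dk.bij_imp_op_invertible)
  obtain S where S: "bounded_op CL S" "\<forall>f\<in>CL. S (D L f) = f \<and> D L (S f) = f"
    using assms(2) unfolding op_invertible_def by blast
  have inj: "h = 0" if "h \<in> CL" "D L h = 0" for h
  proof -
    have "h = S (D L 0)" using S(2) that by (simp only: dl.A_zero) metis
    then show ?thesis using S(2) wl.mem_zero by metis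
  qed
  fix f assume f: "f \<in> CK" "D K f = 0"
  have "res f = 0" using inj[OF res_mem[OF f(1)]] res_D[of f] f(2) res_zero by simp
  then have "f \<in> J" using res_eq_0_iff f(1) by blast
  then have "sup_norm f \<le> C * (sup_norm (D K f) + 0)" using assms(1) unfolding apriori_def by simp
  then show "f = 0" using f wm.norm_eq_0 by simp
next
  obtain S where S: "bounded_op CL S" "\<forall>f\<in>CL. S (D L f) = f \<and> D L (S f) = f"
    using assms(2) unfolding op_invertible_def by blast
  have SL: "S f \<in> CL" if "f \<in> CL" for f using S(1) that by (auto simp: bounded_op_def)
  show "CK \<subseteq> D K ` CK"
  proof
    fix g assume g: "g \<in> CK"
    have "res g = D L (S (res g))" using S(2) res_mem[OF g] by simp
    then have "res g \<in> D L ` CL" using SL[OF res_mem[OF g]] by blast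
    then show "g \<in> D K ` CK" by (rule range_lift[OF finite.emptyI assms(1) g])
  qed
qed

end

section \<open>From a splitting to an a priori estimate\<close>

lemma continuous_map_finite_support:
  fixes f :: "'a \<Rightarrow> complex"
  assumes "Hausdorff_space Y" "finite A" "\<And>a. a \<in> A \<Longrightarrow> openin Y {a}" "\<And>x. x \<in> topspace Y \<Longrightarrow> x \<notin> A \<Longrightarrow> f x = 0"
  shows "continuous_map Y euclidean f"
  unfolding continuous_map_def
proof (intro conjI allI impI)
  fix U :: "complex set"
  have A: "A \<subseteq> topspace Y" using assms(3) openin_subset by blast
  have fin_closed: "closedin Y S" if "S \<subseteq> A" for S
    using Hausdorff_imp_t1_space[OF assms(1)] that A finite_subset[OF that assms(2)]
    unfolding t1_space_closedin_finite by blast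
  have fin_open: "openin Y S" if "S \<subseteq> A" for S
  proof -
    have "openin Y (\<Union>a\<in>S. {a})" using assms(3) that by (intro openin_Union) auto
    then show ?thesis by simp
  qed
  show "openin Y {x \<in> topspace Y. f x \<in> U}"
  proof (cases "0 \<in> U")
    case True
    have "{x \<in> topspace Y. f x \<in> U} = topspace Y - {a \<in> A. f a \<notin> U}"
      using A True assms(4) by force
    then show ?thesis using fin_closed[of "{a \<in> A. f a \<notin> U}"] by (simp add: openin_diff)
  next
    case False
    have "{x \<in> topspace Y. f x \<in> U} = {a \<in> A. f a \<in> U}"
      using A False assms(4) by force
    then show ?thesis using fin_open[of "{a \<in> A. f a \<in> U}"] by simp
  qed
qed auto

context compact_embedding
begin

lemma closedin_finite: "finite S \<Longrightarrow> S \<subseteq> K \<Longrightarrow> closedin X S"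
  using Hausdorff_imp_t1_space[OF hausdorff] unfolding t1_space_closedin_finite by blast

section \<open>The core of an invariant set and the inverse operator on it\<close>

abbreviation core :: "'a set \<Rightarrow> 'a set" where "core C \<equiv> iterated_image_Inter \<phi> C"

lemma mem_core: "x \<in> core C \<longleftrightarrow> (\<forall>n. x \<in> (\<phi> ^^ n) ` C)"
  by (simp add: iterated_image_Inter_def)

lemma core_subset: "core C \<subseteq> C"
  using mem_core[of _ C] by (metis funpow_0 id_apply image_cong image_ident subsetI)

lemma core_subset_L: "C \<subseteq> K \<Longrightarrow> core C \<subseteq> L"
  unfolding mem_core mem_L_iff subset_iff by blast

lemma closedin_core: "closedin X C \<Longrightarrow> closedin X (core C)"
  unfolding iterated_image_Inter_def using closedin_pow_image by (intro closedin_INT) auto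

text \<open>Injectivity lets one preimage serve for all iterated images at once. Thus
  \<open>\<phi>\<close> restricts to a bijection of the core and can be inverted there.\<close>

lemma core_image:
  assumes "C \<subseteq> K" "\<phi> ` C \<subseteq> C"
  shows "\<phi> ` core C = core C"
proof
  show "\<phi> ` core C \<subseteq> core C"
  proof
    fix y assume "y \<in> \<phi> ` core C"
    then obtain x where x: "x \<in> core C" "y = \<phi> x" by blast
    have "y \<in> (\<phi> ^^ n) ` C" for n
    proof -
      have "x \<in> (\<phi> ^^ n) ` C" using x mem_core by blast
      then have "y \<in> (\<phi> ^^ Suc n) ` C" using x by auto
      then show ?thesis using pow_image_Suc_subset[OF assms(2)] by blast
    qed
    then show "y \<in> core C" by (simp add: mem_core)
  qed
  show "core C \<subseteq> \<phi> ` core C"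
  proof
    fix y assume y: "y \<in> core C"
    then have "y \<in> (\<phi> ^^ 1) ` C" unfolding mem_core by blast
    then obtain x where x: "x \<in> C" "y = \<phi> x" by auto
    have "x \<in> (\<phi> ^^ n) ` C" for n
    proof -
      have "y \<in> (\<phi> ^^ Suc n) ` C" using y unfolding mem_core by blast
      then obtain c where c: "c \<in> C" "\<phi> x = \<phi> ((\<phi> ^^ n) c)" using x by auto
      then have "x = (\<phi> ^^ n) c" using \<phi>_eq x \<phi>_pow_mem assms(1) by blast
      then show ?thesis using c by blast
    qed
    then show "y \<in> \<phi> ` core C" using x by (auto simp: mem_core)
  qed
qed

lemma core_nonempty:
  assumes "closedin X C" "\<phi> ` C \<subseteq> C" "C \<noteq> {}"
  shows "core C \<noteq> {}"
  unfolding iterated_image_Inter_def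
  using assms closedin_pow_image decseq_pow_image by (intro compact_space_imp_nest[OF compact]) auto

text \<open>When \<open>\<phi>\<close> maps \<open>F\<close> onto itself and \<open>v\<close> has no
  zero on \<open>F\<close>, the inverse of \<open>T\<close> on \<open>C(F)\<close> is again a
  weighted composition operator, with this map and the weight \<open>inv_weight\<close> defined
  next.\<close>

definition inv_on :: "'a set \<Rightarrow> 'a \<Rightarrow> 'a" where "inv_on F = inv_into F \<phi>"
definition inv_weight :: "'a set \<Rightarrow> 'a \<Rightarrow> complex" where "inv_weight F y = 1 / v (inv_on F y)"

context
  fixes F :: "'a set"
  assumes F: "closedin X F" "\<phi> ` F = F"
begin

lemma F_subset_K: "F \<subseteq> K" using F(1) closedin_subset by blast

lemma inv_on_mem: "y \<in> F \<Longrightarrow> inv_on F y \<in> F"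
  unfolding inv_on_def using F(2) by (metis inv_into_into)

lemma \<phi>_inv_on: "y \<in> F \<Longrightarrow> \<phi> (inv_on F y) = y"
  unfolding inv_on_def using F(2) by (metis f_inv_into_f)

lemma inv_on_\<phi>: "x \<in> F \<Longrightarrow> inv_on F (\<phi> x) = x"
  unfolding inv_on_def using inv_into_f_f inj_on_subset[OF inj_\<phi> F_subset_K] by metis

lemma inv_on_pow_mem: "y \<in> F \<Longrightarrow> (inv_on F ^^ n) y \<in> F"
  by (induction n) (auto intro: inv_on_mem)

lemma \<phi>_pow_inv_on_pow: "y \<in> F \<Longrightarrow> (\<phi> ^^ n) ((inv_on F ^^ n) y) = y"
proof (induction n arbitrary: y)
  case (Suc n)
  have "(\<phi> ^^ Suc n) ((inv_on F ^^ Suc n) y) = \<phi> ((\<phi> ^^ n) ((inv_on F ^^ n) (inv_on F y)))"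
    by (simp add: funpow_swap1)
  then show ?case using Suc.IH[OF inv_on_mem[OF Suc.prems]] \<phi>_inv_on[OF Suc.prems] by simp
qed simp

lemma \<phi>_pow_inv_on_pow_le: "y \<in> F \<Longrightarrow> l \<le> m \<Longrightarrow> (\<phi> ^^ l) ((inv_on F ^^ m) y) = (inv_on F ^^ (m - l)) y"
proof -
  assume y: "y \<in> F" and "l \<le> m"
  then have "(inv_on F ^^ m) y = (inv_on F ^^ l) ((inv_on F ^^ (m - l)) y)"
    by (metis comp_apply funpow_add le_add_diff_inverse)
  then show ?thesis using \<phi>_pow_inv_on_pow[OF inv_on_pow_mem[OF y]] by simp
qed

lemma weighted_map_inverse:
  assumes nz: "\<And>k. k \<in> F \<Longrightarrow> v k \<noteq> 0"
  shows "weighted_map X F (inv_weight F) (inv_on F)"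
proof
  have [simp]: "topspace (subtopology X F) = F" using F_subset_K by auto
  show "compactin X F" using closedin_compact_space[OF compact F(1)] .
  show c: "continuous_map (subtopology X F) (subtopology X F) (inv_on F)"
    unfolding continuous_map_closedin
  proof (intro conjI allI impI)
    show "inv_on F \<in> topspace (subtopology X F) \<rightarrow> topspace (subtopology X F)" using inv_on_mem F_subset_K by auto
    fix C assume "closedin (subtopology X F) C"
    then have C: "closedin X C" "C \<subseteq> F" using closedin_closed_subtopology[OF F(1)] by auto
    \<comment> \<open>The preimage of a closed set under the inverse is its image under
      \<open>\<phi>\<close>, closed because \<open>K\<close> is compact and Hausdorff.\<close>
    have "{x \<in> topspace (subtopology X F). inv_on F x \<in> C} = \<phi> ` C"
    proof
      show "\<phi> ` C \<subseteq> {x \<in> topspace (subtopology X F). inv_on F x \<in> C}"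
        using C(2) F(2) F_subset_K \<phi>_mem inv_on_\<phi> by auto
      show "{x \<in> topspace (subtopology X F). inv_on F x \<in> C} \<subseteq> \<phi> ` C"
        using \<phi>_inv_on by (auto simp: image_iff) metis
    qed
    then show "closedin (subtopology X F) {x \<in> topspace (subtopology X F). inv_on F x \<in> C}"
      using closedin_image[OF C(1)] C(2) F closedin_closed_subtopology[OF F(1)] by auto
  qed
  have "continuous_map (subtopology X F) euclidean (\<lambda>y. v (inv_on F y))"
    using continuous_map_compose[OF c continuous_map_from_subtopology[OF cont_v]] by (simp add: o_def)
  then show "continuous_map (subtopology X F) euclidean (inv_weight F)"
    using nz inv_on_mem unfolding inv_weight_def[abs_def] continuous_map_atin limitin_canonical_iff
    by (auto intro!: tendsto_divide)
qed

text \<open>Going back \<open>n\<close> steps from \<open>y\<close> traverses, in reverse, the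
  forward orbit of the point reached; the same weights are multiplied, as reciprocals.\<close>

lemma cocycle_inverse:
  assumes "y \<in> F"
  shows "cocycle (inv_weight F) (inv_on F) n y = 1 / cocycle v \<phi> n ((inv_on F ^^ n) y)"
  using assms
proof (induction n arbitrary: y)
  case (Suc n)
  define z where "z = (inv_on F ^^ n) (inv_on F y)"
  have z: "(inv_on F ^^ Suc n) y = z" by (simp add: z_def funpow_swap1)
  have "(\<phi> ^^ n) z = inv_on F y" unfolding z_def using \<phi>_pow_inv_on_pow inv_on_mem Suc.prems by blast
  then have "cocycle v \<phi> (n + 1) z = cocycle v \<phi> n z * v (inv_on F y)"
    unfolding cocycle_add by simp
  then have "1 / cocycle v \<phi> (Suc n) z = (1 / v (inv_on F y)) * (1 / cocycle v \<phi> n z)" by simp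
  also have "\<dots> = inv_weight F y * cocycle (inv_weight F) (inv_on F) n (inv_on F y)"
    unfolding Suc.IH[OF inv_on_mem[OF Suc.prems]] z_def by (simp only: inv_weight_def)
  also have "\<dots> = cocycle (inv_weight F) (inv_on F) (Suc n) y" by (simp only: cocycle_Suc)
  finally show ?case unfolding z by (rule sym)
qed simp

end

definition M :: "'a set" where "M = K - X interior_of L"

lemma M_closure: "M = X closure_of (K - L)"
  by (simp add: M_def closure_of_complement)

lemma KL_subset_M: "K - L \<subseteq> M"
  unfolding M_closure by (rule closure_of_subset) auto

text \<open>The conditions on both spectral radii in terms of products of
  \<open>v = w / \<mu>\<close>, for which the critical radius is 1. For an empty part the
  quantifiers are vacuous, so no case distinction is made.\<close>

definition dynamic_splitting :: "'a set \<Rightarrow> 'a set \<Rightarrow> bool" where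
  "dynamic_splitting M1 M2 \<longleftrightarrow>
     M = M1 \<union> M2 \<and> M1 \<inter> M2 = {} \<and> closedin X M1 \<and> closedin X M2 \<and> \<phi> ` M1 \<subseteq> M1 \<and> \<phi> ` M2 \<subseteq> M2 \<and>
     (\<forall>k\<in>M1. \<exists>n\<ge>1. cmod (cocycle v \<phi> n k) < 1) \<and>
     finite (M2 - \<phi> ` M2) \<and> (\<forall>k\<in>core M2. v k \<noteq> 0) \<and>
     (\<forall>y\<in>core M2. \<exists>n\<ge>1. cmod (cocycle (inv_weight (core M2)) (inv_on (core M2)) n y) < 1)"

text \<open>Repeated substitution into \<open>f k = D K f k + v k * f (\<phi> k)\<close>.\<close>

lemma D_iterate:
  assumes "k \<in> K"
  shows "f k = (\<Sum>i<n. cocycle v \<phi> i k * D K f ((\<phi> ^^ i) k)) + cocycle v \<phi> n k * f ((\<phi> ^^ n) k)"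
proof (induction n)
  case (Suc n)
  have "f ((\<phi> ^^ n) k) = D K f ((\<phi> ^^ n) k) + v ((\<phi> ^^ n) k) * f ((\<phi> ^^ Suc n) k)"
    using D_apply[OF \<phi>_pow_mem[OF assms], of f n] by simp
  moreover have "cocycle v \<phi> (Suc n) k = cocycle v \<phi> n k * v ((\<phi> ^^ n) k)"
    using cocycle_add[of v \<phi> n 1 k] by simp
  ultimately show ?case using Suc by (simp add: algebra_simps)
qed simp

lemma cocycle_bounds:
  obtains b where "\<And>i. b i > 0" "\<And>i k. k \<in> K \<Longrightarrow> cmod (cocycle v \<phi> i k) \<le> b i"
proof -
  have "\<exists>B>0. \<forall>k\<in>K. cmod (cocycle v \<phi> i k) \<le> B" for i
    using wm.bounded_on_F[OF wm.cont_cocycle, of i] by metis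
  then show ?thesis using that by metis
qed

lemma D_iterate_diff_le:
  assumes "k \<in> K" "f \<in> CK" "\<And>i k. k \<in> K \<Longrightarrow> cmod (cocycle v \<phi> i k) \<le> b i"
  shows "cmod (f k - cocycle v \<phi> n k * f ((\<phi> ^^ n) k)) \<le> (\<Sum>i<n. b i) * sup_norm (D K f)"
proof -
  have "f k - cocycle v \<phi> n k * f ((\<phi> ^^ n) k) = (\<Sum>i<n. cocycle v \<phi> i k * D K f ((\<phi> ^^ i) k))"
    using D_iterate[OF assms(1), of f n] by simp
  also have "cmod \<dots> \<le> (\<Sum>i<n. b i * sup_norm (D K f))"
  proof (rule sum_norm_le)
    fix i
    show "cmod (cocycle v \<phi> i k * D K f ((\<phi> ^^ i) k)) \<le> b i * sup_norm (D K f)"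
      unfolding norm_mult using assms(3)[OF assms(1), of i] wm.cmod_le[OF dk.A_mem[OF assms(2)]]
      by (intro mult_mono) (auto intro: order_trans[OF norm_ge_zero])
  qed
  finally show ?thesis by (simp add: sum_distrib_right)
qed

section \<open>Consequences of a splitting\<close>

context
  fixes M1 M2 :: "'a set"
  assumes split: "dynamic_splitting M1 M2"
begin

lemma splitting_facts: "M = M1 \<union> M2" "M1 \<inter> M2 = {}" "closedin X M1" "closedin X M2" "\<phi> ` M1 \<subseteq> M1" "\<phi> ` M2 \<subseteq> M2"
  using split by (auto simp: dynamic_splitting_def)

lemma M2_subset_K: "M2 \<subseteq> K" using splitting_facts(4) closedin_subset by blast
lemma M1_subset_K: "M1 \<subseteq> K" using splitting_facts(3) closedin_subset by blast

lemma pow_mem_M1: "x \<in> M1 \<Longrightarrow> (\<phi> ^^ n) x \<in> M1" and pow_mem_M2: "x \<in> M2 \<Longrightarrow> (\<phi> ^^ n) x \<in> M2"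
  using splitting_facts(5,6) by (induction n) auto

lemma root_in_M2:
  assumes "u \<in> W" "(\<phi> ^^ n) u \<notin> M1"
  shows "u \<in> M2"
proof -
  have "u \<in> K - L" using assms(1) W_orbit_notin_L[of u 0] W_subset by auto
  then have "u \<in> M" using KL_subset_M by blast
  then show ?thesis using splitting_facts(1) pow_mem_M1[of u n] assms(2) by blast
qed

text \<open>A point of \<open>M2\<close> off \<open>L\<close> traces back to a root, which is in
  \<open>M2\<close> because \<open>M1\<close> is invariant. Points of \<open>M2\<close> in
  \<open>L\<close> are limits of points off \<open>L\<close>.\<close>

lemma M2_minus_image: "M2 - \<phi> ` M2 = M2 \<inter> W"
proof
  show "M2 \<inter> W \<subseteq> M2 - \<phi> ` M2" using M2_subset_K by (auto simp: W_def)
  have finW: "finite (M2 \<inter> W)"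
    using split finite_subset[of "M2 \<inter> W" "M2 - \<phi> ` M2"] M2_subset_K unfolding dynamic_splitting_def W_def by blast
  show "M2 - \<phi> ` M2 \<subseteq> M2 \<inter> W"
  proof
    fix x assume x: "x \<in> M2 - \<phi> ` M2"
    have key: "y \<in> W" if y: "y \<in> K" "y \<notin> L" "y \<notin> M1" "y \<notin> \<phi> ` M2" for y
    proof -
      obtain u n where u: "u \<in> W" "y = (\<phi> ^^ n) u" using ex_root y by blast
      then have uM: "u \<in> M2" using root_in_M2 y(3) by blast
      show ?thesis
      proof (cases n)
        case (Suc m)
        then have "y = \<phi> ((\<phi> ^^ m) u)" using u by simp
        then show ?thesis using pow_mem_M2[OF uM] y(4) by blast
      qed (use u in simp)
    qed
    show "x \<in> M2 \<inter> W"
    proof (cases "x \<in> L")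
      case False
      then show ?thesis using x key[of x] M2_subset_K splitting_facts(2) by blast
    next
      case True
      \<comment> \<open>Finiteness of \<open>M2 \<inter> W\<close> makes this set open. If it
        contained a point of \<open>L\<close> in \<open>M2\<close>, it would also contain a point
        off \<open>L\<close>, which \<open>key\<close> puts into the removed set
        \<open>M2 \<inter> W\<close>.\<close>
      have "openin X (K - (\<phi> ` M2 \<union> M1 \<union> (M2 \<inter> W)))"
        using splitting_facts(3) closedin_image[OF splitting_facts(4)] closedin_finite[OF finW] M2_subset_K by (intro openin_diff) auto
      moreover have "x \<notin> W"
      proof
        assume "x \<in> W"
        then show False using W_orbit_notin_L[of x 0] True by simp
      qed
      then have "x \<in> K - (\<phi> ` M2 \<union> M1 \<union> (M2 \<inter> W))" using x M2_subset_K splitting_facts(2) by blast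
      moreover have "x \<in> X closure_of (K - L)" using x splitting_facts(1) M_closure by blast
      ultimately obtain y where y: "y \<in> K - L" "y \<in> K - (\<phi> ` M2 \<union> M1 \<union> (M2 \<inter> W))"
        unfolding in_closure_of by meson
      then have "y \<in> W" using key[of y] by blast
      moreover have "y \<in> M2" using y KL_subset_M splitting_facts(1) by blast
      ultimately show ?thesis using y by blast
    qed
  qed
qed

lemma finite_M2W: "finite (M2 \<inter> W)"
  using split unfolding M2_minus_image[symmetric] dynamic_splitting_def by blast

lemma M2_minus_L:
  assumes "x \<in> M2" "x \<notin> L"
  obtains u n where "u \<in> M2 \<inter> W" "x = (\<phi> ^^ n) u"
proof -
  obtain u n where u: "u \<in> W" "x = (\<phi> ^^ n) u" using ex_root assms M2_subset_K by blast
  then have "u \<in> M2" using root_in_M2 assms(1) splitting_facts(2) by blast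
  then show ?thesis using that u by blast
qed

text \<open>Outside \<open>M1\<close> and the image of order \<open>n + 1\<close> only the first
  \<open>n + 1\<close> points of finitely many orbits are left: a finite open set. Isolation makes
  functions supported on orbit segments continuous.\<close>

lemma isolated:
  assumes "u \<in> M2 \<inter> W"
  shows "openin X {(\<phi> ^^ n) u}"
proof -
  let ?x = "(\<phi> ^^ n) u"
  define Z where "Z = K - (\<phi> ^^ Suc n) ` K - M1"
  have Zo: "openin X Z" unfolding Z_def
    using splitting_facts(3) closedin_pow_image[OF closedin_topspace, of "Suc n"] by (intro openin_diff) auto
  have "Z \<subseteq> (\<lambda>(i, u). (\<phi> ^^ i) u) ` ({..n} \<times> (M2 \<inter> W))"
  proof
    fix y assume y: "y \<in> Z"
    then have "y \<notin> L" unfolding Z_def mem_L_iff by blast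
    then obtain u' i where u': "u' \<in> W" "y = (\<phi> ^^ i) u'" using ex_root y unfolding Z_def by blast
    then have "u' \<in> M2" using root_in_M2 y unfolding Z_def by blast
    moreover have "i \<le> n"
    proof (rule ccontr)
      assume "\<not> i \<le> n"
      then have "i = Suc n + (i - Suc n)" by simp
      then have "y = (\<phi> ^^ Suc n) ((\<phi> ^^ (i - Suc n)) u')" using u'(2) by (metis comp_apply funpow_add)
      then show False using y \<phi>_pow_mem u'(1) W_subset unfolding Z_def by blast
    qed
    ultimately show "y \<in> (\<lambda>(i, u). (\<phi> ^^ i) u) ` ({..n} \<times> (M2 \<inter> W))" using u' by force
  qed
  then have "finite Z" using finite_M2W by (meson finite_SigmaI finite_atMost finite_imageI finite_subset)
  then have "openin X (Z - (Z - {?x}))"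
    using Zo by (intro openin_diff closedin_finite) (auto simp: Z_def)
  moreover have "?x \<in> Z"
  proof -
    have "?x \<notin> (\<phi> ^^ Suc n) ` K" using W_orbit_notin assms by blast
    moreover have "?x \<in> M2" using pow_mem_M2 assms by blast
    ultimately show ?thesis using M2_subset_K splitting_facts(2) unfolding Z_def by blast
  qed
  then have "Z - (Z - {?x}) = {?x}" by blast
  ultimately show ?thesis by simp
qed

lemma core_M2: "closedin X (core M2)" "\<phi> ` core M2 = core M2"
  using closedin_core[OF splitting_facts(4)] core_image[OF M2_subset_K splitting_facts(6)] by auto

text \<open>On the core the inverse products of some length are at most \<open>1 / 4\<close>, so the
  forward ones exceed 2. That is an open condition, which compactness extends to a whole image of
  \<open>M2\<close>.\<close>

lemma expansion:
  obtains N m where "N \<ge> 1" "\<And>x. x \<in> (\<phi> ^^ m) ` M2 \<Longrightarrow> cmod (cocycle v \<phi> N x) \<ge> 2"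
proof -
  let ?N = "core M2"
  note c = core_M2
  have nz: "\<And>k. k \<in> ?N \<Longrightarrow> v k \<noteq> 0" using split unfolding dynamic_splitting_def by blast
  interpret I: weighted_map X ?N "inv_weight ?N" "inv_on ?N"
    by (rule weighted_map_inverse[OF c nz])
  have "\<exists>N0. \<forall>n\<ge>N0. \<forall>y\<in>?N. cmod (cocycle (inv_weight ?N) (inv_on ?N) n y) \<le> 1 / 4"
    using split unfolding dynamic_splitting_def by (intro I.cocycle_unif_tendsto_0) auto
  then obtain N0 where N0: "\<And>n y. n \<ge> N0 \<Longrightarrow> y \<in> ?N \<Longrightarrow> cmod (cocycle (inv_weight ?N) (inv_on ?N) n y) \<le> 1 / 4"
    by blast
  define N where "N = Suc N0"
  have big: "cmod (cocycle v \<phi> N x) > 2" if x: "x \<in> ?N" for x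
  proof -
    have pow: "(\<phi> ^^ n) x \<in> ?N \<and> (inv_on ?N ^^ n) ((\<phi> ^^ n) x) = x" for n
    proof (induction n)
      case (Suc n)
      have "inv_on ?N (\<phi> ((\<phi> ^^ n) x)) = (\<phi> ^^ n) x" using inv_on_\<phi>[OF c] Suc by blast
      then have "(inv_on ?N ^^ Suc n) ((\<phi> ^^ Suc n) x) = (inv_on ?N ^^ n) ((\<phi> ^^ n) x)"
        by (simp add: funpow_swap1)
      then show ?case using Suc c(2) by auto
    qed (use x in simp)
    have nzN: "cocycle v \<phi> n x \<noteq> 0" for n
      unfolding cocycle_def using nz pow by simp
    have "cmod (1 / cocycle v \<phi> N x) \<le> 1 / 4"
      using N0[of N "(\<phi> ^^ N) x"] pow[of N] cocycle_inverse[OF c, of "(\<phi> ^^ N) x" N] by (simp add: N_def)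
    then show ?thesis using nzN[of N] by (simp add: norm_divide field_simps)
  qed
  have "continuous_map X euclideanreal (\<lambda>k. cmod (cocycle v \<phi> N k))"
    using wm.cont_cocycle[of N] unfolding subtopology_topspace continuous_map_atin limitin_canonical_iff
    by (auto intro!: tendsto_norm)
  then have "openin X {k \<in> K. cmod (cocycle v \<phi> N k) \<in> {2<..}}"
    by (rule openin_continuous_map_preimage) simp
  moreover have "(\<Inter>n. (\<phi> ^^ n) ` M2) \<subseteq> {k \<in> K. cmod (cocycle v \<phi> N k) \<in> {2<..}}"
    using big core_subset[of M2] M2_subset_K unfolding iterated_image_Inter_def by auto
  ultimately obtain m where "(\<phi> ^^ m) ` M2 \<subseteq> {k \<in> K. cmod (cocycle v \<phi> N k) \<in> {2<..}}"
    using compact_nest_subset[OF compact closedin_pow_image[OF splitting_facts(4)] decseq_pow_image[OF splitting_facts(6)]] by blast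
  then have "\<And>x. x \<in> (\<phi> ^^ m) ` M2 \<Longrightarrow> cmod (cocycle v \<phi> N x) \<ge> 2" by fastforce
  then show ?thesis using that[of N m] by (simp add: N_def)
qed

text \<open>Over \<open>N\<close> steps \<open>f k\<close> is a bounded multiple of
  \<open>D K f\<close> plus at most half of a later value of \<open>f\<close> on \<open>M1\<close>;
  iteration removes the remainder.\<close>

lemma estimate_M1:
  obtains C1 where "C1 \<ge> 0" "\<And>f k. f \<in> J \<Longrightarrow> k \<in> M1 \<Longrightarrow> cmod (f k) \<le> C1 * sup_norm (D K f)"
proof -
  interpret I: weighted_map X M1 v \<phi> by (rule weighted_map_invariant[OF splitting_facts(3,5)])
  have "\<exists>N. \<forall>n\<ge>N. \<forall>k\<in>M1. cmod (cocycle v \<phi> n k) \<le> 1 / 2"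
    using split unfolding dynamic_splitting_def by (intro I.cocycle_unif_tendsto_0) auto
  then obtain N where N: "\<And>k. k \<in> M1 \<Longrightarrow> cmod (cocycle v \<phi> N k) \<le> 1 / 2" by blast
  obtain b where b: "\<And>i. b i > 0" "\<And>i k. k \<in> K \<Longrightarrow> cmod (cocycle v \<phi> i k) \<le> b i" using cocycle_bounds by blast
  define S where "S = (\<Sum>i<N. b i)"
  have S: "S \<ge> 0" unfolding S_def using b(1) less_imp_le by (intro sum_nonneg) auto
  have "cmod (f k) \<le> 2 * S * sup_norm (D K f)" if f: "f \<in> J" and k: "k \<in> M1" for f k
  proof -
    have fK: "f \<in> CK" using f J_subset by blast
    have it: "cmod (f k) \<le> 2 * S * sup_norm (D K f) + sup_norm f / 2 ^ i" if "k \<in> M1" for i k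
      using that
    proof (induction i arbitrary: k)
      case 0
      have "0 \<le> 2 * S * sup_norm (D K f)" using S by simp
      then show ?case using wm.cmod_le[OF fK, of k] by simp
    next
      case (Suc i)
      let ?x = "(\<phi> ^^ N) k"
      have kK: "k \<in> K" using Suc.prems M1_subset_K by blast
      have "cmod (f k) \<le> cmod (f k - cocycle v \<phi> N k * f ?x) + cmod (cocycle v \<phi> N k * f ?x)"
        using norm_triangle_sub by (metis add.commute)
      also have "\<dots> \<le> S * sup_norm (D K f) + 1 / 2 * (2 * S * sup_norm (D K f) + sup_norm f / 2 ^ i)"
        unfolding norm_mult S_def
        using N[OF Suc.prems] Suc.IH[OF pow_mem_M1[OF Suc.prems], of N, unfolded S_def] S
        by (intro add_mono mult_mono D_iterate_diff_le[OF kK fK b(2)]) auto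
      finally show ?case by (simp add: field_simps)
    qed
    have "(\<lambda>i. 2 * S * sup_norm (D K f) + sup_norm f * (1 / 2) ^ i) \<longlonglongrightarrow> 2 * S * sup_norm (D K f) + sup_norm f * 0"
      by (intro tendsto_intros LIMSEQ_power_zero) auto
    then show ?thesis
      using it[OF k] by (intro LIMSEQ_le_const[where X = "\<lambda>i. 2 * S * sup_norm (D K f) + sup_norm f * (1 / 2) ^ i"])
        (auto simp: power_one_over)
  qed
  then show ?thesis using that[of "2 * S"] S by auto
qed

text \<open>The iteration is read in the other direction: dividing by the large product bounds a
  value by the one \<open>N\<close> steps earlier, so one value controls the rest of the
  orbit.\<close>

lemma estimate_orbit:
  assumes N: "N \<ge> 1" "\<And>x. x \<in> (\<phi> ^^ m) ` M2 \<Longrightarrow> cmod (cocycle v \<phi> N x) \<ge> 2"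
  obtains A where "A \<ge> 0" "\<And>f p l. f \<in> J \<Longrightarrow> p \<in> (\<phi> ^^ m) ` M2 \<Longrightarrow>
    cmod (f ((\<phi> ^^ l) p)) \<le> A * (sup_norm (D K f) + cmod (f p))"
proof -
  obtain b where b: "\<And>i. b i > 0" "\<And>i k. k \<in> K \<Longrightarrow> cmod (cocycle v \<phi> i k) \<le> b i" using cocycle_bounds by blast
  have stay: "(\<phi> ^^ l) p \<in> (\<phi> ^^ m) ` M2" if p: "p \<in> (\<phi> ^^ m) ` M2" for p l
  proof -
    obtain y where "y \<in> M2" "p = (\<phi> ^^ m) y" using p by blast
    then have "(\<phi> ^^ l) p = (\<phi> ^^ m) ((\<phi> ^^ l) y)" by (metis add.commute comp_apply funpow_add)
    then show ?thesis using pow_mem_M2 \<open>y \<in> M2\<close> by blast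
  qed
  have inK: "p \<in> K" if "p \<in> (\<phi> ^^ m) ` M2" for p using that M2_subset_K \<phi>_pow_mem by blast
  have nzc: "cmod (cocycle v \<phi> l p) \<ge> 2 / b (N - l)" if p: "p \<in> (\<phi> ^^ m) ` M2" and l: "l \<le> N" for p l
  proof -
    have "cocycle v \<phi> N p = cocycle v \<phi> l p * cocycle v \<phi> (N - l) ((\<phi> ^^ l) p)"
      using cocycle_add[of v \<phi> l "N - l" p] l by simp
    then have "2 \<le> cmod (cocycle v \<phi> l p) * cmod (cocycle v \<phi> (N - l) ((\<phi> ^^ l) p))"
      using N(2)[OF p] by (simp add: norm_mult)
    also have "\<dots> \<le> cmod (cocycle v \<phi> l p) * b (N - l)"
      using b(2)[OF inK[OF stay[OF p]]] by (intro mult_left_mono) auto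
    finally show ?thesis using b(1) by (simp add: divide_le_eq)
  qed
  define S where "S = (\<Sum>i<N. b i)"
  have S: "S \<ge> 0" unfolding S_def using b(1) less_imp_le by (intro sum_nonneg) auto
  \<comment> \<open>The sum serves the first \<open>N\<close> steps, where a product, as a factor of
    one of length \<open>N\<close>, is only known to be at least \<open>2 / b (N - l)\<close>. The
    summand \<open>S\<close> serves the inductive step.\<close>
  define A where "A = S + (\<Sum>l\<le>N. (1 + S) * b (N - l))"
  have A: "A \<ge> S" "\<And>l. l \<le> N \<Longrightarrow> A \<ge> (1 + S) * b (N - l)"
  proof -
    have nn: "0 \<le> (1 + S) * b (N - l)" for l using S b(1)[of "N - l"] by simp
    show "A \<ge> S" unfolding A_def using nn by (simp add: sum_nonneg)
    show "A \<ge> (1 + S) * b (N - l)" if "l \<le> N" for l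
      unfolding A_def using that nn S member_le_sum[of l "{..N}" "\<lambda>l. (1 + S) * b (N - l)"] by fastforce
  qed
  have forward: "cmod (cocycle v \<phi> l k) * cmod (f ((\<phi> ^^ l) k)) \<le> cmod (f k) + S * sup_norm (D K f)"
    if f: "f \<in> CK" and k: "k \<in> K" and l: "l \<le> N" for f k l
  proof -
    have "cmod (cocycle v \<phi> l k * f ((\<phi> ^^ l) k)) \<le> cmod (f k) + cmod (f k - cocycle v \<phi> l k * f ((\<phi> ^^ l) k))"
      by (metis norm_minus_commute norm_triangle_sub)
    also have "cmod (f k - cocycle v \<phi> l k * f ((\<phi> ^^ l) k)) \<le> (\<Sum>i<l. b i) * sup_norm (D K f)"
      by (rule D_iterate_diff_le[OF k f b(2)])
    also have "\<dots> \<le> S * sup_norm (D K f)"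
      unfolding S_def using l b(1) less_imp_le by (intro mult_right_mono sum_mono2) auto
    finally show ?thesis by (simp add: norm_mult)
  qed
  have "cmod (f ((\<phi> ^^ l) p)) \<le> A * (sup_norm (D K f) + cmod (f p))"
    if f: "f \<in> J" and p: "p \<in> (\<phi> ^^ m) ` M2" for f p l
  proof (induction l rule: less_induct)
    case (less l)
    have fK: "f \<in> CK" using f J_subset by blast
    let ?\<delta> = "sup_norm (D K f) + cmod (f p)"
    have d0: "?\<delta> \<ge> 0" by (simp add: add_nonneg_nonneg)
    show ?case
    proof (cases "l \<le> N")
      case True
      have "2 / b (N - l) * cmod (f ((\<phi> ^^ l) p)) \<le> cmod (cocycle v \<phi> l p) * cmod (f ((\<phi> ^^ l) p))"
        using nzc[OF p True] by (intro mult_right_mono) auto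
      also have "\<dots> \<le> cmod (f p) + S * sup_norm (D K f)" by (rule forward[OF fK inK[OF p] True])
      also have "\<dots> \<le> (1 + S) * ?\<delta>"
        using S mult_nonneg_nonneg[OF S norm_ge_zero[of "f p"]] by (simp add: algebra_simps)
      finally have "2 * cmod (f ((\<phi> ^^ l) p)) \<le> (1 + S) * b (N - l) * ?\<delta>"
        using b(1)[of "N - l"] by (simp add: field_simps)
      also have "\<dots> \<le> A * ?\<delta>" using A(2)[OF True] d0 by (rule mult_right_mono)
      finally show ?thesis using norm_ge_zero[of "f ((\<phi> ^^ l) p)"] by linarith
    next
      case False
      define x where "x = (\<phi> ^^ (l - N)) p"
      have x: "x \<in> (\<phi> ^^ m) ` M2" unfolding x_def by (rule stay[OF p])
      have xl: "(\<phi> ^^ N) x = (\<phi> ^^ l) p" unfolding x_def using False by (metis comp_apply funpow_add le_add_diff_inverse nat_le_linear)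
      have "2 * cmod (f ((\<phi> ^^ l) p)) \<le> cmod (cocycle v \<phi> N x) * cmod (f ((\<phi> ^^ N) x))"
        unfolding xl using N(2)[OF x] by (intro mult_right_mono) auto
      also have "\<dots> \<le> cmod (f x) + S * sup_norm (D K f)" by (rule forward[OF fK inK[OF x]]) simp
      also have "cmod (f x) \<le> A * ?\<delta>" unfolding x_def using False N(1) by (intro less) auto
      also have "S * sup_norm (D K f) \<le> A * ?\<delta>" using A(1) S by (intro mult_mono) auto
      finally show ?thesis by linarith
    qed
  qed
  then show ?thesis using that[of A] A(1) S by auto
qed

lemma splitting_apriori:
  assumes N: "N \<ge> 1" "\<And>x. x \<in> (\<phi> ^^ m) ` M2 \<Longrightarrow> cmod (cocycle v \<phi> N x) \<ge> 2"
  shows "\<exists>C. apriori J (D K) ((\<phi> ^^ m) ` (M2 \<inter> W)) C"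
proof -
  obtain C1 where C1: "C1 \<ge> 0" "\<And>f k. f \<in> J \<Longrightarrow> k \<in> M1 \<Longrightarrow> cmod (f k) \<le> C1 * sup_norm (D K f)"
    using estimate_M1 by blast
  obtain A where A: "A \<ge> 0" "\<And>f p l. f \<in> J \<Longrightarrow> p \<in> (\<phi> ^^ m) ` M2 \<Longrightarrow>
    cmod (f ((\<phi> ^^ l) p)) \<le> A * (sup_norm (D K f) + cmod (f p))" using estimate_orbit[OF N] by blast
  obtain b where b: "\<And>i. b i > 0" "\<And>i k. k \<in> K \<Longrightarrow> cmod (cocycle v \<phi> i k) \<le> b i" using cocycle_bounds by blast
  define S where "S = (\<Sum>i\<le>m. b i)"
  have S: "S \<ge> 0" "\<And>i. i \<le> m \<Longrightarrow> b i \<le> S" "\<And>i. i \<le> m \<Longrightarrow> (\<Sum>j<i. b j) \<le> S"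
  proof -
    show "S \<ge> 0" unfolding S_def using b(1) less_imp_le by (intro sum_nonneg) auto
    show "b i \<le> S" if "i \<le> m" for i unfolding S_def using that b(1) less_imp_le by (intro member_le_sum) auto
    show "(\<Sum>j<i. b j) \<le> S" if "i \<le> m" for i unfolding S_def using that b(1) less_imp_le by (intro sum_mono2) auto
  qed
  define P where "P = (\<phi> ^^ m) ` (M2 \<inter> W)"
  have finP: "finite P" using finite_M2W by (simp add: P_def)
  define C where "C = C1 + A + S"
  have C: "C1 \<le> C" "A \<le> C" "S \<le> C" "C \<ge> 0" using C1(1) A(1) S(1) by (auto simp: C_def)
  have "cmod (f k) \<le> C * (sup_norm (D K f) + (\<Sum>p\<in>P. cmod (f p)))" if f: "f \<in> J" for f k
  proof -
    have fK: "f \<in> CK" using f J_subset by blast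
    let ?\<sigma> = "\<Sum>p\<in>P. cmod (f p)"
    have s0: "?\<sigma> \<ge> 0" by (intro sum_nonneg) auto
    have R0: "sup_norm (D K f) + ?\<sigma> \<ge> 0" using s0 by (simp add: add_nonneg_nonneg)
    show ?thesis
    proof (cases "k \<in> K - L")
      case False
      then have "f k = 0" using f by (auto simp: J_def C_space_def)
      then show ?thesis using C(4) R0 by simp
    next
      case True
      then consider "k \<in> M1" | "k \<in> M2" using KL_subset_M splitting_facts(1) by blast
      then show ?thesis
      proof cases
        case 1
        have "C1 * sup_norm (D K f) \<le> C * (sup_norm (D K f) + ?\<sigma>)"
          using C s0 by (intro mult_mono) auto
        then show ?thesis using C1(2)[OF f 1] by linarith
      next
        case 2
        then obtain u n where u: "u \<in> M2 \<inter> W" "k = (\<phi> ^^ n) u" using M2_minus_L True by blast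
        define p where "p = (\<phi> ^^ m) u"
        have pP: "p \<in> P" using u by (auto simp: P_def p_def)
        have pM: "p \<in> (\<phi> ^^ m) ` M2" using u by (auto simp: p_def)
        have fp: "cmod (f p) \<le> ?\<sigma>" using pP finP by (intro member_le_sum) auto
        show ?thesis
        proof (cases "m \<le> n")
          case True
          have "k = (\<phi> ^^ (n - m)) p" using u(2) True unfolding p_def by (metis comp_apply funpow_add le_add_diff_inverse2)
          then have "cmod (f k) \<le> A * (sup_norm (D K f) + cmod (f p))" using A(2)[OF f pM] by simp
          also have "\<dots> \<le> C * (sup_norm (D K f) + ?\<sigma>)" using C A(1) fp by (intro mult_mono add_left_mono) (auto intro: add_nonneg_nonneg)
          finally show ?thesis .
        next
          case False
          let ?i = "m - n"
          have pk: "(\<phi> ^^ ?i) k = p" using u(2) False unfolding p_def by (metis comp_apply funpow_add le_add_diff_inverse2 nat_le_linear)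
          have kK: "k \<in> K" using 2 M2_subset_K by blast
          have "cmod (f k) \<le> cmod (f k - cocycle v \<phi> ?i k * f p) + cmod (cocycle v \<phi> ?i k * f p)"
            using norm_triangle_sub by (metis add.commute)
          also have "\<dots> \<le> (\<Sum>j<?i. b j) * sup_norm (D K f) + b ?i * cmod (f p)"
            unfolding norm_mult pk[symmetric] using b(2)[OF kK, of ?i]
            by (intro add_mono D_iterate_diff_le[OF kK fK b(2)] mult_right_mono) auto
          also have "\<dots> \<le> S * sup_norm (D K f) + S * ?\<sigma>"
            using S fp by (intro add_mono mult_mono) auto
          also have "\<dots> = S * (sup_norm (D K f) + ?\<sigma>)" by (simp add: algebra_simps)
          also have "\<dots> \<le> C * (sup_norm (D K f) + ?\<sigma>)" using C R0 by (intro mult_right_mono) auto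
          finally show ?thesis .
        qed
      qed
    qed
  qed
  then have "apriori J (D K) P C" unfolding apriori_def by (intro ballI sup_norm_le)
  then show ?thesis unfolding P_def by blast
qed

text \<open>The kernel vector carried by the orbit of \<open>p\<close>, truncated after \<open>R\<close> steps, is almost annihilated by \<open>D\<close>.\<close>

lemma splitting_minimal:
  assumes N: "N \<ge> 1" "\<And>x. x \<in> (\<phi> ^^ m) ` M2 \<Longrightarrow> cmod (cocycle v \<phi> N x) \<ge> 2"
    and p: "p \<in> (\<phi> ^^ m) ` (M2 \<inter> W)"
  shows "\<not> apriori J (D K) ((\<phi> ^^ m) ` (M2 \<inter> W) - {p}) C"
proof
  assume ap: "apriori J (D K) ((\<phi> ^^ m) ` (M2 \<inter> W) - {p}) C"
  obtain u where u: "u \<in> M2 \<inter> W" "p = (\<phi> ^^ m) u" using p by blast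
  have uW: "u \<in> W" and uK: "u \<in> K" using u W_subset by auto
  define orb where "orb i = (\<phi> ^^ i) u" for i
  have inj: "inj orb"
    unfolding orb_def using root_unique[OF uW uW] by (intro injI) blast
  have grow: "cmod (cocycle v \<phi> (l * N) p) \<ge> 2 ^ l" for l
  proof (induction l)
    case (Suc l)
    have "(\<phi> ^^ (l * N)) p = (\<phi> ^^ m) ((\<phi> ^^ (l * N)) u)" unfolding u(2) by (metis add.commute comp_apply funpow_add)
    then have "(\<phi> ^^ (l * N)) p \<in> (\<phi> ^^ m) ` M2" using pow_mem_M2 u(1) by blast
    then have "2 ^ l * 2 \<le> cmod (cocycle v \<phi> (l * N) p) * cmod (cocycle v \<phi> N ((\<phi> ^^ (l * N)) p))"
      using N(2) Suc by (intro mult_mono) auto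
    then show ?case using cocycle_add[of v \<phi> "l * N" N p] by (simp add: norm_mult add.commute mult.commute)
  qed simp
  have "1 \<le> max C 0 * (1 / 2) ^ l" for l
  proof -
    define R where "R = m + l * N"
    define c where "c = cocycle v \<phi> (l * N) p"
    have c: "cmod c \<ge> 2 ^ l" using grow by (simp add: c_def)
    then have c0: "c \<noteq> 0" by (metis norm_zero not_le zero_less_numeral zero_less_power)
    \<comment> \<open>Solves \<open>f x = v x * f (\<phi> x)\<close> backwards from step
      \<open>R\<close>, scaled to 1 at \<open>p\<close>. The root \<open>u\<close> has no preimage
      in \<open>K\<close>, so the only defect is \<open>1 / c\<close> at the cut, and
      \<open>c\<close> is at least \<open>2 ^ l\<close> in modulus.\<close>
    define f where "f x = (if x \<in> orb ` {..R} then cocycle v \<phi> (R - inv orb x) x / c else 0)" for x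
    have f_orb: "f (orb i) = (if i \<le> R then cocycle v \<phi> (R - i) (orb i) / c else 0)" for i
      using inj by (auto simp: f_def inj_image_mem_iff)
    have orbK: "orb i \<in> K" "orb i \<notin> L" for i
      unfolding orb_def using \<phi>_pow_mem[OF uK] W_orbit_notin_L[OF uW] by auto
    have "continuous_map X euclidean f"
    proof (rule continuous_map_finite_support[OF hausdorff])
      show "openin X {a}" if "a \<in> orb ` {..R}" for a using that isolated[OF u(1)] by (auto simp: orb_def)
    qed (auto simp: f_def)
    then have fJ: "f \<in> J" using orbK by (auto simp: J_def C_space_def f_def)
    have Df: "cmod (D K f x) \<le> 1 / cmod c" for x
    proof (cases "x \<in> K")
      case False
      then have "D K f x = 0" by (simp add: D_def wcomp_def f_def image_iff) (use orbK in metis)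
      then show ?thesis by simp
    next
      case xK: True
      note Dx = D_apply[OF xK, of f]
      show ?thesis
      proof (cases "x \<in> range orb")
        case True
        then obtain i where i: "x = orb i" by blast
        have \<phi>x: "\<phi> x = orb (Suc i)" by (simp add: i orb_def)
        consider "i < R" | "i = R" | "i > R" by linarith
        then show ?thesis
        proof cases
          case 1
          then have "R - i = Suc (R - Suc i)" by simp
          then have "cocycle v \<phi> (R - i) x = v x * cocycle v \<phi> (R - Suc i) (\<phi> x)" by (simp only: cocycle_Suc)
          moreover have "f x = cocycle v \<phi> (R - i) x / c" using 1 f_orb[of i] i by simp
          moreover have "f (\<phi> x) = cocycle v \<phi> (R - Suc i) (\<phi> x) / c" using 1 f_orb[of "Suc i"] \<phi>x by simp
          ultimately have "f x = v x * f (\<phi> x)" by simp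
          then show ?thesis using Dx by simp
        next
          case 2
          then have "f x = 1 / c" "f (\<phi> x) = 0" using f_orb[of i] f_orb[of "Suc i"] i \<phi>x by simp_all
          then show ?thesis using Dx by (simp add: norm_divide)
        next
          case 3
          then have "f x = 0" "f (\<phi> x) = 0" using f_orb[of i] f_orb[of "Suc i"] i \<phi>x by simp_all
          then show ?thesis using Dx by simp
        qed
      next
        case False
        then have "\<phi> x \<notin> orb ` {..R}"
        proof (intro notI)
          assume "\<phi> x \<in> orb ` {..R}"
          then obtain i where i: "\<phi> x = orb i" by blast
          show False
          proof (cases i)
            case 0
            then have "u = \<phi> x" using i by (simp add: orb_def)
            then show False using uW xK by (auto simp: W_def)
          next
            case (Suc j)
            then have "\<phi> x = \<phi> (orb j)" using i by (simp add: orb_def)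
            then have "x = orb j" using \<phi>_eq xK orbK by blast
            then show False using False by blast
          qed
        qed
        then have "f x = 0" "f (\<phi> x) = 0" using False by (auto simp: f_def)
        then show ?thesis using Dx by simp
      qed
    qed
    have fp: "f p = 1"
      using f_orb[of m] c0 by (simp add: u(2) orb_def R_def c_def)
    have "f q = 0" if q: "q \<in> (\<phi> ^^ m) ` (M2 \<inter> W) - {p}" for q
    proof -
      obtain u' where u': "u' \<in> W" "q = (\<phi> ^^ m) u'" using q by blast
      have "q \<notin> orb ` {..R}"
      proof
        assume "q \<in> orb ` {..R}"
        then obtain i where "(\<phi> ^^ m) u' = (\<phi> ^^ i) u" using u' by (auto simp: orb_def)
        then have "u' = u" using root_unique[OF u'(1) uW] by blast
        then show False using u' u q by blast
      qed
      then show ?thesis by (simp add: f_def)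
    qed
    then have "(\<Sum>q\<in>(\<phi> ^^ m) ` (M2 \<inter> W) - {p}. cmod (f q)) = 0" by (intro sum.neutral) auto
    then have "sup_norm f \<le> C * sup_norm (D K f)" using ap fJ unfolding apriori_def by fastforce
    moreover have "1 \<le> sup_norm f" using j.cmod_le[OF fJ, of p] fp by simp
    moreover have "sup_norm (D K f) \<le> (1 / 2) ^ l"
    proof (rule sup_norm_le)
      fix x
      have "1 / cmod c \<le> 1 / 2 ^ l" using c c0 by (intro divide_left_mono) auto
      then show "cmod (D K f x) \<le> (1 / 2) ^ l" using Df[of x] by (simp add: power_one_over)
    qed
    moreover have "C * sup_norm (D K f) \<le> max C 0 * sup_norm (D K f)" by (intro mult_right_mono) auto
    moreover have "max C 0 * sup_norm (D K f) \<le> max C 0 * (1 / 2) ^ l"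
      using \<open>sup_norm (D K f) \<le> (1 / 2) ^ l\<close> by (intro mult_left_mono) auto
    ultimately show ?thesis by linarith
  qed
  moreover have "(\<lambda>l. max C 0 * (1 / 2) ^ l) \<longlonglongrightarrow> max C 0 * 0"
    by (intro tendsto_intros LIMSEQ_power_zero) auto
  ultimately have "1 \<le> max C 0 * (0 :: real)" by (intro LIMSEQ_le_const) auto
  then show False by simp
qed

lemma splitting_dual_system:
  "\<exists>P C e. finite P \<and> apriori J (D K) P C \<and> dj.dual_system P e \<and> card P = card (M2 - \<phi> ` M2)"
proof -
  obtain N m where N: "N \<ge> 1" "\<And>x. x \<in> (\<phi> ^^ m) ` M2 \<Longrightarrow> cmod (cocycle v \<phi> N x) \<ge> 2"
    using expansion by blast
  define P where "P = (\<phi> ^^ m) ` (M2 \<inter> W)"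
  have finP: "finite P" using finite_M2W by (simp add: P_def)
  obtain C where C: "apriori J (D K) P C" using splitting_apriori[OF N] unfolding P_def by blast
  have "\<exists>e. \<forall>p\<in>P. e p \<in> J \<and> D K (e p) = 0 \<and> e p p = 1 \<and> (\<forall>q\<in>P - {p}. e p q = 0)"
    using dj.ex_dual_kernel_vector[OF finP C] splitting_minimal[OF N] unfolding P_def
    by (intro bchoice) blast
  then have "\<exists>e. dj.dual_system P e" unfolding dj.dual_system_def dual_family_def by blast
  moreover have "card P = card (M2 - \<phi> ` M2)"
    unfolding P_def M2_minus_image using \<phi>_pow_eq W_subset
    by (intro card_image inj_onI) blast
  ultimately show ?thesis using finP C by blast
qed

end

end

section \<open>From an a priori estimate to a splitting\<close>

context compact_embedding
begin

text \<open>Vanishing on the \<open>m\<close>-th image keeps the Neumann series finite, the phases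
  along the orbit of \<open>y\<close> turn its terms into moduli, and the zeros at the other orbit
  points of \<open>Q\<close> suppress their contributions. All three are prescriptions on one closed
  set, met by a Tietze extension.\<close>

lemma ex_test_function:
  assumes y: "y \<in> K" "y \<notin> L" and Q: "finite Q" "Q \<subseteq> K"
  shows "\<exists>g m. g \<in> J \<and> n \<le> m \<and> (\<forall>k\<in>K. g ((\<phi> ^^ m) k) = 0) \<and> sup_norm g \<le> 2 \<and>
    (\<forall>i<n. cocycle v \<phi> i y * g ((\<phi> ^^ i) y) = of_real (cmod (cocycle v \<phi> i y))) \<and>
    (\<forall>q\<in>Q. \<forall>i<m. (\<phi> ^^ i) q \<notin> (\<lambda>l. (\<phi> ^^ l) y) ` {..<n} \<longrightarrow> g ((\<phi> ^^ i) q) = 0)"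
proof -
  obtain u s where u: "u \<in> W" "y = (\<phi> ^^ s) u" using ex_root y by blast
  define orb where "orb i = (\<phi> ^^ i) y" for i
  have orb_u: "orb i = (\<phi> ^^ (i + s)) u" for i unfolding orb_def u(2) by (simp add: funpow_add)
  have inj: "inj orb" unfolding orb_u using root_unique[OF u(1) u(1)] by (intro injI) (metis add_right_cancel)
  have orbK: "orb i \<in> K" for i unfolding orb_def using \<phi>_pow_mem[OF y(1)] .
  \<comment> \<open>The first \<open>n\<close> points of the orbit of \<open>y\<close> are iterates
    of \<open>u\<close> of order below \<open>s + n\<close>, hence lie outside this image of
    \<open>K\<close>.\<close>
  define m where "m = s + n"
  have orb_out: "orb i \<notin> (\<phi> ^^ m) ` K" if "i < n" for i
  proof -
    have "(\<phi> ^^ m) ` K \<subseteq> (\<phi> ^^ Suc (i + s)) ` K"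
      using decseq_pow_image[OF K_inv] that by (simp add: decseq_def m_def del: funpow.simps)
    then show ?thesis using W_orbit_notin[OF u(1), of "i + s"] unfolding orb_u by blast
  qed
  define Z where "Z = orb ` {..<n} \<union> (\<lambda>(i, q). (\<phi> ^^ i) q) ` ({..<m} \<times> Q)"
  have Z: "finite Z" "Z \<subseteq> K" unfolding Z_def using Q orbK \<phi>_pow_mem by auto
  define S where "S = Z \<union> (\<phi> ^^ m) ` K"
  have Sc: "closedin X S" unfolding S_def using Z closedin_finite closedin_pow_image[OF closedin_topspace] by (intro closedin_Un) auto
  then have SK: "S \<subseteq> K" by (rule closedin_subset)
  \<comment> \<open>The conjugate phase of the product. Where the product is 0, division by 0 yields
    0, which is the required value.\<close>
  define h where "h x = (if x \<in> orb ` {..<n}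
    then cnj (cocycle v \<phi> (inv orb x) y) / of_real (cmod (cocycle v \<phi> (inv orb x) y)) else 0)" for x
  have h_orb: "h (orb i) = cnj (cocycle v \<phi> i y) / of_real (cmod (cocycle v \<phi> i y))" if "i < n" for i
    using inj that by (simp add: h_def)
  have h1: "cmod (h x) \<le> 1" for x by (auto simp: h_def norm_divide)
  have "continuous_map (subtopology X S) euclidean h"
  proof (rule continuous_map_finite_support[where A = "orb ` {..<n}"])
    show "Hausdorff_space (subtopology X S)" using hausdorff by (rule Hausdorff_space_subtopology)
    fix a assume a: "a \<in> orb ` {..<n}"
    have "openin X (K - ((Z - {a}) \<union> (\<phi> ^^ m) ` K))"
      using Z closedin_finite[of "Z - {a}"] closedin_pow_image[OF closedin_topspace]
      by (intro openin_diff closedin_Un) auto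
    then have "openin (subtopology X S) (S \<inter> (K - ((Z - {a}) \<union> (\<phi> ^^ m) ` K)))" by (rule openin_subtopology_Int2)
    moreover have "S \<inter> (K - ((Z - {a}) \<union> (\<phi> ^^ m) ` K)) = {a}"
      using a orb_out orbK unfolding S_def Z_def by auto
    ultimately show "openin (subtopology X S) {a}" by simp
  qed (auto simp: h_def)
  moreover have "h x = 0" if "x \<notin> S" for x using that by (auto simp: h_def S_def Z_def)
  ultimately have hC: "h \<in> C_space X S" by (simp add: C_space_def)
  obtain g where g: "g \<in> CK" "\<forall>x\<in>S. g x = h x" "sup_norm g \<le> 2 * 1"
    using Tietze_complex[OF compact hausdorff Sc hC h1] by blast
  have g0: "g ((\<phi> ^^ m) k) = 0" if "k \<in> K" for k
  proof -
    have "(\<phi> ^^ m) k \<in> (\<phi> ^^ m) ` K" using that by blast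
    then have "(\<phi> ^^ m) k \<in> S" "(\<phi> ^^ m) k \<notin> orb ` {..<n}"
      unfolding S_def using orb_out by (blast, metis imageE lessThan_iff)
    then show ?thesis using g(2) by (simp add: h_def)
  qed
  moreover have "g x = 0" if x: "x \<in> L" for x
  proof -
    have "x \<in> (\<phi> ^^ m) ` K" using x mem_L_iff by blast
    then show ?thesis using g0 by blast
  qed
  then have "g \<in> J" using g(1) by (simp add: J_def)
  moreover have "cocycle v \<phi> i y * g ((\<phi> ^^ i) y) = of_real (cmod (cocycle v \<phi> i y))" if "i < n" for i
  proof -
    have "orb i \<in> S" using that by (auto simp: S_def Z_def)
    then have "g ((\<phi> ^^ i) y) = cnj (cocycle v \<phi> i y) / of_real (cmod (cocycle v \<phi> i y))"
      using g(2) h_orb[OF that] by (simp add: orb_def)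
    then show ?thesis by (simp add: complex_norm_square[symmetric] power2_eq_square)
  qed
  moreover have "g ((\<phi> ^^ i) q) = 0" if "q \<in> Q" "i < m" "(\<phi> ^^ i) q \<notin> (\<lambda>l. (\<phi> ^^ l) y) ` {..<n}" for q i
  proof -
    have "(\<phi> ^^ i) q \<in> S" using that(1,2) by (force simp: S_def Z_def)
    then show ?thesis using g(2) that(3) by (simp add: h_def orb_def)
  qed
  moreover have "n \<le> m" by (simp add: m_def)
  ultimately show ?thesis using g(3) by (intro exI[of _ g] exI[of _ m]) simp
qed

text \<open>\<open>S\<close> is the finite Neumann series of \<open>g\<close>, which
  \<open>D\<close> maps back to \<open>g\<close>. Once its values on \<open>P\<close> are removed by
  the dual system, the estimate bounds it by \<open>g\<close> alone.\<close>

lemma neumann_sum_bound: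
  assumes P: "finite P" "apriori J (D K) P C" "dj.dual_system P e"
    and g: "g \<in> J" "\<And>k. k \<in> K \<Longrightarrow> g ((\<phi> ^^ m) k) = 0" and PK: "P \<subseteq> K" and k: "k \<in> K"
  defines "S \<equiv> \<lambda>k. \<Sum>i<m. cocycle v \<phi> i k * g ((\<phi> ^^ i) k)"
  shows "cmod (S k - (\<Sum>p\<in>P. S p * e p k)) \<le> C * sup_norm g"
proof -
  define f where "f = (\<Sum>i<m. (T ^^ i) g)"
  have fJ: "f \<in> J" unfolding f_def using j.pow_mem[OF g(1)] by (intro j.mem_sum)
  have fS: "f x = S x" if "x \<in> K" for x
    unfolding f_def S_def sum_fun_apply using wm.T_pow[OF that] by (intro sum.cong) auto
  have "(T ^^ m) g = 0"
  proof
    fix x show "(T ^^ m) g x = 0 x"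
    proof (cases "x \<in> K")
      case True then show ?thesis using wm.T_pow[OF True] g(2) by simp
    next
      case False
      then show ?thesis using j.pow_mem[OF g(1), of m] by (simp add: J_def C_space_def)
    qed
  qed
  then have Df: "D K f = g"
    unfolding D_def f_def j.telescope[OF g(1)] by simp
  define f' where "f' = f - (\<Sum>p\<in>P. fscale (f p) (e p))"
  note c = dj.A_correction[OF P(1) fJ P(3), folded f'_def]
  have "sup_norm f' \<le> C * (sup_norm (D K f') + (\<Sum>p\<in>P. cmod (f' p)))"
    using P(2) c(1) unfolding apriori_def by blast
  then have "sup_norm f' \<le> C * sup_norm g" using c(2,3) Df by simp
  then have "cmod (f' k) \<le> C * sup_norm g" using j.cmod_le[OF c(1), of k] by linarith
  moreover have "f' k = S k - (\<Sum>p\<in>P. S p * e p k)"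
    unfolding f'_def using fS[OF k] fS PK by (auto simp: sum_fun_apply fscale_def intro!: sum.cong)
  ultimately show ?thesis by simp
qed

section \<open>Growth of products along orbits\<close>

context
  fixes P :: "'a set" and C :: real and e :: "'a \<Rightarrow> 'a \<Rightarrow> complex"
  assumes P: "finite P" "apriori J (D K) P C" "dj.dual_system P e"
begin

lemma dual_system_facts: "p \<in> P \<Longrightarrow> e p \<in> J" "p \<in> P \<Longrightarrow> D K (e p) = 0" "p \<in> P \<Longrightarrow> e p p = 1"
  "p \<in> P \<Longrightarrow> q \<in> P \<Longrightarrow> q \<noteq> p \<Longrightarrow> e p q = 0"
  using P(3) by (auto simp: dj.dual_system_def dual_family_def)

lemma P_subset: "P \<subseteq> K - L"
proof
  fix p assume p: "p \<in> P"
  then have "e p p \<noteq> 0" "e p \<in> J" using dual_system_facts by auto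
  then show "p \<in> K - L" by (auto simp: J_def C_space_def)
qed

lemma kernel_iterate: "p \<in> P \<Longrightarrow> k \<in> K \<Longrightarrow> e p k = cocycle v \<phi> n k * e p ((\<phi> ^^ n) k)"
  using D_iterate[of k "e p" n] dual_system_facts(2) by simp

text \<open>If \<open>p'\<close> were an iterate of \<open>p\<close>, then \<open>e p' p = 0\<close>
  and \<open>e p' p' = 1\<close> force the product from \<open>p\<close> to \<open>p'\<close> to
  vanish, and with it \<open>e p p\<close>, which is 1.\<close>

lemma orbits_disjoint:
  assumes "p \<in> P" "p' \<in> P" "(\<phi> ^^ i) p = (\<phi> ^^ l) p'"
  shows "p = p'"
proof (rule ccontr)
  assume ne: "p \<noteq> p'"
  have no: "p' \<noteq> (\<phi> ^^ d) p" if "p \<in> P" "p' \<in> P" "p \<noteq> p'" for p p' d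
  proof
    assume "p' = (\<phi> ^^ d) p"
    then have "e p' p = cocycle v \<phi> d p * e p' p'" "e p p = cocycle v \<phi> d p * e p p'"
      using kernel_iterate that P_subset by blast+
    then show False using dual_system_facts that by auto
  qed
  obtain u a where u: "u \<in> W" "p = (\<phi> ^^ a) u" using ex_root P_subset assms(1) by blast
  obtain u' b where u': "u' \<in> W" "p' = (\<phi> ^^ b) u'" using ex_root P_subset assms(2) by blast
  have "(\<phi> ^^ (i + a)) u = (\<phi> ^^ (l + b)) u'" using assms(3) u u' by (simp add: funpow_add)
  then have [simp]: "u' = u" using root_unique[OF u(1) u'(1)] by blast
  show False
  proof (cases "a \<le> b")
    case True
    then have "p' = (\<phi> ^^ (b - a)) p" using u u' by (metis \<open>u' = u\<close> comp_apply funpow_add le_add_diff_inverse2)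
    then show False using no assms ne by blast
  next
    case False
    then have "p = (\<phi> ^^ (a - b)) p'" using u u' by (metis \<open>u' = u\<close> comp_apply funpow_add le_add_diff_inverse2 nat_le_linear)
    then show False using no assms ne by metis
  qed
qed

lemma aperiodic:
  assumes "y \<in> K" "y \<notin> L" "(\<phi> ^^ i) y = (\<phi> ^^ l) y"
  shows "i = l"
proof -
  obtain u a where u: "u \<in> W" "y = (\<phi> ^^ a) u" using ex_root assms by blast
  have "(\<phi> ^^ (i + a)) u = (\<phi> ^^ (l + a)) u" using assms(3) u by (simp add: funpow_add)
  then show ?thesis using root_unique[OF u(1) u(1)] by fastforce
qed

lemma sum_test:
  assumes y: "y \<in> K" "y \<notin> L" and "n \<le> m"
    and g1: "\<And>i. i < n \<Longrightarrow> cocycle v \<phi> i y * g ((\<phi> ^^ i) y) = of_real (cmod (cocycle v \<phi> i y))"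
    and g2: "\<And>i. i < m \<Longrightarrow> (\<phi> ^^ i) y \<notin> (\<lambda>l. (\<phi> ^^ l) y) ` {..<n} \<Longrightarrow> g ((\<phi> ^^ i) y) = 0"
  shows "(\<Sum>i<m. cocycle v \<phi> i y * g ((\<phi> ^^ i) y)) = of_real (\<Sum>i<n. cmod (cocycle v \<phi> i y))"
proof -
  have "(\<Sum>i<m. cocycle v \<phi> i y * g ((\<phi> ^^ i) y)) = (\<Sum>i<n. cocycle v \<phi> i y * g ((\<phi> ^^ i) y))"
  proof (rule sum.mono_neutral_right)
    show "\<forall>i\<in>{..<m} - {..<n}. cocycle v \<phi> i y * g ((\<phi> ^^ i) y) = 0"
    proof
      fix i assume i: "i \<in> {..<m} - {..<n}"
      have "(\<phi> ^^ i) y \<notin> (\<lambda>l. (\<phi> ^^ l) y) ` {..<n}" 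
      proof
        assume "(\<phi> ^^ i) y \<in> (\<lambda>l. (\<phi> ^^ l) y) ` {..<n}"
        then obtain l where "l < n" "(\<phi> ^^ i) y = (\<phi> ^^ l) y" by blast
        then show False using aperiodic[OF y, of i l] i by simp
      qed
      then show "cocycle v \<phi> i y * g ((\<phi> ^^ i) y) = 0" using g2 i by simp
    qed
  qed (use assms(3) in auto)
  also have "\<dots> = (\<Sum>i<n. of_real (cmod (cocycle v \<phi> i y)))" using g1 by (intro sum.cong) auto
  finally show ?thesis by simp
qed

text \<open>The sum is the Neumann series of a test function of norm at most 2. Since the orbit
  misses those of \<open>P\<close>, the kernel correction is 0; \<open>max C 1\<close> covers a
  negative \<open>C\<close>.\<close>

lemma cocycle_sum_le_off_P:
  assumes k: "k \<in> K" "k \<notin> L" and off: "\<And>p i l. p \<in> P \<Longrightarrow> (\<phi> ^^ i) p \<noteq> (\<phi> ^^ l) k"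
  shows "(\<Sum>i<n. cmod (cocycle v \<phi> i k)) \<le> 2 * max C 1"
proof -
  have PK: "P \<subseteq> K" using P_subset by blast
  have "finite (insert k P)" "insert k P \<subseteq> K" using P(1) PK k by auto
  then obtain g m where g: "g \<in> J" "n \<le> m" "\<forall>k\<in>K. g ((\<phi> ^^ m) k) = 0" "sup_norm g \<le> 2"
    "\<forall>i<n. cocycle v \<phi> i k * g ((\<phi> ^^ i) k) = of_real (cmod (cocycle v \<phi> i k))"
    "\<forall>q\<in>insert k P. \<forall>i<m. (\<phi> ^^ i) q \<notin> (\<lambda>l. (\<phi> ^^ l) k) ` {..<n} \<longrightarrow> g ((\<phi> ^^ i) q) = 0"
    using ex_test_function[OF k, of "insert k P" n] by blast
  define S where "S k = (\<Sum>i<m. cocycle v \<phi> i k * g ((\<phi> ^^ i) k))" for k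
  have "S k = of_real (\<Sum>i<n. cmod (cocycle v \<phi> i k))"
    unfolding S_def using g by (intro sum_test[OF k]) auto
  moreover have "S p = 0" if p: "p \<in> P" for p
    unfolding S_def
  proof (intro sum.neutral ballI)
    fix i assume "i \<in> {..<m}"
    moreover have "(\<phi> ^^ i) p \<notin> (\<lambda>l. (\<phi> ^^ l) k) ` {..<n}" using off[OF p] by blast
    ultimately show "cocycle v \<phi> i p * g ((\<phi> ^^ i) p) = 0" using g(6) p by auto
  qed
  ultimately have "cmod (of_real (\<Sum>i<n. cmod (cocycle v \<phi> i k))) \<le> C * sup_norm g"
    using neumann_sum_bound[OF P g(1) _ PK k(1), of m] g(3) unfolding S_def[symmetric] by simp
  also have "\<dots> \<le> max C 1 * sup_norm g" by (intro mult_right_mono) auto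
  also have "\<dots> \<le> max C 1 * 2" using g(4) by (intro mult_left_mono) auto
  finally have "\<bar>\<Sum>i<n. cmod (cocycle v \<phi> i k)\<bar> \<le> max C 1 * 2" by (simp only: norm_of_real)
  then show ?thesis by linarith
qed

text \<open>The bound is evaluated at the \<open>n\<close>-th iterate \<open>k\<close> of
  \<open>p\<close>, just beyond the support on the orbit: there the Neumann series vanishes and only
  the correction \<open>S p * e p k\<close> remains, with \<open>e p k\<close> the reciprocal of
  \<open>cocycle v \<phi> n p\<close>.\<close>

lemma cocycle_sum_le_on_P:
  assumes p: "p \<in> P"
  shows "(\<Sum>i<n. cmod (cocycle v \<phi> i p)) \<le> 2 * max C 1 * cmod (cocycle v \<phi> n p)"
proof -
  have PK: "P \<subseteq> K" and pK: "p \<in> K" "p \<notin> L" using P_subset p by auto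
  obtain g m where g: "g \<in> J" "n \<le> m" "\<forall>k\<in>K. g ((\<phi> ^^ m) k) = 0" "sup_norm g \<le> 2"
    "\<forall>i<n. cocycle v \<phi> i p * g ((\<phi> ^^ i) p) = of_real (cmod (cocycle v \<phi> i p))"
    "\<forall>q\<in>insert ((\<phi> ^^ n) p) P. \<forall>i<m. (\<phi> ^^ i) q \<notin> (\<lambda>l. (\<phi> ^^ l) p) ` {..<n} \<longrightarrow> g ((\<phi> ^^ i) q) = 0"
    using ex_test_function[OF pK, of "insert ((\<phi> ^^ n) p) P" n] P(1) PK \<phi>_pow_mem[OF pK(1), of n] by blast
  define S where "S k = (\<Sum>i<m. cocycle v \<phi> i k * g ((\<phi> ^^ i) k))" for k
  define \<Sigma> where "\<Sigma> = (\<Sum>i<n. cmod (cocycle v \<phi> i p))"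
  define k where "k = (\<phi> ^^ n) p"
  have kK: "k \<in> K" unfolding k_def by (rule \<phi>_pow_mem[OF pK(1)])
  have Sp: "S p = of_real \<Sigma>"
    unfolding S_def \<Sigma>_def using g p by (intro sum_test[OF pK]) auto
  have "S q = 0" if q: "q \<in> P" "q \<noteq> p" for q
    unfolding S_def
  proof (intro sum.neutral ballI)
    fix i assume "i \<in> {..<m}"
    moreover have "(\<phi> ^^ i) q \<notin> (\<lambda>l. (\<phi> ^^ l) p) ` {..<n}" using orbits_disjoint[OF q(1) p] q(2) by auto
    ultimately show "cocycle v \<phi> i q * g ((\<phi> ^^ i) q) = 0" using g(6) q by auto
  qed
  then have "(\<Sum>q\<in>P. S q * e q k) = (\<Sum>q\<in>P. if q = p then S p * e p k else 0)"
    by (intro sum.cong) auto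
  also have "\<dots> = of_real \<Sigma> * e p k" using P(1) p Sp by simp
  finally have sum: "(\<Sum>q\<in>P. S q * e q k) = of_real \<Sigma> * e p k" .
  have "S k = 0"
    unfolding S_def
  proof (intro sum.neutral ballI)
    fix i assume i: "i \<in> {..<m}"
    have "(\<phi> ^^ i) k = (\<phi> ^^ (i + n)) p" by (simp add: k_def funpow_add)
    then have "(\<phi> ^^ i) k \<notin> (\<lambda>l. (\<phi> ^^ l) p) ` {..<n}" 
    proof (intro notI)
      assume "(\<phi> ^^ i) k \<in> (\<lambda>l. (\<phi> ^^ l) p) ` {..<n}"
      then obtain l where "l < n" "(\<phi> ^^ i) k = (\<phi> ^^ l) p" by blast
      then show False using aperiodic[OF pK, of "i + n" l] \<open>(\<phi> ^^ i) k = (\<phi> ^^ (i + n)) p\<close> by simp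
    qed
    then show "cocycle v \<phi> i k * g ((\<phi> ^^ i) k) = 0" using g(6) i unfolding k_def by auto
  qed
  then have "cmod (of_real \<Sigma> * e p k) \<le> C * sup_norm g"
    using neumann_sum_bound[OF P g(1) _ PK kK, of m] g(3) sum unfolding S_def[symmetric] by simp
  also have "\<dots> \<le> max C 1 * sup_norm g" by (intro mult_right_mono) auto
  also have "\<dots> \<le> max C 1 * 2" using g(4) by (intro mult_left_mono) auto
  moreover have "\<Sigma> \<ge> 0" unfolding \<Sigma>_def by (intro sum_nonneg) auto
  ultimately have *: "\<Sigma> * cmod (e p k) \<le> 2 * max C 1"
    by (simp add: norm_mult)
  have one: "cmod (cocycle v \<phi> n p) * cmod (e p k) = 1"
    using kernel_iterate[OF p pK(1), of n] dual_system_facts(3)[OF p] unfolding k_def by (metis norm_mult norm_one)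
  have "\<Sigma> = \<Sigma> * (cmod (cocycle v \<phi> n p) * cmod (e p k))" using one by simp
  also have "\<dots> = (\<Sigma> * cmod (e p k)) * cmod (cocycle v \<phi> n p)" by simp
  also have "\<dots> \<le> 2 * max C 1 * cmod (cocycle v \<phi> n p)" using * by (rule mult_right_mono) simp
  finally show ?thesis unfolding \<Sigma>_def .
qed

text \<open>\<open>Q\<close> consists of the starting points of the orbits through \<open>P\<close>. The two cocycle estimates are closed
  conditions, so they pass from orbits to orbit closures; there they exclude each other and yield
  contraction on \<open>M1\<close> and expansion on the core of \<open>M2\<close>.\<close>

lemma apriori_splitting: "\<exists>M1 M2. dynamic_splitting M1 M2"
proof -
  define c where "c = 2 * max C 1"
  have c: "c \<ge> 2" by (simp add: c_def)
  define Q where "Q = {u\<in>W. \<exists>n. (\<phi> ^^ n) u \<in> P}"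
  have "\<exists>a. \<forall>u\<in>Q. (\<phi> ^^ a u) u \<in> P" unfolding Q_def by (intro bchoice) blast
  then obtain a where a: "\<And>u. u \<in> Q \<Longrightarrow> (\<phi> ^^ a u) u \<in> P" by blast
  have QW: "Q \<subseteq> W" and QK: "Q \<subseteq> K" using W_subset by (auto simp: Q_def)
  have "inj_on (\<lambda>u. (\<phi> ^^ a u) u) Q" using root_unique QW by (intro inj_onI) blast
  then have finQ: "finite Q" using inj_on_finite[of _ Q P] a P(1) by blast
  define S1 where "S1 = {(\<phi> ^^ n) u |n u. u \<in> W - Q}"
  define S2 where "S2 = {(\<phi> ^^ n) u |n u. u \<in> Q}"
  \<comment> \<open>The growth estimate is available only from the points of \<open>P\<close>
    onwards. The finitely many earlier orbit points are put into \<open>F0\<close> and treated by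
    hand.\<close>
  define S2' where "S2' = {(\<phi> ^^ n) p |n p. p \<in> P}"
  define F0 where "F0 = (\<Union>u\<in>Q. (\<lambda>i. (\<phi> ^^ i) u) ` {..<a u})"
  have finF0: "finite F0" "F0 \<subseteq> K" unfolding F0_def using finQ QK \<phi>_pow_mem by auto
  have SK: "S1 \<subseteq> K" "S2 \<subseteq> K" "S2' \<subseteq> K"
    unfolding S1_def S2_def S2'_def using \<phi>_pow_mem W_subset QK P_subset by auto
  have S2_sub: "S2 \<subseteq> F0 \<union> S2'"
  proof
    fix x assume "x \<in> S2"
    then obtain n u where u: "u \<in> Q" "x = (\<phi> ^^ n) u" unfolding S2_def by blast
    show "x \<in> F0 \<union> S2'"
    proof (cases "n < a u")
      case True then show ?thesis using u unfolding F0_def by blast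
    next
      case False
      then have "x = (\<phi> ^^ (n - a u)) ((\<phi> ^^ a u) u)" using u(2)
        by (metis comp_apply funpow_add le_add_diff_inverse2 not_less)
      then show ?thesis using a[OF u(1)] unfolding S2'_def by blast
    qed
  qed
  have KL: "K - L = S1 \<union> S2"
  proof
    show "K - L \<subseteq> S1 \<union> S2" using ex_root unfolding S1_def S2_def by blast
    show "S1 \<union> S2 \<subseteq> K - L"
      unfolding S1_def S2_def using \<phi>_pow_mem W_subset W_orbit_notin_L QW by blast
  qed
  define M1 where "M1 = X closure_of S1"
  define M2 where "M2 = X closure_of S2"
  have inv: "\<phi> ` (X closure_of S) \<subseteq> X closure_of S" if "\<phi> ` S \<subseteq> S" for S
    using continuous_map_image_closure_subset[OF cont_\<phi>, of S] closure_of_mono[OF that] by blast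
  have shift: "\<phi> ` {(\<phi> ^^ n) u |n u. u \<in> R} \<subseteq> {(\<phi> ^^ n) u |n u. u \<in> R}" for R
  proof
    fix x assume "x \<in> \<phi> ` {(\<phi> ^^ n) u |n u. u \<in> R}"
    then obtain n u where "u \<in> R" "x = \<phi> ((\<phi> ^^ n) u)" by blast
    then have "u \<in> R" "x = (\<phi> ^^ Suc n) u" by auto
    then show "x \<in> {(\<phi> ^^ n) u |n u. u \<in> R}" by blast
  qed
  have M1inv: "\<phi> ` M1 \<subseteq> M1" unfolding M1_def S1_def by (rule inv[OF shift])
  have M2inv: "\<phi> ` M2 \<subseteq> M2" unfolding M2_def S2_def by (rule inv[OF shift])
  have closed: "closedin X M1" "closedin X M2" by (auto simp: M1_def M2_def)
  have cont_abs: "continuous_map X euclideanreal (\<lambda>k. cmod (cocycle v \<phi> n k))" for n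
    using wm.cont_cocycle[of n] unfolding subtopology_topspace continuous_map_atin limitin_canonical_iff
    by (auto intro!: tendsto_norm)
  have M1_bd: "(\<Sum>i<n. cmod (cocycle v \<phi> i k)) \<le> c" if k: "k \<in> M1" for k n
  proof -
    have "continuous_map X euclideanreal (\<lambda>k. \<Sum>i<n. cmod (cocycle v \<phi> i k))"
      using cont_abs by (intro continuous_map_sum) auto
    from closedin_continuous_map_preimage[OF this, of "{..c}"]
    have "closedin X {k \<in> K. (\<Sum>i<n. cmod (cocycle v \<phi> i k)) \<le> c}" by simp
    moreover have "S1 \<subseteq> {k \<in> K. (\<Sum>i<n. cmod (cocycle v \<phi> i k)) \<le> c}"
    proof
      fix x assume "x \<in> S1"
      then obtain s u where u: "u \<in> W" "u \<notin> Q" "x = (\<phi> ^^ s) u" unfolding S1_def by blast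
      have x: "x \<in> K" "x \<notin> L" using KL \<open>x \<in> S1\<close> by auto
      have "(\<phi> ^^ i) p \<noteq> (\<phi> ^^ l) x" if p: "p \<in> P" for p i l
      proof
        assume eq: "(\<phi> ^^ i) p = (\<phi> ^^ l) x"
        obtain u' b where u': "u' \<in> W" "p = (\<phi> ^^ b) u'" using ex_root P_subset p by blast
        have "(\<phi> ^^ (i + b)) u' = (\<phi> ^^ (l + s)) u" using eq u u' by (simp add: funpow_add)
        then have "u' = u" using root_unique[OF u'(1) u(1)] by blast
        then show False using u(2) u' p unfolding Q_def by blast
      qed
      from cocycle_sum_le_off_P[OF x this]
      show "x \<in> {k \<in> K. (\<Sum>i<n. cmod (cocycle v \<phi> i k)) \<le> c}" using x by (simp add: c_def)
    qed
    ultimately show ?thesis using closure_of_minimal k unfolding M1_def by blast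
  qed
  have S2'_bd: "(\<Sum>l<n. cmod (cocycle v \<phi> l x)) \<le> c * cmod (cocycle v \<phi> n x)" if x: "x \<in> X closure_of S2'" for x n
  proof -
    have "continuous_map X euclideanreal (\<lambda>k. (\<Sum>i<n. cmod (cocycle v \<phi> i k)) - c * cmod (cocycle v \<phi> n k))"
      using cont_abs by (intro continuous_map_diff continuous_map_sum continuous_map_real_mult_left) auto
    from closedin_continuous_map_preimage[OF this, of "{..0}"]
    have "closedin X {k \<in> K. (\<Sum>i<n. cmod (cocycle v \<phi> i k)) \<le> c * cmod (cocycle v \<phi> n k)}" by simp
    moreover have "S2' \<subseteq> {k \<in> K. (\<Sum>i<n. cmod (cocycle v \<phi> i k)) \<le> c * cmod (cocycle v \<phi> n k)}"
    proof
      fix x assume xS: "x \<in> S2'"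
      then obtain s p where p: "p \<in> P" "x = (\<phi> ^^ s) p" unfolding S2'_def by blast
      have bd: "(\<Sum>i<r. cmod (cocycle v \<phi> i p)) \<le> c * cmod (cocycle v \<phi> r p)" for r
        using cocycle_sum_le_on_P[OF p(1)] by (simp add: c_def)
      \<comment> \<open>The term of index 0 is 1, so the estimate forces later products to be
        nonzero; cancelling this factor moves the estimate from \<open>p\<close> to
        \<open>x\<close>.\<close>
      have pos: "cmod (cocycle v \<phi> s p) > 0"
      proof (cases s)
        case (Suc r)
        have "(\<Sum>i<1. cmod (cocycle v \<phi> i p)) \<le> (\<Sum>i<s. cmod (cocycle v \<phi> i p))"
          using Suc by (intro sum_mono2) auto
        then have "1 \<le> c * cmod (cocycle v \<phi> s p)" using bd[of s] by simp
        then show ?thesis using c by (cases "cocycle v \<phi> s p = 0") auto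
      qed simp
      have sp: "cmod (cocycle v \<phi> (s + l) p) = cmod (cocycle v \<phi> s p) * cmod (cocycle v \<phi> l x)" for l
        unfolding cocycle_add p(2) by (simp add: norm_mult)
      have "cmod (cocycle v \<phi> s p) * (\<Sum>l<n. cmod (cocycle v \<phi> l x)) = (\<Sum>l<n. cmod (cocycle v \<phi> (s + l) p))"
        unfolding sum_distrib_left sp ..
      also have "\<dots> = (\<Sum>i\<in>(\<lambda>l. s + l) ` {..<n}. cmod (cocycle v \<phi> i p))" by (simp add: sum.reindex)
      also have "\<dots> \<le> (\<Sum>i<s + n. cmod (cocycle v \<phi> i p))" by (intro sum_mono2) auto
      also have "\<dots> \<le> c * cmod (cocycle v \<phi> (s + n) p)" by (rule bd)
      also have "\<dots> = cmod (cocycle v \<phi> s p) * (c * cmod (cocycle v \<phi> n x))" unfolding sp by simp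
      finally have "(\<Sum>l<n. cmod (cocycle v \<phi> l x)) \<le> c * cmod (cocycle v \<phi> n x)"
        using pos by simp
      then show "x \<in> {k \<in> K. (\<Sum>i<n. cmod (cocycle v \<phi> i k)) \<le> c * cmod (cocycle v \<phi> n k)}" using SK xS by auto
    qed
    ultimately show ?thesis using closure_of_minimal x by blast
  qed
  have S2'_low: "1 \<le> c * cmod (cocycle v \<phi> n x)" if x: "x \<in> X closure_of S2'" for x n
  proof (cases n)
    case 0 then show ?thesis using c by simp
  next
    case (Suc r)
    have "(\<Sum>i<1. cmod (cocycle v \<phi> i x)) \<le> (\<Sum>i<n. cmod (cocycle v \<phi> i x))"
      using Suc by (intro sum_mono2) auto
    then show ?thesis using S2'_bd[OF x, of n] by simp
  qed
  have M2_sub: "M2 \<subseteq> F0 \<union> X closure_of S2'"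
    unfolding M2_def using S2_sub closure_of_subset[OF SK(3)] closedin_finite[OF finF0]
    by (intro closure_of_minimal) auto
  \<comment> \<open>At a common point the \<open>n\<close> moduli are each at least
    \<open>1 / c\<close> and sum to at most \<open>c\<close>, which fails for large
    \<open>n\<close>.\<close>
  have disj': "M1 \<inter> X closure_of S2' = {}"
  proof (rule ccontr)
    assume "M1 \<inter> X closure_of S2' \<noteq> {}"
    then obtain x where x: "x \<in> M1" "x \<in> X closure_of S2'" by blast
    obtain n where n: "real n > c * c" using reals_Archimedean2 by blast
    have "(\<Sum>i<n. 1 / c) \<le> (\<Sum>i<n. cmod (cocycle v \<phi> i x))"
      using S2'_low[OF x(2)] c by (intro sum_mono) (auto simp: field_simps)
    then have "real n / c \<le> c" using M1_bd[OF x(1), of n] by simp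
    then show False using n c by (simp add: field_simps)
  qed
  have pow1: "(\<phi> ^^ n) x \<in> M1" if "x \<in> M1" for n x using that M1inv by (induction n) auto
  have disj: "M1 \<inter> M2 = {}"
  proof (rule ccontr)
    assume "M1 \<inter> M2 \<noteq> {}"
    then obtain x where x: "x \<in> M1" "x \<in> F0" using M2_sub disj' by blast
    then obtain u i where u: "u \<in> Q" "i < a u" "x = (\<phi> ^^ i) u" unfolding F0_def by blast
    \<comment> \<open>A common point among the initial ones is moved forward into \<open>P\<close>,
      and thus into the intersection just shown to be empty.\<close>
    have "(\<phi> ^^ (a u - i)) x = (\<phi> ^^ a u) u" using u by (metis comp_apply funpow_add le_add_diff_inverse2 less_imp_le)
    then have "(\<phi> ^^ a u) u \<in> M1" using pow1[OF x(1), of "a u - i"] by simp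
    moreover have "(\<phi> ^^ 0) ((\<phi> ^^ a u) u) \<in> S2'" unfolding S2'_def using a[OF u(1)] by blast
    then have "(\<phi> ^^ a u) u \<in> X closure_of S2'" using closure_of_subset[OF SK(3)] by auto
    ultimately show False using disj' by blast
  qed
  have fin: "finite (M2 - \<phi> ` M2)"
  proof -
    have "S2 \<subseteq> Q \<union> \<phi> ` M2"
    proof
      fix x assume "x \<in> S2"
      then obtain n u where u: "u \<in> Q" "x = (\<phi> ^^ n) u" unfolding S2_def by blast
      show "x \<in> Q \<union> \<phi> ` M2"
      proof (cases n)
        case (Suc r)
        have "(\<phi> ^^ r) u \<in> M2" unfolding M2_def using u(1) closure_of_subset[OF SK(2)] unfolding S2_def by blast
        then show ?thesis using u(2) Suc by simp
      qed (use u in simp)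
    qed
    then have "M2 \<subseteq> Q \<union> \<phi> ` M2"
      unfolding M2_def[symmetric] using closedin_finite[OF finQ QK] closedin_image[OF closed(2)]
      by (subst M2_def, intro closure_of_minimal) auto
    then have "M2 - \<phi> ` M2 \<subseteq> Q" by blast
    then show ?thesis using finQ finite_subset by blast
  qed
  have M2K: "M2 \<subseteq> K" using closed(2) closedin_subset by blast
  let ?N = "core M2"
  have Nc: "closedin X ?N" "\<phi> ` ?N = ?N" using closedin_core[OF closed(2)] core_image[OF M2K M2inv] by auto
  have N_sub: "?N \<subseteq> X closure_of S2'"
  proof -
    have "F0 \<inter> L = {}" unfolding F0_def using W_orbit_notin_L QW by blast
    then show ?thesis using core_subset[of M2] core_subset_L[OF M2K] M2_sub by blast
  qed
  have nz: "v k \<noteq> 0" if "k \<in> ?N" for k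
    using S2'_low[of k 1] N_sub that by auto
  \<comment> \<open>If no inverse product contracts, every product that ends at \<open>y\<close> has
    modulus at most 1. Starting \<open>m\<close> steps back, the full product is then the smallest
    of the partial ones, and \<open>m\<close> times it is at most \<open>c\<close> times it,
    impossible for \<open>m > c\<close>.\<close>
  have inv_contr: "\<exists>n\<ge>1. cmod (cocycle (inv_weight ?N) (inv_on ?N) n y) < 1" if y: "y \<in> ?N" for y
  proof (rule ccontr)
    assume "\<not> ?thesis"
    then have ge: "cmod (cocycle (inv_weight ?N) (inv_on ?N) n y) \<ge> 1" if "n \<ge> 1" for n using that by (simp add: not_less)
    have low: "cmod (cocycle v \<phi> n ((inv_on ?N ^^ n) y)) \<le> 1" for n
    proof (cases "n = 0")
      case False
      then have "1 \<le> 1 / cmod (cocycle v \<phi> n ((inv_on ?N ^^ n) y))"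
        using ge[of n] unfolding cocycle_inverse[OF Nc y] by (simp add: norm_divide)
      then show ?thesis by (simp add: le_divide_eq split: if_splits)
    qed simp
    obtain m where m: "real m > c" using reals_Archimedean2 by blast
    define x where "x = (inv_on ?N ^^ m) y"
    have xN: "x \<in> ?N" unfolding x_def by (rule inv_on_pow_mem[OF Nc y])
    then have xS: "x \<in> X closure_of S2'" using N_sub by blast
    have "cmod (cocycle v \<phi> m x) \<le> cmod (cocycle v \<phi> l x)" if "l < m" for l
    proof -
      have "(\<phi> ^^ l) x = (inv_on ?N ^^ (m - l)) y" unfolding x_def
        using \<phi>_pow_inv_on_pow_le[OF Nc y, of l m] that by simp
      then have "cmod (cocycle v \<phi> (m - l) ((\<phi> ^^ l) x)) \<le> 1" using low by simp
      moreover have "cocycle v \<phi> m x = cocycle v \<phi> l x * cocycle v \<phi> (m - l) ((\<phi> ^^ l) x)"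
        using cocycle_add[of v \<phi> l "m - l" x] that by simp
      ultimately show ?thesis by (simp add: norm_mult mult_left_le)
    qed
    then have "(\<Sum>l<m. cmod (cocycle v \<phi> m x)) \<le> (\<Sum>l<m. cmod (cocycle v \<phi> l x))" by (intro sum_mono) auto
    then have "real m * cmod (cocycle v \<phi> m x) \<le> c * cmod (cocycle v \<phi> m x)"
      using S2'_bd[OF xS, of m] by simp
    moreover have "cmod (cocycle v \<phi> m x) > 0" using S2'_low[OF xS, of m] by (cases "cocycle v \<phi> m x = 0") auto
    ultimately show False using m by simp
  qed
  have contr: "\<exists>n\<ge>1. cmod (cocycle v \<phi> n k) < 1" if k: "k \<in> M1" for k
  proof (rule ccontr)
    assume "\<not> ?thesis"
    then have ge: "cmod (cocycle v \<phi> n k) \<ge> 1" for n by (cases "n = 0") (auto simp: not_less)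
    obtain n where n: "real n > c" using reals_Archimedean2 by blast
    have "(\<Sum>i<n. 1) \<le> (\<Sum>i<n. cmod (cocycle v \<phi> i k))" using ge by (intro sum_mono)
    then show False using M1_bd[OF k, of n] n by simp
  qed
  have "M = M1 \<union> M2" unfolding M_closure KL M1_def M2_def by simp
  then have "dynamic_splitting M1 M2"
    unfolding dynamic_splitting_def using disj closed M1inv M2inv contr fin nz inv_contr by blast
  then show ?thesis by blast
qed

end

lemma upper_semi_Fredholm_iff_splitting:
  "upper_semi_Fredholm CK (D K) \<longleftrightarrow>
    upper_semi_Fredholm CL (D L) \<and> (\<exists>M1 M2. dynamic_splitting M1 M2)"
proof
  assume usf: "upper_semi_Fredholm CK (D K)"
  obtain P0 C0 where P0: "finite P0" "apriori J (D K) P0 C0" using upper_semi_Fredholm_K_imp(1)[OF usf] by blast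
  obtain P C e where P: "P \<subseteq> P0" "apriori J (D K) P C" "dj.dual_system P e" using dj.ex_dual_system[OF P0] by blast
  then have "finite P" using P0(1) finite_subset by blast
  then show "upper_semi_Fredholm CL (D L) \<and> (\<exists>M1 M2. dynamic_splitting M1 M2)"
    using apriori_splitting P upper_semi_Fredholm_K_imp(2)[OF usf] by blast
next
  assume "upper_semi_Fredholm CL (D L) \<and> (\<exists>M1 M2. dynamic_splitting M1 M2)"
  then show "upper_semi_Fredholm CK (D K)"
    using splitting_dual_system upper_semi_Fredholm_K_if(1) by blast
qed

lemma dim_kernel_splitting:
  assumes "upper_semi_Fredholm CL (D L)" "dynamic_splitting M1 M2"
  shows "fun_vs.dim (op_kernel CK (D K)) = fun_vs.dim (op_kernel CL (D L)) + card (M2 - \<phi> ` M2)"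
  using splitting_dual_system[OF assms(2)] upper_semi_Fredholm_K_if(2)[OF _ _ _ assms(1)] by metis

text \<open>The estimate provided by a splitting has one point for each root in \<open>M2\<close>,
  hence none here.\<close>

lemma invertible_splitting:
  assumes "op_invertible CL (D L)" "dynamic_splitting M1 {}"
  shows "op_invertible CK (D K)"
proof -
  obtain P C where P: "finite P" "apriori J (D K) P C" "card P = card ({} - \<phi> ` {} :: 'a set)"
    using splitting_dual_system[OF assms(2)] by blast
  then have "P = {}" by simp
  then show ?thesis using invertible_K_if P(2) assms(1) by blast
qed

end

section \<open>Spectral form of the splitting\<close>

context fun_op
begin

lemma op_invertible_scale:
  assumes "op_invertible E A" "c \<noteq> 0"
  shows "op_invertible E (\<lambda>f. fscale c (A f))"
proof -
  interpret S: fun_op E "\<lambda>f. fscale c (A f)" by (rule fun_op_scale) unfold_locales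
  obtain S where S: "bounded_op E S" "\<forall>f\<in>E. S (A f) = f \<and> A (S f) = f"
    using assms(1) unfolding op_invertible_def by blast
  show ?thesis
  proof (rule S.bij_imp_op_invertible)
    fix f assume f: "f \<in> E" "fscale c (A f) = 0"
    have "A f = 0"
    proof
      fix x show "A f x = 0 x" using fun_cong[OF f(2), of x] assms(2) by (simp add: fscale_def)
    qed
    then have "f = S (A 0)" using S(2) f(1) A_zero by metis
    then show "f = 0" using S(2) mem_zero by metis
  next
    show "E \<subseteq> (\<lambda>f. fscale c (A f)) ` E"
    proof
      fix g assume "g \<in> E"
      then have g: "fscale (1 / c) g \<in> E" by (rule mem_scale)
      have "g = fscale c (A (S (fscale (1 / c) g)))"
        using S(2) g assms(2) by (simp add: fscale_def)
      moreover have "S (fscale (1 / c) g) \<in> E" using S(1) g by (auto simp: bounded_op_def)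
      ultimately show "g \<in> (\<lambda>f. fscale c (A f)) ` E" by blast
    qed
  qed
qed

lemma op_kernel_scale:
  assumes "c \<noteq> 0"
  shows "op_kernel E (\<lambda>f. fscale c (A f)) = op_kernel E A"
proof -
  have "fscale c g = 0 \<longleftrightarrow> g = 0" for g :: "'a \<Rightarrow> complex"
    using assms by (auto simp: fscale_def fun_eq_iff)
  then show ?thesis by (simp only: op_kernel_def)
qed

lemma upper_semi_Fredholm_scale:
  assumes "c \<noteq> 0"
  shows "upper_semi_Fredholm E (\<lambda>f. fscale c (A f)) \<longleftrightarrow> upper_semi_Fredholm E A"
proof -
  interpret S: fun_op E "\<lambda>f. fscale c (A f)" by (rule fun_op_scale) unfold_locales
  have "(\<lambda>f. fscale c (A f)) ` E = A ` E"
  proof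
    show "(\<lambda>f. fscale c (A f)) ` E \<subseteq> A ` E" using A_scale[symmetric] mem_scale by auto
    show "A ` E \<subseteq> (\<lambda>f. fscale c (A f)) ` E"
    proof
      fix g assume "g \<in> A ` E"
      then obtain f where f: "f \<in> E" "g = A f" by blast
      have "fscale c (A (fscale (1 / c) f)) = g"
        unfolding A_scale[OF f(1)] f(2) using assms by (simp add: fscale_def)
      then show "g \<in> (\<lambda>f. fscale c (A f)) ` E" using mem_scale[OF f(1)] by blast
    qed
  qed
  then show ?thesis
    unfolding upper_semi_Fredholm_def op_kernel_scale[OF assms] using bop S.bop by simp
qed

end

text \<open>The pointwise criterion is applied with radius \<open>cmod \<mu>\<close> on
  \<open>M1\<close>, and with radius \<open>1 / cmod \<mu>\<close> to the inverse operator on the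
  core. A zero of the weight on the core rules out invertibility; without zeros the inverse is
  explicit.\<close>

lemma (in compact_embedding) Fredholm_splitting_iff_dynamic:
  assumes v: "v = (\<lambda>k. w k / \<mu>)" and \<mu>: "\<mu> \<noteq> 0" and w: "continuous_map X euclidean w"
  shows "Fredholm_splitting X \<phi> w \<mu> M M1 M2 \<longleftrightarrow> dynamic_splitting M1 M2"
proof (cases "M = M1 \<union> M2 \<and> M1 \<inter> M2 = {} \<and> closedin X M1 \<and> closedin X M2 \<and> \<phi> ` M1 \<subseteq> M1 \<and> \<phi> ` M2 \<subseteq> M2")
  case False
  then show ?thesis unfolding Fredholm_splitting_def dynamic_splitting_def by blast
next
  case True
  then have M12: "closedin X M1" "closedin X M2" "\<phi> ` M1 \<subseteq> M1" "\<phi> ` M2 \<subseteq> M2" by auto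
  \<comment> \<open>The spectral conditions concern \<open>w\<close>, the dynamic ones
    \<open>v = w / \<mu>\<close>, so the locale is used for both weights.\<close>
  interpret W: compact_embedding X \<phi> w
    by unfold_locales (rule compact hausdorff cont_\<phi> inj_\<phi> w)+
  have \<mu>0: "cmod \<mu> > 0" using \<mu> by simp
  have coc: "cocycle v \<phi> n k = cocycle w \<phi> n k / \<mu> ^ n" for n k
    unfolding v by (rule cocycle_divide)
  have c: "(M1 \<noteq> {} \<longrightarrow> op_spectral_radius (C_space X M1) (wcomp w \<phi> M1) < cmod \<mu>) \<longleftrightarrow>
      (\<forall>k\<in>M1. \<exists>n\<ge>1. cmod (cocycle v \<phi> n k) < 1)"
  proof (cases "M1 = {}")
    case False
    interpret I: weighted_map X M1 w \<phi> by (rule W.weighted_map_invariant[OF M12(1,3)])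
    have "cmod (cocycle v \<phi> n k) < 1 \<longleftrightarrow> cmod (cocycle w \<phi> n k) < cmod \<mu> ^ n" for n k
      unfolding coc using \<mu> by (simp add: norm_divide norm_power)
    then show ?thesis using I.op_spectral_radius_less_iff[OF False \<mu>0] False by simp
  qed simp
  have d: "(M2 \<noteq> {} \<longrightarrow>
        op_invertible (C_space X (core M2)) (wcomp w \<phi> (core M2)) \<and>
        cmod \<mu> < 1 / op_spectral_radius (C_space X (core M2)) (op_inverse (C_space X (core M2)) (wcomp w \<phi> (core M2))) \<and>
        finite (M2 - \<phi> ` M2)) \<longleftrightarrow>
      finite (M2 - \<phi> ` M2) \<and> (\<forall>k\<in>core M2. v k \<noteq> 0) \<and>
      (\<forall>y\<in>core M2. \<exists>n\<ge>1. cmod (cocycle (inv_weight (core M2)) (inv_on (core M2)) n y) < 1)"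
  proof (cases "M2 = {}")
    case True
    then have "core M2 = {}" using core_subset by blast
    then show ?thesis using True by simp
  next
    case False
    let ?N = "core M2"
    have M2K: "M2 \<subseteq> K" using M12(2) closedin_subset by blast
    have Nne: "?N \<noteq> {}" by (rule core_nonempty[OF M12(2,4) False])
    have Nc: "closedin X ?N" "\<phi> ` ?N = ?N"
      using closedin_core[OF M12(2)] core_image[OF M2K M12(4)] by auto
    interpret I: weighted_map X ?N w \<phi> using Nc by (intro W.weighted_map_invariant) auto
    let ?inv = "wcomp (W.inv_weight ?N) (inv_on ?N) ?N"
    show ?thesis
    proof (cases "\<forall>k\<in>?N. v k \<noteq> 0")
      case nz: False
      have "\<not> op_invertible I.E I.T" using nz I.invertible_imp_weight_nonzero \<mu> by (auto simp: v)
      then show ?thesis using nz False by blast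
    next
      case nz: True
      then have wnz: "\<And>k. k \<in> ?N \<Longrightarrow> w k \<noteq> 0" by (auto simp: v)
      interpret V: weighted_map X ?N "W.inv_weight ?N" "inv_on ?N"
        by (rule W.weighted_map_inverse[OF Nc wnz])
      have ST: "?inv (I.T f) = f" if "f \<in> I.E" for f
      proof
        fix k show "?inv (I.T f) k = f k"
        proof (cases "k \<in> ?N")
          case True
          then show ?thesis
            using inv_on_mem[OF Nc True] \<phi>_inv_on[OF Nc True] wnz by (simp add: wcomp_def W.inv_weight_def)
        qed (use that in \<open>simp add: wcomp_def C_space_def\<close>)
      qed
      have TS: "I.T (?inv f) = f" if "f \<in> I.E" for f
      proof
        fix k show "I.T (?inv f) k = f k"
        proof (cases "k \<in> ?N")
          case True
          then show ?thesis
            using I.\<psi>_mem[OF True] inv_on_\<phi>[OF Nc True] wnz by (simp add: wcomp_def W.inv_weight_def)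
        qed (use that in \<open>simp add: wcomp_def C_space_def\<close>)
      qed
      have invertible: "op_invertible I.E I.T"
        unfolding op_invertible_def using I.bop V.bop ST TS by blast
      have inv_eq: "op_inverse I.E I.T f = ?inv f" if f: "f \<in> I.E" for f
        unfolding op_inverse_def
      proof (rule inv_into_f_eq)
        show "inj_on I.T I.E" using ST by (metis inj_onI)
        show "?inv f \<in> I.E" by (rule V.A_mem[OF f])
        show "I.T (?inv f) = f" by (rule TS[OF f])
      qed
      define \<rho> where "\<rho> = op_spectral_radius I.E (op_inverse I.E I.T)"
      have \<rho>: "\<rho> = op_spectral_radius I.E ?inv"
        unfolding \<rho>_def by (rule op_spectral_radius_cong[OF subspace_C_space inv_eq])
      obtain B where B: "B > 0" "\<And>k. k \<in> ?N \<Longrightarrow> cmod (w k) \<le> B" using I.bounded_on_F[OF I.cont_v] by blast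
      \<comment> \<open>Since division by 0 yields 0, the inequality with \<open>1 / \<rho>\<close>
        can be inverted only for positive \<open>\<rho>\<close>.\<close>
      have "\<rho> > 0"
        unfolding \<rho>
      proof (rule V.op_spectral_radius_pos[OF Nne])
        show "0 < 1 / B" using B by simp
        fix k assume "k \<in> ?N"
        then have "inv_on ?N k \<in> ?N" by (rule inv_on_mem[OF Nc])
        then show "1 / B \<le> cmod (W.inv_weight ?N k)"
          using B wnz by (auto simp: W.inv_weight_def norm_divide intro!: divide_left_mono)
      qed
      then have "cmod \<mu> < 1 / \<rho> \<longleftrightarrow> \<rho> < 1 / cmod \<mu>" using \<mu>0 by (simp add: field_simps)
      also have "\<dots> \<longleftrightarrow> (\<forall>y\<in>?N. \<exists>n\<ge>1. cmod (cocycle (W.inv_weight ?N) (inv_on ?N) n y) < (1 / cmod \<mu>) ^ n)"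
        unfolding \<rho> using \<mu>0 by (intro V.op_spectral_radius_less_iff[OF Nne]) simp
      also have "\<dots> \<longleftrightarrow> (\<forall>y\<in>?N. \<exists>n\<ge>1. cmod (cocycle (inv_weight ?N) (inv_on ?N) n y) < 1)"
      proof -
        have "cmod (cocycle (W.inv_weight ?N) (inv_on ?N) n y) < (1 / cmod \<mu>) ^ n \<longleftrightarrow>
            cmod (cocycle (inv_weight ?N) (inv_on ?N) n y) < 1" if y: "y \<in> ?N" for n y
        proof -
          have "cocycle (inv_weight ?N) (inv_on ?N) n y = cocycle (W.inv_weight ?N) (inv_on ?N) n y * \<mu> ^ n"
            unfolding cocycle_inverse[OF Nc y] W.cocycle_inverse[OF Nc y] coc by simp
          then have "cmod (cocycle (inv_weight ?N) (inv_on ?N) n y) =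
              cmod (cocycle (W.inv_weight ?N) (inv_on ?N) n y) * cmod \<mu> ^ n"
            by (simp only: norm_mult norm_power)
          then show ?thesis using \<mu>0 by (simp only: power_one_over) (simp add: less_divide_eq)
        qed
        then show ?thesis by blast
      qed
      finally show ?thesis using False nz invertible unfolding \<rho>_def by blast
    qed
  qed
  show ?thesis
    unfolding Fredholm_splitting_def dynamic_splitting_def Let_def c d by (rule refl)
qed

theorem theorem5p1:
  fixes X :: "'a topology" and \<phi> :: "'a \<Rightarrow> 'a" and w :: "'a \<Rightarrow> complex"
    and L M :: "'a set" and \<mu> :: complex
  assumes "compact_space X" and "Hausdorff_space X"
    and "continuous_map X X \<phi>" and "inj_on \<phi> (topspace X)"
    and "\<phi> ` topspace X \<subset> topspace X"
    and "continuous_map X euclidean w"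
    and L_eq: "L = iterated_image_Inter \<phi> (topspace X)"
    and M_eq: "M = topspace X - X interior_of L"
    and "\<mu> \<in> op_spectrum (C_space X (topspace X)) (wcomp w \<phi> (topspace X)) - {0}"
  shows
    "(upper_semi_Fredholm (C_space X (topspace X)) (shifted_op \<mu> (wcomp w \<phi> (topspace X)))
        \<longleftrightarrow>
      upper_semi_Fredholm (C_space X L) (shifted_op \<mu> (wcomp w \<phi> L)) \<and>
      (\<exists>M1 M2. Fredholm_splitting X \<phi> w \<mu> M M1 M2)) \<and>
     (\<forall>M1 M2.
        upper_semi_Fredholm (C_space X L) (shifted_op \<mu> (wcomp w \<phi> L)) \<and>
        Fredholm_splitting X \<phi> w \<mu> M M1 M2 \<longrightarrow>
        (\<mu> \<notin> op_spectrum (C_space X L) (wcomp w \<phi> L) \<longrightarrow> M2 \<noteq> {}) \<and>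
        fun_vs.dim (op_kernel (C_space X (topspace X)) (shifted_op \<mu> (wcomp w \<phi> (topspace X)))) =
          fun_vs.dim (op_kernel (C_space X L) (shifted_op \<mu> (wcomp w \<phi> L))) +
          card (M2 - \<phi> ` M2))"
proof -
  have \<mu>: "\<mu> \<noteq> 0" and spec: "\<mu> \<in> op_spectrum (C_space X (topspace X)) (wcomp w \<phi> (topspace X))"
    using assms(9) by auto
  interpret C: compact_embedding X \<phi> "\<lambda>k. w k / \<mu>"
  proof
    show "continuous_map X euclidean (\<lambda>k. w k / \<mu>)"
      using assms(6) \<mu> unfolding continuous_map_atin limitin_canonical_iff by (auto intro!: tendsto_divide)
  qed (rule assms)+
  have L: "L = C.L" unfolding L_eq C.L_def ..
  have M: "M = C.M" unfolding M_eq L C.M_def ..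
  have sh: "shifted_op \<mu> (wcomp w \<phi> F) = (\<lambda>f. fscale \<mu> (C.D F f))" for F
    using \<mu> by (auto simp: shifted_op_def C.D_def wcomp_def fscale_def fun_eq_iff algebra_simps)
  have D: "C.D F = (\<lambda>f. fscale (1 / \<mu>) (shifted_op \<mu> (wcomp w \<phi> F) f))" for F
    unfolding sh using \<mu> by (simp add: fscale_def)
  have split: "Fredholm_splitting X \<phi> w \<mu> M M1 M2 \<longleftrightarrow> C.dynamic_splitting M1 M2" for M1 M2
    unfolding M by (rule C.Fredholm_splitting_iff_dynamic[OF refl \<mu> assms(6)])
  have usfK: "upper_semi_Fredholm C.CK (shifted_op \<mu> (wcomp w \<phi> C.K)) \<longleftrightarrow> upper_semi_Fredholm C.CK (C.D C.K)"
    and kerK: "op_kernel C.CK (shifted_op \<mu> (wcomp w \<phi> C.K)) = op_kernel C.CK (C.D C.K)"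
    unfolding sh by (rule C.dk.upper_semi_Fredholm_scale[OF \<mu>] C.dk.op_kernel_scale[OF \<mu>])+
  have usfL: "upper_semi_Fredholm C.CL (shifted_op \<mu> (wcomp w \<phi> C.L)) \<longleftrightarrow> upper_semi_Fredholm C.CL (C.D C.L)"
    and kerL: "op_kernel C.CL (shifted_op \<mu> (wcomp w \<phi> C.L)) = op_kernel C.CL (C.D C.L)"
    unfolding sh by (rule C.dl.upper_semi_Fredholm_scale[OF \<mu>] C.dl.op_kernel_scale[OF \<mu>])+
  \<comment> \<open>With \<open>M2\<close> empty, invertibility would lift from \<open>C(L)\<close>
    to \<open>C(K)\<close>, although \<open>\<mu>\<close> belongs to the spectrum there.\<close>
  have nonempty: "M2 \<noteq> {}" if ns: "\<mu> \<notin> op_spectrum C.CL (wcomp w \<phi> C.L)" and s: "C.dynamic_splitting M1 M2" for M1 M2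
  proof
    assume "M2 = {}"
    interpret S: fun_op C.CL "shifted_op \<mu> (wcomp w \<phi> C.L)"
      unfolding sh by (rule fun_op_scale) unfold_locales
    have "op_invertible C.CL (shifted_op \<mu> (wcomp w \<phi> C.L))" using ns by (simp add: op_spectrum_def)
    then have "op_invertible C.CL (C.D C.L)"
      unfolding D[of C.L] using \<mu> by (intro S.op_invertible_scale) auto
    then have "op_invertible C.CK (C.D C.K)"
      using C.invertible_splitting s \<open>M2 = {}\<close> by blast
    then have "op_invertible C.CK (shifted_op \<mu> (wcomp w \<phi> C.K))"
      unfolding sh by (rule C.dk.op_invertible_scale[OF _ \<mu>])
    then show False using spec by (simp add: op_spectrum_def)
  qed
  show ?thesis
    unfolding L split usfK usfL kerK kerL
    using C.upper_semi_Fredholm_iff_splitting C.dim_kernel_splitting nonempty by blast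
qed

end
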